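(* Let $M$ be a finitely generated, integral, cancellative, torsion-free binoid that is regular in codimension $1$. Let $V$ be an open subset of $\operatorname{Spec}M$ such that $M_{\mathfrak p}$ is regular for all $\mathfrak p\in V$. Then $\operatorname{Pic}(V)\cong\operatorname{Cl}(V)$.
   Context: A (commutative) binoid is a commutative monoid $(M,+,0)$ with an absorbing element $\infty$; $M^\bullet=M\smallsetminus\{\infty\}$. It is integral if $M^\bullet$ is a submonoid, cancellative if $a+b=a+c\neq\infty$ implies $b=c$, torsion-free if $na=nb\neq\infty$ with $n\geq1$ implies $a=b$. For $M$ integral and cancellative, $\Gamma^\bullet=-M^\bullet+M^\bullet$ is the difference group of $M$. For a monoid $N$, $N^\infty=N\cup\{\infty\}$ is the binoid obtained by adjoining an absorbing element. The smash product $M\wedge N$ of binoids is $M\times N$ with all pairs having at least one entry $\infty$ identified to $\infty$. A prime ideal is a subset $\mathfrak p\ni\infty$ with $\mathfrak p+M\subseteq\mathfrak p$ and $M\smallsetminus\mathfrak p$ a submonoid. $\operatorname{Spec}M$ is the set of prime ideals with basis of open sets $D(f)=\{\mathfrak p\mid f\notin\mathfrak p\}$. The height $\operatorname{ht}\mathfrak p$ is the maximal length $n$ of a chain $\mathfrak p_0\subsetneq\dots\subsetneq\mathfrak p_n=\mathfrak p$ of primes. $M_{\mathfrak p}$ is the localization at $M\smallsetminus\mathfrak p$. A binoid is regular if it is isomorphic to $G^\infty\wedge(\mathbb N^s)^\infty$ for some abelian group $G$ and $s\in\mathbb N$; $M$ is regular in codimension $1$ if $M_{\mathfrak p}$ is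 regular for every prime $\mathfrak p$ of height at most $1$. The structure sheaf $\mathcal O_M$ is the sheaf of binoids with $\mathcal O_M(D(f))=M_f$. For an open subset $U$, $\operatorname{Pic}(U)$ is the group of isomorphism classes of sheaves of $\mathcal O_M|_U$-sets locally isomorphic to $\mathcal O_M|_U$, under the smash product over $\mathcal O_M|_U$; it is isomorphic to $\mathrm H^1(U,\mathcal O_M^*|_U)$. For a prime $\mathfrak p$ of height $1$, regularity gives $M_{\mathfrak p}^\bullet\cong\mathbb Z^{r-1}\times\mathbb N$ and $\Gamma^\bullet\cong\mathbb Z^{r-1}\times\mathbb Z$; the valuation $v_{\mathfrak p}:\Gamma^\bullet\to\mathbb Z$ is the projection to the last factor. For an open $V\subseteq\operatorname{Spec}M$, put $\operatorname{Div}(V)=\bigoplus_{\mathfrak p\in V,\ \operatorname{ht}\mathfrak p=1}\mathbb Z\mathfrak p$, let $\operatorname{Prin}(V)$ be the image of $\Gamma^\bullet\to\operatorname{Div}(V)$, $q\mapsto\sum_{\mathfrak p}v_{\mathfrak p}(q)\mathfrak p$, and $\operatorname{Cl}(V)=\operatorname{Div}(V)/\operatorname{Prin}(V)$. *)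

theory Defs
  imports
    "HOL-Algebra.Free_Abelian_Groups"
    "HOL-Algebra.Coset"
    "HOL-Library.Extended_Nat"
    "HOL-Analysis.Abstract_Topology"
begin

section \<open>Binoids\<close>

text \<open>Binoids extend the monoids of \<open>HOL-Algebra\<close>, so the additive notation $a + b$, $0$, $n a$
  of the literature becomes \<open>a \<otimes> b\<close>, \<open>\<one>\<close>, \<open>a [^] n\<close>; \<open>absorb\<close> is the absorbing element $\infty$.\<close>

record 'a binoid = "'a monoid" +
  absorb :: 'a

locale binoid = comm_monoid M for M :: "'a binoid" (structure) +
  assumes absorb_closed: "absorb M \<in> carrier M"
    and absorb_mult: "x \<in> carrier M \<Longrightarrow> absorb M \<otimes> x = absorb M"

definition nonabsorb :: "'a binoid \<Rightarrow> 'a set" where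
  "nonabsorb M = carrier M - {absorb M}"

definition integral_binoid :: "'a binoid \<Rightarrow> bool" where
  "integral_binoid M \<longleftrightarrow> submonoid (nonabsorb M) M"

definition cancellative_binoid :: "'a binoid \<Rightarrow> bool" where
  "cancellative_binoid M \<longleftrightarrow>
     (\<forall>a\<in>carrier M. \<forall>b\<in>carrier M. \<forall>c\<in>carrier M.
        a \<otimes>\<^bsub>M\<^esub> b = a \<otimes>\<^bsub>M\<^esub> c \<longrightarrow> a \<otimes>\<^bsub>M\<^esub> b \<noteq> absorb M \<longrightarrow> b = c)"

definition torsion_free_binoid :: "'a binoid \<Rightarrow> bool" where
  "torsion_free_binoid M \<longleftrightarrow>
     (\<forall>a\<in>carrier M. \<forall>b\<in>carrier M. \<forall>n::nat. n \<ge> 1 \<longrightarrow>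
        a [^]\<^bsub>M\<^esub> n = b [^]\<^bsub>M\<^esub> n \<longrightarrow> a [^]\<^bsub>M\<^esub> n \<noteq> absorb M \<longrightarrow> a = b)"

definition finitely_generated_binoid :: "'a binoid \<Rightarrow> bool" where
  "finitely_generated_binoid M \<longleftrightarrow>
     (\<exists>A. finite A \<and> A \<subseteq> carrier M \<and>
        (\<forall>H. submonoid H M \<and> absorb M \<in> H \<and> A \<subseteq> H \<longrightarrow> H = carrier M))"

definition binoid_iso :: "'a binoid \<Rightarrow> 'b binoid \<Rightarrow> ('a \<Rightarrow> 'b) set" where
  "binoid_iso M N = {h \<in> iso M N. h \<one>\<^bsub>M\<^esub> = \<one>\<^bsub>N\<^esub> \<and> h (absorb M) = absorb N}"

definition adjoin_absorb :: "('a, 'c) monoid_scheme \<Rightarrow> 'a option binoid" where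
  "adjoin_absorb N =
     \<lparr>carrier = insert None (Some ` carrier N),
      monoid.mult = (\<lambda>x y. case (x, y) of (Some a, Some b) \<Rightarrow> Some (a \<otimes>\<^bsub>N\<^esub> b) | _ \<Rightarrow> None),
      one = Some \<one>\<^bsub>N\<^esub>,
      absorb = None\<rparr>"

text \<open>The class of all pairs with an entry $\infty$ is represented by the pair $(\infty,\infty)$.\<close>

definition smash_collapse :: "'a binoid \<Rightarrow> 'b binoid \<Rightarrow> 'a \<times> 'b \<Rightarrow> 'a \<times> 'b" where
  "smash_collapse M N x =
     (if fst x = absorb M \<or> snd x = absorb N then (absorb M, absorb N) else x)"

definition smash :: "'a binoid \<Rightarrow> 'b binoid \<Rightarrow> ('a \<times> 'b) binoid" where
  "smash M N =
     \<lparr>carrier = smash_collapse M N ` (carrier M \<times> carrier N),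
      monoid.mult = (\<lambda>x y. smash_collapse M N (fst x \<otimes>\<^bsub>M\<^esub> fst y, snd x \<otimes>\<^bsub>N\<^esub> snd y)),
      one = smash_collapse M N (\<one>\<^bsub>M\<^esub>, \<one>\<^bsub>N\<^esub>),
      absorb = (absorb M, absorb N)\<rparr>"

definition nat_monoid :: "nat monoid" where
  "nat_monoid = \<lparr>carrier = UNIV, monoid.mult = (+), one = 0\<rparr>"

text \<open>The group \<open>G\<close> may be sought on the element type of \<open>B\<close> itself: whenever
  $B \cong G^\infty \wedge (\mathbb{N}^s)^\infty$, the group $G$ is isomorphic to the unit group of $B$.
  The library's \<open>product_group\<close> makes sense for monoids.\<close>

definition regular_binoid :: "'b binoid \<Rightarrow> bool" where
  "regular_binoid B \<longleftrightarrow>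
     (\<exists>(G :: 'b monoid) (s :: nat). comm_group G \<and>
        binoid_iso B
          (smash (adjoin_absorb G)
                 (adjoin_absorb (product_group {..<s} (\<lambda>_. nat_monoid)))) \<noteq> {})"


section \<open>Localization and the difference group\<close>

definition fraction :: "'a binoid \<Rightarrow> 'a set \<Rightarrow> 'a \<Rightarrow> 'a \<Rightarrow> ('a \<times> 'a) set" where
  "fraction M S a s =
     {(b, t). b \<in> carrier M \<and> t \<in> S \<and> (\<exists>u\<in>S. u \<otimes>\<^bsub>M\<^esub> (a \<otimes>\<^bsub>M\<^esub> t) = u \<otimes>\<^bsub>M\<^esub> (b \<otimes>\<^bsub>M\<^esub> s))}"

definition localization :: "'a binoid \<Rightarrow> 'a set \<Rightarrow> ('a \<times> 'a) set binoid" where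
  "localization M S =
     \<lparr>carrier = {fraction M S a s | a s. a \<in> carrier M \<and> s \<in> S},
      monoid.mult = (\<lambda>x y. \<Union>(a, s)\<in>x. \<Union>(b, t)\<in>y. fraction M S (a \<otimes>\<^bsub>M\<^esub> b) (s \<otimes>\<^bsub>M\<^esub> t)),
      one = fraction M S \<one>\<^bsub>M\<^esub> \<one>\<^bsub>M\<^esub>,
      absorb = fraction M S (absorb M) \<one>\<^bsub>M\<^esub>\<rparr>"

definition diff_group :: "'a binoid \<Rightarrow> ('a \<times> 'a) set monoid" where
  "diff_group M =
     \<lparr>carrier = nonabsorb (localization M (nonabsorb M)),
      monoid.mult = monoid.mult (localization M (nonabsorb M)),
      one = \<one>\<^bsub>localization M (nonabsorb M)\<^esub>\<rparr>"


section \<open>The spectrum\<close>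

definition prime_ideal :: "'a binoid \<Rightarrow> 'a set \<Rightarrow> bool" where
  "prime_ideal M p \<longleftrightarrow>
     p \<subseteq> carrier M \<and> absorb M \<in> p \<and>
     (\<forall>a\<in>p. \<forall>b\<in>carrier M. a \<otimes>\<^bsub>M\<^esub> b \<in> p) \<and>
     submonoid (carrier M - p) M"

definition basic_open :: "'a binoid \<Rightarrow> 'a \<Rightarrow> 'a set set" where
  "basic_open M f = {p. prime_ideal M p \<and> f \<notin> p}"

definition Spec :: "'a binoid \<Rightarrow> 'a set topology" where
  "Spec M = topology_generated_by (basic_open M ` carrier M)"

definition height :: "'a binoid \<Rightarrow> 'a set \<Rightarrow> enat" where
  "height M p =
     Sup {enat n | n. \<exists>c :: nat \<Rightarrow> 'a set.
            (\<forall>i\<le>n. prime_ideal M (c i)) \<and> (\<forall>i<n. c i \<subset> c (Suc i)) \<and> c n = p}"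

abbreviation localization_at :: "'a binoid \<Rightarrow> 'a set \<Rightarrow> ('a \<times> 'a) set binoid" where
  "localization_at M p \<equiv> localization M (carrier M - p)"

definition regular_in_codim_one :: "'a binoid \<Rightarrow> bool" where
  "regular_in_codim_one M \<longleftrightarrow>
     (\<forall>p. prime_ideal M p \<and> height M p \<le> 1 \<longrightarrow> regular_binoid (localization_at M p))"


section \<open>Sheaves of binoids and of sets with an action\<close>

text \<open>Data on non-open sets is irrelevant throughout; consequently the restriction of a (pre)sheaf
  on \<open>X\<close> to an open subset \<open>U\<close> is the same record, viewed over \<open>subtopology X U\<close>.\<close>

record ('x, 'o) binoid_presheaf =
  binoid_of :: "'x set \<Rightarrow> 'o binoid"
  restr :: "'x set \<Rightarrow> 'x set \<Rightarrow> 'o \<Rightarrow> 'o"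

text \<open>Sections over \<open>U\<close> assign to each point \<open>p\<close> of \<open>U\<close> an element of \<open>M\<^sub>p\<close>, locally given by
  fractions.  This makes sense for every open \<open>U\<close>, and lemma \<open>structure_sheaf_basic_open\<close> below
  identifies the binoid of sections over \<open>D(f)\<close> with \<open>M\<^sub>f\<close>.\<close>

definition structure_sheaf :: "'a binoid \<Rightarrow> ('a set, 'a set \<Rightarrow> ('a \<times> 'a) set) binoid_presheaf" where
  "structure_sheaf M =
     \<lparr>binoid_of = (\<lambda>U.
        \<lparr>carrier = {\<sigma> \<in> extensional U. \<forall>p\<in>U. \<exists>W a f.
             openin (Spec M) W \<and> p \<in> W \<and> W \<subseteq> U \<and> a \<in> carrier M \<and> f \<in> carrier M \<and>
             (\<forall>q\<in>W. f \<notin> q \<and> \<sigma> q = fraction M (carrier M - q) a f)},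
         monoid.mult = (\<lambda>\<sigma> \<tau>. \<lambda>p\<in>U. \<sigma> p \<otimes>\<^bsub>localization_at M p\<^esub> \<tau> p),
         one = (\<lambda>p\<in>U. \<one>\<^bsub>localization_at M p\<^esub>),
         absorb = (\<lambda>p\<in>U. absorb (localization_at M p))\<rparr>),
      restr = (\<lambda>U W \<sigma>. restrict \<sigma> W)\<rparr>"

subsection \<open>Sections over basic open sets\<close>

context binoid
begin

lemma fraction_mem_iff:
  "(b, t) \<in> fraction M S a s \<longleftrightarrow> b \<in> carrier M \<and> t \<in> S \<and> (\<exists>u\<in>S. u \<otimes> (a \<otimes> t) = u \<otimes> (b \<otimes> s))"
  by (simp add: fraction_def)

lemma fraction_refl:
  assumes "submonoid S M" "a \<in> carrier M" "s \<in> S"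
  shows "(a, s) \<in> fraction M S a s"
  using assms submonoid.one_closed[OF assms(1)] by (auto simp: fraction_mem_iff)

lemma fraction_trans:
  assumes S: "submonoid S M"
    and c: "a \<in> carrier M" "s \<in> S" "b \<in> carrier M" "t \<in> S" "c \<in> carrier M" "r \<in> S"
    and u: "u \<in> S" "u \<otimes> (a \<otimes> t) = u \<otimes> (b \<otimes> s)"
    and v: "v \<in> S" "v \<otimes> (b \<otimes> r) = v \<otimes> (c \<otimes> t)"
  shows "\<exists>w\<in>S. w \<otimes> (a \<otimes> r) = w \<otimes> (c \<otimes> s)"
proof -
  have SM: "x \<in> carrier M" if "x \<in> S" for x
    using submonoid.subset[OF S] that by blast
  note C = c(1) c(3) c(5) SM[OF c(2)] SM[OF c(4)] SM[OF c(6)] SM[OF u(1)] SM[OF v(1)]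
  have "(u \<otimes> v \<otimes> t) \<otimes> (a \<otimes> r) = (u \<otimes> (a \<otimes> t)) \<otimes> (v \<otimes> r)" using C by (simp add: m_ac)
  also have "\<dots> = (v \<otimes> (b \<otimes> r)) \<otimes> (u \<otimes> s)" unfolding u(2) using C by (simp add: m_ac)
  also have "\<dots> = (u \<otimes> v \<otimes> t) \<otimes> (c \<otimes> s)" unfolding v(2) using C by (simp add: m_ac)
  finally show ?thesis
    using u(1) v(1) c(4) submonoid.m_closed[OF S] by blast
qed

lemma fraction_eq_iff:
  assumes S: "submonoid S M" and c: "a \<in> carrier M" "s \<in> S" "b \<in> carrier M" "t \<in> S"
  shows "fraction M S a s = fraction M S b t \<longleftrightarrow> (\<exists>u\<in>S. u \<otimes> (a \<otimes> t) = u \<otimes> (b \<otimes> s))"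
proof
  assume "fraction M S a s = fraction M S b t"
  then show "\<exists>u\<in>S. u \<otimes> (a \<otimes> t) = u \<otimes> (b \<otimes> s)"
    using fraction_refl[OF S c(3,4)] by (metis fraction_mem_iff)
next
  assume "\<exists>u\<in>S. u \<otimes> (a \<otimes> t) = u \<otimes> (b \<otimes> s)"
  then obtain u where u: "u \<in> S" "u \<otimes> (a \<otimes> t) = u \<otimes> (b \<otimes> s)" by blast
  have "(d, r) \<in> fraction M S a s \<longleftrightarrow> (d, r) \<in> fraction M S b t" for d r
    unfolding fraction_mem_iff
    using fraction_trans[OF S c(3,4) c(1,2) _ _ u(1) u(2)[symmetric]] fraction_trans[OF S c _ _ u] by meson
  then show "fraction M S a s = fraction M S b t" by auto
qed

lemma fraction_eq_of_mem:
  assumes S: "submonoid S M" and "a \<in> carrier M" "s \<in> S" "(b, t) \<in> fraction M S a s"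
  shows "fraction M S b t = fraction M S a s"
proof -
  obtain u where u: "b \<in> carrier M" "t \<in> S" "u \<in> S" "u \<otimes> (a \<otimes> t) = u \<otimes> (b \<otimes> s)"
    using assms(4) unfolding fraction_mem_iff by blast
  show ?thesis
    unfolding fraction_eq_iff[OF S u(1,2) assms(2,3)] using u(3) u(4)[symmetric] by blast
qed

lemma localization_mult:
  assumes S: "submonoid S M" and c: "a \<in> carrier M" "s \<in> S" "b \<in> carrier M" "t \<in> S"
  shows "fraction M S a s \<otimes>\<^bsub>localization M S\<^esub> fraction M S b t = fraction M S (a \<otimes> b) (s \<otimes> t)"
proof -
  have SM: "x \<in> carrier M" if "x \<in> S" for x
    using submonoid.subset[OF S] that by blast
  have "fraction M S (a' \<otimes> b') (s' \<otimes> t') = fraction M S (a \<otimes> b) (s \<otimes> t)"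
    if m: "(a', s') \<in> fraction M S a s" "(b', t') \<in> fraction M S b t" for a' s' b' t'
  proof -
    obtain u v where uv: "u \<in> S" "u \<otimes> (a \<otimes> s') = u \<otimes> (a' \<otimes> s)"
        "v \<in> S" "v \<otimes> (b \<otimes> t') = v \<otimes> (b' \<otimes> t)"
      and c': "a' \<in> carrier M" "s' \<in> S" "b' \<in> carrier M" "t' \<in> S"
      using m unfolding fraction_mem_iff by blast
    note C = c(1,3) c'(1,3) SM[OF c(2)] SM[OF c(4)] SM[OF c'(2)] SM[OF c'(4)]
      SM[OF uv(1)] SM[OF uv(3)]
    have "(u \<otimes> v) \<otimes> ((a' \<otimes> b') \<otimes> (s \<otimes> t)) = (u \<otimes> (a' \<otimes> s)) \<otimes> (v \<otimes> (b' \<otimes> t))"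
      using C by (simp add: m_ac)
    also have "\<dots> = (u \<otimes> (a \<otimes> s')) \<otimes> (v \<otimes> (b \<otimes> t'))" using uv by simp
    also have "\<dots> = (u \<otimes> v) \<otimes> ((a \<otimes> b) \<otimes> (s' \<otimes> t'))" using C by (simp add: m_ac)
    finally show ?thesis
      using c c' uv(1,3) submonoid.m_closed[OF S] by (subst fraction_eq_iff[OF S]) auto
  qed
  then have "fraction M S a s \<otimes>\<^bsub>localization M S\<^esub> fraction M S b t
      = (\<Union>_\<in>fraction M S a s. \<Union>_\<in>fraction M S b t. fraction M S (a \<otimes> b) (s \<otimes> t))"
    unfolding localization_def monoid.simps by (intro SUP_cong refl) auto
  moreover have "fraction M S a s \<noteq> {}" "fraction M S b t \<noteq> {}"
    using fraction_refl[OF S c(1,2)] fraction_refl[OF S c(3,4)] by blast+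
  ultimately show ?thesis by simp
qed

lemma submonoid_powers:
  assumes "f \<in> carrier M"
  shows "submonoid (range (\<lambda>n::nat. f [^] n)) M"
proof (rule submonoid.intro)
  show "\<one> \<in> range (\<lambda>n::nat. f [^] n)" by (metis nat_pow_0 rangeI)
qed (use assms in \<open>auto simp: nat_pow_mult\<close>)

lemma openin_Spec_contains_basic:
  assumes "openin (Spec M) W" "p \<in> W"
  shows "\<exists>g\<in>carrier M. p \<in> basic_open M g \<and> basic_open M g \<subseteq> W"
proof -
  have "generate_topology_on (basic_open M ` carrier M) W"
    using assms(1) by (simp add: Spec_def openin_topology_generated_by_iff)
  then show ?thesis using assms(2)
  proof (induction arbitrary: p rule: generate_topology_on.induct)
    case (Int a b)
    then obtain g h where g: "g \<in> carrier M" "p \<in> basic_open M g" "basic_open M g \<subseteq> a"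
      and h: "h \<in> carrier M" "p \<in> basic_open M h" "basic_open M h \<subseteq> b" by blast
    have sub: "basic_open M (g \<otimes> h) \<subseteq> basic_open M g \<inter> basic_open M h"
      using g(1) h(1) m_comm[OF g(1) h(1)]
      by (auto simp: basic_open_def prime_ideal_def) metis
    have "g \<otimes> h \<in> carrier M - p"
      using g h submonoid.m_closed by (fastforce simp: basic_open_def prime_ideal_def)
    then show ?case using sub g h by (auto simp: basic_open_def intro!: bexI[of _ "g \<otimes> h"])
  next
    case (UN K)
    then show ?case by (meson UnionE Union_upper subset_trans)
  qed auto
qed

lemma structure_sheaf_basic_open:
  assumes f: "f \<in> carrier M"
  defines "S \<equiv> range (\<lambda>n::nat. f [^] n)"
  shows "(\<lambda>x. \<lambda>p\<in>basic_open M f. \<Union>(a, s)\<in>x. fraction M (carrier M - p) a s)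
           \<in> binoid_iso (localization M S) (binoid_of (structure_sheaf M) (basic_open M f))"
proof -
  let ?D = "basic_open M f"
  let ?O = "binoid_of (structure_sheaf M) ?D"
  define h where "h = (\<lambda>x. \<lambda>p\<in>?D. \<Union>(a, s)\<in>x. fraction M (carrier M - p) a s)"
  have S: "submonoid S M" unfolding S_def by (rule submonoid_powers[OF f])
  have SM: "x \<in> carrier M" if "x \<in> S" for x
    using submonoid.subset[OF S] that by blast
  have sub: "submonoid (carrier M - p) M" if "p \<in> ?D" for p
    using that by (simp add: basic_open_def prime_ideal_def)
  have Sp: "S \<subseteq> carrier M - p" if "p \<in> ?D" for p
  proof -
    have "f [^] n \<in> carrier M - p" for n :: nat
    proof (induction n)
      case (Suc n)
      then show ?case
        using submonoid.m_closed[OF sub[OF that], of "f [^] n" f] f that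
        by (auto simp: basic_open_def)
    qed (use submonoid.one_closed[OF sub[OF that]] in auto)
    then show ?thesis unfolding S_def by blast
  qed
  have h_fraction: "h (fraction M S a s) = (\<lambda>p\<in>?D. fraction M (carrier M - p) a s)"
    if "a \<in> carrier M" "s \<in> S" for a s
  proof -
    have "(\<Union>(b, t)\<in>fraction M S a s. fraction M (carrier M - p) b t) = fraction M (carrier M - p) a s"
      if p: "p \<in> ?D" for p
    proof -
      have "fraction M (carrier M - p) b t = fraction M (carrier M - p) a s" if "(b, t) \<in> fraction M S a s" for b t
        using that \<open>a \<in> carrier M\<close> \<open>s \<in> S\<close> Sp[OF p]
        by (intro fraction_eq_of_mem[OF sub[OF p]]) (auto simp: fraction_mem_iff)
      then have "(\<Union>(b, t)\<in>fraction M S a s. fraction M (carrier M - p) b t)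
                   = (\<Union>_\<in>fraction M S a s. fraction M (carrier M - p) a s)"
        by (intro SUP_cong) auto
      moreover have "fraction M S a s \<noteq> {}"
        using fraction_refl[OF S \<open>a \<in> carrier M\<close> \<open>s \<in> S\<close>] by blast
      ultimately show ?thesis by simp
    qed
    then show ?thesis unfolding h_def by (intro restrict_ext) auto
  qed
  have D_open: "openin (Spec M) ?D"
    unfolding Spec_def openin_topology_generated_by_iff
    using f by (intro generate_topology_on.Basis) auto
  have carr: "carrier (localization M S) = {fraction M S a s | a s. a \<in> carrier M \<and> s \<in> S}"
    by (simp add: localization_def)
  have carrE: "\<exists>a s. x = fraction M S a s \<and> a \<in> carrier M \<and> s \<in> S"
    if "x \<in> carrier (localization M S)" for x
    using that unfolding carr by (rule CollectD)
  have carrO: "carrier ?O = {\<sigma> \<in> extensional ?D. \<forall>p\<in>?D. \<exists>W a g.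
             openin (Spec M) W \<and> p \<in> W \<and> W \<subseteq> ?D \<and> a \<in> carrier M \<and> g \<in> carrier M \<and>
             (\<forall>q\<in>W. g \<notin> q \<and> \<sigma> q = fraction M (carrier M - q) a g)}"
    by (simp add: structure_sheaf_def)
  have h_closed: "h x \<in> carrier ?O" if x': "x \<in> carrier (localization M S)" for x
  proof -
    obtain a s where x: "x = fraction M S a s" "a \<in> carrier M" "s \<in> S" using carrE[OF x'] by blast
    have "s \<notin> q" if "q \<in> ?D" for q using Sp[OF that] x(3) by blast
    then have "\<forall>q\<in>?D. s \<notin> q \<and> h x q = fraction M (carrier M - q) a s"
      unfolding x(1) h_fraction[OF x(2,3)] by simp
    moreover have "h x \<in> extensional ?D" by (simp add: h_def)
    ultimately show ?thesis
      unfolding carrO using x(2) SM[OF x(3)] D_open by blast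
  qed
  have hom: "h \<in> hom (localization M S) ?O"
  proof (rule homI)
    fix x y assume xy: "x \<in> carrier (localization M S)" "y \<in> carrier (localization M S)"
    obtain a s where x: "x = fraction M S a s" "a \<in> carrier M" "s \<in> S"
      using carrE[OF xy(1)] by blast
    obtain b t where y: "y = fraction M S b t" "b \<in> carrier M" "t \<in> S"
      using carrE[OF xy(2)] by blast
    have st: "s \<otimes> t \<in> S" using x y submonoid.m_closed[OF S] by blast
    have "fraction M (carrier M - p) (a \<otimes> b) (s \<otimes> t)
            = fraction M (carrier M - p) a s \<otimes>\<^bsub>localization_at M p\<^esub> fraction M (carrier M - p) b t"
      if "p \<in> ?D" for p
      by (rule localization_mult[OF sub[OF that] x(2) subsetD[OF Sp[OF that] x(3)]
            y(2) subsetD[OF Sp[OF that] y(3)], symmetric])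
    then show "h (x \<otimes>\<^bsub>localization M S\<^esub> y) = h x \<otimes>\<^bsub>?O\<^esub> h y"
      unfolding x(1) y(1) localization_mult[OF S x(2,3) y(2,3)]
        h_fraction[OF x(2,3)] h_fraction[OF y(2,3)] h_fraction[OF m_closed[OF x(2) y(2)] st]
      by (auto simp: structure_sheaf_def intro!: restrict_ext)
  qed (rule h_closed)
  have bij: "bij_betw h (carrier (localization M S)) (carrier ?O)"
  proof (cases "absorb M \<in> S")
    case True
    have "absorb M \<in> p" if "p \<in> ?D" for p using that by (simp add: basic_open_def prime_ideal_def)
    then have D_empty: "?D = {}" using Sp True by blast
    have one: "fraction M S a s = fraction M S (absorb M) \<one>" if "a \<in> carrier M" "s \<in> S" for a s
      using that True absorb_closed SM submonoid.one_closed[OF S] absorb_mult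
      by (subst fraction_eq_iff[OF S]) (auto intro!: bexI[of _ "absorb M"])
    have "carrier (localization M S) = {fraction M S (absorb M) \<one>}"
      unfolding carr using one absorb_closed submonoid.one_closed[OF S] by blast
    moreover have "carrier ?O = {\<lambda>_. undefined}" by (simp add: structure_sheaf_def D_empty)
    ultimately show ?thesis by (simp add: bij_betw_def h_def D_empty fun_eq_iff)
  next
    case False
    define P where "P = {a \<in> carrier M. \<forall>b\<in>carrier M. a \<otimes> b \<notin> S}"
    have notP: "a \<notin> P \<longleftrightarrow> (\<exists>b\<in>carrier M. a \<otimes> b \<in> S)" if "a \<in> carrier M" for a
      using that by (auto simp: P_def)
    have "submonoid (carrier M - P) M"
    proof (rule submonoid.intro)
      have "\<one> \<otimes> \<one> \<in> S" using submonoid.one_closed[OF S] by simp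
      then show "\<one> \<in> carrier M - P" using notP[OF one_closed] by blast
      fix x y assume "x \<in> carrier M - P" "y \<in> carrier M - P"
      then obtain b c where xy: "x \<in> carrier M" "y \<in> carrier M" "b \<in> carrier M" "c \<in> carrier M"
        "x \<otimes> b \<in> S" "y \<otimes> c \<in> S" unfolding P_def by blast
      have "(x \<otimes> y) \<otimes> (b \<otimes> c) = (x \<otimes> b) \<otimes> (y \<otimes> c)" using xy by (simp add: m_ac)
      also have "\<dots> \<in> S" using xy submonoid.m_closed[OF S] by blast
      finally show "x \<otimes> y \<in> carrier M - P"
        using notP[OF m_closed[OF xy(1,2)]] m_closed[OF xy(1,2)] m_closed[OF xy(3,4)] by blast
    qed auto
    moreover have "a \<otimes> b \<in> P" if "a \<in> P" "b \<in> carrier M" for a b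
      using that by (auto simp: P_def m_assoc)
    moreover have "absorb M \<in> P" using False absorb_closed absorb_mult by (auto simp: P_def)
    moreover have "f \<notin> P"
    proof -
      have "f \<otimes> \<one> = f [^] (1::nat)" using f by simp
      then have "f \<otimes> \<one> \<in> S" unfolding S_def by blast
      then show ?thesis using notP[OF f] by blast
    qed
    ultimately have PD: "P \<in> ?D" by (auto simp: basic_open_def prime_ideal_def P_def)
    have inv: "\<exists>b\<in>carrier M. g \<otimes> b \<in> S" if "g \<in> carrier M" "g \<notin> P" for g
      using that notP by blast
    have inj: "inj_on h (carrier (localization M S))"
    proof (rule inj_onI)
      fix x y assume xy: "x \<in> carrier (localization M S)" "y \<in> carrier (localization M S)"
        and e: "h x = h y"
      obtain a s where x: "x = fraction M S a s" "a \<in> carrier M" "s \<in> S"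
        using carrE[OF xy(1)] by blast
      obtain b t where y: "y = fraction M S b t" "b \<in> carrier M" "t \<in> S"
        using carrE[OF xy(2)] by blast
      have "h x P = h y P" using e by simp
      then have "fraction M (carrier M - P) a s = fraction M (carrier M - P) b t"
        unfolding x(1) y(1) h_fraction[OF x(2,3)] h_fraction[OF y(2,3)] using PD by simp
      then obtain u where u: "u \<in> carrier M" "u \<notin> P" "u \<otimes> (a \<otimes> t) = u \<otimes> (b \<otimes> s)"
        unfolding fraction_eq_iff[OF sub[OF PD] x(2) subsetD[OF Sp[OF PD] x(3)]
            y(2) subsetD[OF Sp[OF PD] y(3)]] by blast
      obtain c where c: "c \<in> carrier M" "u \<otimes> c \<in> S" using inv u by blast
      note C = x(2) y(2) SM[OF x(3)] SM[OF y(3)] u(1) c(1)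
      have "(u \<otimes> c) \<otimes> (a \<otimes> t) = c \<otimes> (u \<otimes> (a \<otimes> t))" using C by (simp add: m_ac)
      also have "\<dots> = (u \<otimes> c) \<otimes> (b \<otimes> s)" unfolding u(3) using C by (simp add: m_ac)
      finally show "x = y" unfolding x(1) y(1) fraction_eq_iff[OF S x(2,3) y(2,3)] using c(2) by blast
    qed
    have "\<exists>x\<in>carrier (localization M S). h x = \<sigma>" if \<sigma>: "\<sigma> \<in> carrier ?O" for \<sigma>
    proof -
      obtain W a g where W: "openin (Spec M) W" "P \<in> W" "a \<in> carrier M" "g \<in> carrier M"
        and q: "\<forall>q\<in>W. g \<notin> q \<and> \<sigma> q = fraction M (carrier M - q) a g"
        using \<sigma> PD unfolding carrO by blast
      obtain k where k: "k \<in> carrier M" "P \<in> basic_open M k" "basic_open M k \<subseteq> W"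
        using openin_Spec_contains_basic[OF W(1,2)] by blast
      obtain b where b: "b \<in> carrier M" "k \<otimes> b \<in> S" using inv k by (auto simp: basic_open_def)
      obtain c where c: "c \<in> carrier M" "g \<otimes> c \<in> S" using inv W q by blast
      have DW: "?D \<subseteq> W"
      proof
        fix p assume p: "p \<in> ?D"
        have "k \<notin> p"
          using Sp[OF p] b p by (auto simp: basic_open_def prime_ideal_def)
        then show "p \<in> W" using p k(3) by (auto simp: basic_open_def)
      qed
      have "\<sigma> p = fraction M (carrier M - p) (a \<otimes> c) (g \<otimes> c)" if p: "p \<in> ?D" for p
      proof -
        have pW: "p \<in> W" using DW p by blast
        have gp: "g \<in> carrier M - p" and \<sigma>p: "\<sigma> p = fraction M (carrier M - p) a g"
          using q pW W(4) by simp_all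
        have "a \<otimes> (g \<otimes> c) = (a \<otimes> c) \<otimes> g" using W(3,4) c(1) by (simp add: m_ac)
        then show ?thesis unfolding \<sigma>p
            fraction_eq_iff[OF sub[OF p] W(3) gp m_closed[OF W(3) c(1)] subsetD[OF Sp[OF p] c(2)]]
          using submonoid.one_closed[OF sub[OF p]] by metis
      qed
      moreover have "\<sigma> \<in> extensional ?D" using \<sigma> carrO by simp
      ultimately have "h (fraction M S (a \<otimes> c) (g \<otimes> c)) = \<sigma>"
        unfolding h_fraction[OF m_closed[OF W(3) c(1)] c(2)]
        by (auto simp: fun_eq_iff extensional_def)
      then show ?thesis unfolding carr using m_closed[OF W(3) c(1)] c(2) by blast
    qed
    then have "h ` carrier (localization M S) = carrier ?O" using h_closed by blast
    with inj show ?thesis by (simp add: bij_betw_def)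
  qed
  have "h \<one>\<^bsub>localization M S\<^esub> = \<one>\<^bsub>?O\<^esub>" "h (absorb (localization M S)) = absorb ?O"
    using h_fraction[OF one_closed submonoid.one_closed[OF S]]
      h_fraction[OF absorb_closed submonoid.one_closed[OF S]]
    by (simp_all add: localization_def structure_sheaf_def)
  with hom bij show ?thesis unfolding h_def binoid_iso_def iso_def by blast
qed

end


subsection \<open>Sheaves of sets with an action of a sheaf of binoids\<close>

text \<open>A set with an action of a binoid is pointed, and \<open>\<infinity>\<close> sends everything to the base point.\<close>

locale binoid_set = binoid M for M :: "'o binoid" (structure) +
  fixes S :: "'s set" and act :: "'o \<Rightarrow> 's \<Rightarrow> 's" and pt :: 's
  assumes pt_closed: "pt \<in> S"
    and act_closed: "a \<in> carrier M \<Longrightarrow> s \<in> S \<Longrightarrow> act a s \<in> S"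
    and act_mult: "a \<in> carrier M \<Longrightarrow> b \<in> carrier M \<Longrightarrow> s \<in> S \<Longrightarrow> act (a \<otimes> b) s = act a (act b s)"
    and act_one: "s \<in> S \<Longrightarrow> act \<one> s = s"
    and act_absorb: "s \<in> S \<Longrightarrow> act (absorb M) s = pt"
    and act_pt: "a \<in> carrier M \<Longrightarrow> act a pt = pt"

record ('x, 'o, 's) oset_presheaf =
  sections :: "'x set \<Rightarrow> 's set"
  res :: "'x set \<Rightarrow> 'x set \<Rightarrow> 's \<Rightarrow> 's"
  action :: "'x set \<Rightarrow> 'o \<Rightarrow> 's \<Rightarrow> 's"
  point :: "'x set \<Rightarrow> 's"

locale oset_sheaf =
  fixes X :: "'x topology" and \<O> :: "('x, 'o) binoid_presheaf" and L :: "('x, 'o, 's) oset_presheaf"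
  assumes sections_set:
      "openin X U \<Longrightarrow> binoid_set (binoid_of \<O> U) (sections L U) (action L U) (point L U)"
    and res_closed:
      "openin X U \<Longrightarrow> openin X W \<Longrightarrow> W \<subseteq> U \<Longrightarrow> s \<in> sections L U \<Longrightarrow> res L U W s \<in> sections L W"
    and res_id: "openin X U \<Longrightarrow> s \<in> sections L U \<Longrightarrow> res L U U s = s"
    and res_comp:
      "openin X U \<Longrightarrow> openin X W \<Longrightarrow> openin X T \<Longrightarrow> T \<subseteq> W \<Longrightarrow> W \<subseteq> U \<Longrightarrow> s \<in> sections L U \<Longrightarrow>
         res L W T (res L U W s) = res L U T s"
    and res_action:
      "openin X U \<Longrightarrow> openin X W \<Longrightarrow> W \<subseteq> U \<Longrightarrow> a \<in> carrier (binoid_of \<O> U) \<Longrightarrow> s \<in> sections L U \<Longrightarrow>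
         res L U W (action L U a s) = action L W (restr \<O> U W a) (res L U W s)"
    and res_point: "openin X U \<Longrightarrow> openin X W \<Longrightarrow> W \<subseteq> U \<Longrightarrow> res L U W (point L U) = point L W"
    and glue:
      "(\<And>U. U \<in> \<U> \<Longrightarrow> openin X U) \<Longrightarrow> (\<And>U. U \<in> \<U> \<Longrightarrow> \<sigma> U \<in> sections L U) \<Longrightarrow>
       (\<And>U W. U \<in> \<U> \<Longrightarrow> W \<in> \<U> \<Longrightarrow> res L U (U \<inter> W) (\<sigma> U) = res L W (U \<inter> W) (\<sigma> W)) \<Longrightarrow>
         \<exists>!s. s \<in> sections L (\<Union>\<U>) \<and> (\<forall>U\<in>\<U>. res L (\<Union>\<U>) U s = \<sigma> U)"

definition oset_isomorphic ::
  "'x topology \<Rightarrow> ('x, 'o) binoid_presheaf \<Rightarrow> ('x, 'o, 's) oset_presheaf \<Rightarrow> ('x, 'o, 't) oset_presheaf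
     \<Rightarrow> bool" where
  "oset_isomorphic X \<O> L K \<longleftrightarrow>
     (\<exists>\<phi>. \<forall>U. openin X U \<longrightarrow>
        bij_betw (\<phi> U) (sections L U) (sections K U) \<and>
        \<phi> U (point L U) = point K U \<and>
        (\<forall>a\<in>carrier (binoid_of \<O> U). \<forall>s\<in>sections L U.
           \<phi> U (action L U a s) = action K U a (\<phi> U s)) \<and>
        (\<forall>W. openin X W \<and> W \<subseteq> U \<longrightarrow>
           (\<forall>s\<in>sections L U. \<phi> W (res L U W s) = res K U W (\<phi> U s))))"

definition oset_self :: "('x, 'o) binoid_presheaf \<Rightarrow> ('x, 'o, 'o) oset_presheaf" where
  "oset_self \<O> =
     \<lparr>sections = (\<lambda>U. carrier (binoid_of \<O> U)),
      res = restr \<O>,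
      action = (\<lambda>U. monoid.mult (binoid_of \<O> U)),
      point = (\<lambda>U. absorb (binoid_of \<O> U))\<rparr>"

definition invertible_sheaf ::
  "'x topology \<Rightarrow> ('x, 'o) binoid_presheaf \<Rightarrow> ('x, 'o, 's) oset_presheaf \<Rightarrow> bool" where
  "invertible_sheaf X \<O> L \<longleftrightarrow>
     oset_sheaf X \<O> L \<and>
     (\<forall>x\<in>topspace X. \<exists>U. openin X U \<and> x \<in> U \<and>
        oset_isomorphic (subtopology X U) \<O> L (oset_self \<O>))"


section \<open>The smash product over the structure sheaf\<close>

text \<open>For sets \<open>S\<close>, \<open>T\<close> with an action, the smash product over the binoid is the quotient of
  \<open>S \<times> T\<close> by the equivalence relation generated by the collapsing of pairs with an entry equal to
  the base point and by \<open>(a s, t) \<sim> (s, a t)\<close>.\<close>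

definition smash_gen ::
  "('x, 'o) binoid_presheaf \<Rightarrow> ('x, 'o, 's) oset_presheaf \<Rightarrow> ('x, 'o, 't) oset_presheaf \<Rightarrow> 'x set
     \<Rightarrow> (('s \<times> 't) \<times> ('s \<times> 't)) set" where
  "smash_gen \<O> L K U =
     {((s, point K U), (point L U, point K U)) | s. s \<in> sections L U} \<union>
     {((point L U, t), (point L U, point K U)) | t. t \<in> sections K U} \<union>
     {((action L U a s, t), (s, action K U a t)) | a s t.
         a \<in> carrier (binoid_of \<O> U) \<and> s \<in> sections L U \<and> t \<in> sections K U}"

definition smash_class ::
  "('x, 'o) binoid_presheaf \<Rightarrow> ('x, 'o, 's) oset_presheaf \<Rightarrow> ('x, 'o, 't) oset_presheaf \<Rightarrow> 'x set
     \<Rightarrow> 's \<times> 't \<Rightarrow> ('s \<times> 't) set" where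
  "smash_class \<O> L K U x = (smash_gen \<O> L K U \<union> (smash_gen \<O> L K U)\<inverse>)\<^sup>* `` {x}"

definition smash_presheaf ::
  "('x, 'o) binoid_presheaf \<Rightarrow> ('x, 'o, 's) oset_presheaf \<Rightarrow> ('x, 'o, 't) oset_presheaf
     \<Rightarrow> ('x, 'o, ('s \<times> 't) set) oset_presheaf" where
  "smash_presheaf \<O> L K =
     \<lparr>sections = (\<lambda>U. smash_class \<O> L K U ` (sections L U \<times> sections K U)),
      res = (\<lambda>U W c. \<Union>(s, t)\<in>c. smash_class \<O> L K W (res L U W s, res K U W t)),
      action = (\<lambda>U a c. \<Union>(s, t)\<in>c. smash_class \<O> L K U (action L U a s, t)),
      point = (\<lambda>U. smash_class \<O> L K U (point L U, point K U))\<rparr>"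

definition germ ::
  "'x topology \<Rightarrow> ('x, 'o, 's) oset_presheaf \<Rightarrow> 'x \<Rightarrow> 'x set \<Rightarrow> 's \<Rightarrow> ('x set \<times> 's) set" where
  "germ X F x U s =
     {(W, t). openin X W \<and> x \<in> W \<and> t \<in> sections F W \<and>
        (\<exists>T. openin X T \<and> x \<in> T \<and> T \<subseteq> U \<inter> W \<and> res F U T s = res F W T t)}"

definition sheafify ::
  "'x topology \<Rightarrow> ('x, 'o) binoid_presheaf \<Rightarrow> ('x, 'o, 's) oset_presheaf
     \<Rightarrow> ('x, 'o, 'x \<Rightarrow> ('x set \<times> 's) set) oset_presheaf" where
  "sheafify X \<O> F =
     \<lparr>sections = (\<lambda>U. {\<sigma> \<in> extensional U. \<forall>x\<in>U. \<exists>W s.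
          openin X W \<and> x \<in> W \<and> W \<subseteq> U \<and> s \<in> sections F W \<and> (\<forall>y\<in>W. \<sigma> y = germ X F y W s)}),
      res = (\<lambda>U W \<sigma>. restrict \<sigma> W),
      action = (\<lambda>U a \<sigma>. \<lambda>x\<in>U. \<Union>(W, s)\<in>\<sigma> x.
          germ X F x (U \<inter> W) (action F (U \<inter> W) (restr \<O> U (U \<inter> W) a) (res F W (U \<inter> W) s))),
      point = (\<lambda>U. \<lambda>x\<in>U. germ X F x U (point F U))\<rparr>"

definition smash_sheaf ::
  "'x topology \<Rightarrow> ('x, 'o) binoid_presheaf \<Rightarrow> ('x, 'o, 's) oset_presheaf \<Rightarrow> ('x, 'o, 't) oset_presheaf
     \<Rightarrow> ('x, 'o, 'x \<Rightarrow> ('x set \<times> ('s \<times> 't) set) set) oset_presheaf" where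
  "smash_sheaf X \<O> L K = sheafify X \<O> (smash_presheaf \<O> L K)"


section \<open>The Picard group\<close>

text \<open>The type \<open>'s\<close> of sections is the universe in which invertible sheaves are classified.  The
  smash product lives over a larger type; a product of classes consists of the invertible sheaves
  in the universe that are isomorphic to it.  If \<open>\<O>\<close> is (a restriction of) the structure sheaf of a
  finitely generated integral cancellative binoid \<open>M\<close>, then sections of invertible sheaves embed
  into the difference group with \<open>\<infinity>\<close> adjoined, so they are countably many, and every infinite type
  \<open>'s\<close> accommodates all invertible sheaves up to isomorphism.\<close>

definition Pic ::
  "'x topology \<Rightarrow> ('x, 'o) binoid_presheaf \<Rightarrow> 's itself \<Rightarrow> ('x, 'o, 's) oset_presheaf set monoid" where
  "Pic X \<O> _ =
     \<lparr>carrier = {L. invertible_sheaf X \<O> L} //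
        {(L, K). invertible_sheaf X \<O> L \<and> invertible_sheaf X \<O> K \<and> oset_isomorphic X \<O> L K},
      monoid.mult = (\<lambda>A B. {K. invertible_sheaf X \<O> K \<and>
        (\<exists>L\<in>A. \<exists>L'\<in>B. oset_isomorphic X \<O> K (smash_sheaf X \<O> L L'))}),
      one = {K. invertible_sheaf X \<O> K \<and> oset_isomorphic X \<O> K (oset_self \<O>)}\<rparr>"


section \<open>The divisor class group\<close>

text \<open>The valuation of a prime \<open>p\<close> of height one: choose an isomorphism of the difference group with
  $\mathbb{Z}^{n} \times \mathbb{Z}$ that maps (the image of) $M_p^\bullet$ onto
  $\mathbb{Z}^{n} \times \mathbb{N}$, and project to the last factor.  The projection does not
  depend on the choice.\<close>

definition valuation :: "'a binoid \<Rightarrow> 'a set \<Rightarrow> ('a \<times> 'a) set \<Rightarrow> int" where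
  "valuation M p =
     (SOME v. \<exists>(n :: nat) \<phi>.
        \<phi> \<in> iso (diff_group M) (product_group {..<n} (\<lambda>_. integer_group) \<times>\<times> integer_group) \<and>
        \<phi> ` {fraction M (nonabsorb M) a s | a s. a \<in> nonabsorb M \<and> s \<in> carrier M - p} =
          carrier (product_group {..<n} (\<lambda>_. integer_group)) \<times> {0..} \<and>
        v = restrict (snd \<circ> \<phi>) (carrier (diff_group M)))"

definition height_one_primes :: "'a binoid \<Rightarrow> 'a set set \<Rightarrow> 'a set set" where
  "height_one_primes M V = {p \<in> V. prime_ideal M p \<and> height M p = 1}"

definition Div :: "'a binoid \<Rightarrow> 'a set set \<Rightarrow> ('a set \<Rightarrow>\<^sub>0 int) monoid" where
  "Div M V = free_Abelian_group (height_one_primes M V)"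

text \<open>A finitely generated binoid has only finitely many primes, so the sum below is finite.\<close>

definition principal_divisor :: "'a binoid \<Rightarrow> 'a set set \<Rightarrow> ('a \<times> 'a) set \<Rightarrow> ('a set \<Rightarrow>\<^sub>0 int)" where
  "principal_divisor M V q =
     (\<Sum>p\<in>height_one_primes M V. frag_cmul (valuation M p q) (frag_of p))"

definition Prin :: "'a binoid \<Rightarrow> 'a set set \<Rightarrow> ('a set \<Rightarrow>\<^sub>0 int) set" where
  "Prin M V = principal_divisor M V ` carrier (diff_group M)"

definition Cl :: "'a binoid \<Rightarrow> 'a set set \<Rightarrow> ('a set \<Rightarrow>\<^sub>0 int) set monoid" where
  "Cl M V = Div M V Mod Prin M V"

end

theory Submission
  imports Defs
begin

text \<open>Every nonempty open subset of the spectrum contains the generic point \<open>{\<infinity>}\<close>, which is itself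
  open, and every point \<open>p\<close> has a smallest open neighbourhood, the set of primes below \<open>p\<close>.  Hence an
  invertible sheaf embeds into its generic stalk, a copy of the difference group with \<open>\<infinity>\<close> adjoined,
  and is determined by a generator at each point.  If $M_p$ is regular, its coordinates are
  the valuations of the primes of height one below \<open>p\<close>; so an element of the difference group is
  determined up to units of $M_p$ by these valuations, which moreover take arbitrary values.
  Therefore every invertible sheaf is isomorphic to the sheaf
  \<open>U \<mapsto> {g. v\<^sub>q g + D q \<ge> 0 for all q \<in> U of height one} \<union> {\<infinity>}\<close> of some divisor \<open>D\<close>; the product of
  the difference group turns smash products of such sheaves into sums of divisors, and two of them are
  isomorphic exactly if the divisors differ by a principal one.\<close>

section \<open>Localizations\<close>

text \<open>Three obstacles shape the argument. \<open>valuation\<close> is a \<open>SOME\<close>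
  over isomorphisms of the difference group with Z^n x Z, so nothing is known about it until such an
  isomorphism exists; hence the structure of finitely generated torsion-free abelian groups is
  developed, and valuations are handled through \<open>is_valuation\<close>, a property that
  determines its function on the difference group. \<open>Pic\<close> is not known to be a group
  beforehand: the map from divisors to classes is shown to be onto and compatible with products and
  units, and the group axioms are transported along it, so that associativity and inverses of smash
  products are never treated directly. Finally, classes are formed from sheaves with sections in an
  arbitrary infinite type, whereas divisor sheaves consist of fractions; countability of the
  difference group carries them over. The empty open set contains no generic point, so it needs its
  own conventions and cases.\<close>

context binoid
begin

lemma absorb_mult_right: "x \<in> carrier M \<Longrightarrow> x \<otimes> absorb M = absorb M"
  using absorb_mult[of x] m_comm[OF absorb_closed, of x] by simp

lemma carrier_localization:
  "carrier (localization M S) = {fraction M S a s | a s. a \<in> carrier M \<and> s \<in> S}"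
  by (simp add: localization_def)

lemma one_localization: "\<one>\<^bsub>localization M S\<^esub> = fraction M S \<one> \<one>"
  by (simp add: localization_def)

lemma absorb_localization: "absorb (localization M S) = fraction M S (absorb M) \<one>"
  by (simp add: localization_def)

lemma fraction_in_localization [intro]:
  "a \<in> carrier M \<Longrightarrow> s \<in> S \<Longrightarrow> fraction M S a s \<in> carrier (localization M S)"
  by (auto simp: carrier_localization)

lemma localizationE:
  assumes "x \<in> carrier (localization M S)"
  obtains a s where "a \<in> carrier M" "s \<in> S" "x = fraction M S a s"
  using assms by (auto simp: carrier_localization)

lemma binoid_localization:
  assumes S: "submonoid S M"
  shows "binoid (localization M S)"
proof -
  have SM: "x \<in> carrier M" if "x \<in> S" for x
    using submonoid.subset[OF S] that by blast
  note [simp] = SM submonoid.m_closed[OF S] submonoid.one_closed[OF S] absorb_closed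
  note mult = localization_mult[OF S]
  have "comm_monoid (localization M S)"
  proof (rule comm_monoidI)
    fix x y z
    assume xyz: "x \<in> carrier (localization M S)" "y \<in> carrier (localization M S)"
      "z \<in> carrier (localization M S)"
    show "x \<otimes>\<^bsub>localization M S\<^esub> y \<in> carrier (localization M S)"
      using xyz(1,2) by (auto elim!: localizationE simp: mult intro!: fraction_in_localization)
    show "x \<otimes>\<^bsub>localization M S\<^esub> y = y \<otimes>\<^bsub>localization M S\<^esub> x"
      using xyz(1,2) by (auto elim!: localizationE simp: mult m_comm)
    show "x \<otimes>\<^bsub>localization M S\<^esub> y \<otimes>\<^bsub>localization M S\<^esub> z =
        x \<otimes>\<^bsub>localization M S\<^esub> (y \<otimes>\<^bsub>localization M S\<^esub> z)"
      using xyz by (auto elim!: localizationE simp: mult m_assoc)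
  next
    show "\<one>\<^bsub>localization M S\<^esub> \<in> carrier (localization M S)"
      by (auto simp: one_localization)
  next
    fix x assume "x \<in> carrier (localization M S)"
    then show "\<one>\<^bsub>localization M S\<^esub> \<otimes>\<^bsub>localization M S\<^esub> x = x"
      by (auto elim!: localizationE simp: mult one_localization)
  qed
  moreover have "absorb (localization M S) \<otimes>\<^bsub>localization M S\<^esub> x = absorb (localization M S)"
    if x: "x \<in> carrier (localization M S)" for x
  proof -
    obtain a s where x: "a \<in> carrier M" "s \<in> S" "x = fraction M S a s"
      using x by (rule localizationE)
    have "fraction M S (absorb M) s = fraction M S (absorb M) \<one>"
      unfolding fraction_eq_iff[OF S absorb_closed x(2) absorb_closed submonoid.one_closed[OF S]]
      using x(2) by (intro bexI[of _ \<one>]) (simp_all add: absorb_mult)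
    then show ?thesis
      using x by (simp add: absorb_localization mult absorb_mult)
  qed
  ultimately show ?thesis
    by (auto simp: binoid_def binoid_axioms_def absorb_localization)
qed

end

section \<open>Integral cancellative binoids and their difference group\<close>

locale cancellative_domain = binoid +
  assumes integral: "integral_binoid M" and cancellative: "cancellative_binoid M"
begin

abbreviation "M\<^sub>0 \<equiv> nonabsorb M"
text \<open>The difference group \<Gamma> together with an absorbing element. It is the fixed
  ambient set in which sections of different sheaves over different open sets become comparable, the
  zero section included.\<close>

abbreviation "K \<equiv> localization M (nonabsorb M)"
abbreviation "quo \<equiv> fraction M (nonabsorb M)"
abbreviation "\<Gamma> \<equiv> diff_group M"

lemma submonoid_nonabsorb: "submonoid M\<^sub>0 M"
  using integral by (simp add: integral_binoid_def)

lemma nonabsorb_closed [simp]: "a \<in> M\<^sub>0 \<Longrightarrow> a \<in> carrier M"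
  by (simp add: nonabsorb_def)

lemma nonabsorb_iff: "a \<in> M\<^sub>0 \<longleftrightarrow> a \<in> carrier M \<and> a \<noteq> absorb M"
  unfolding nonabsorb_def by blast

lemma nonabsorb_mult [simp]: "a \<in> M\<^sub>0 \<Longrightarrow> b \<in> M\<^sub>0 \<Longrightarrow> a \<otimes> b \<in> M\<^sub>0"
  using submonoid.m_closed[OF submonoid_nonabsorb] by blast

lemma nonabsorb_one [simp]: "\<one> \<in> M\<^sub>0"
  using submonoid.one_closed[OF submonoid_nonabsorb] .

lemma mult_eq_absorb_iff:
  "a \<in> carrier M \<Longrightarrow> b \<in> carrier M \<Longrightarrow> a \<otimes> b = absorb M \<longleftrightarrow> a = absorb M \<or> b = absorb M"
  using nonabsorb_mult[of a b] absorb_mult absorb_mult_right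
  by (auto simp: nonabsorb_iff simp del: nonabsorb_closed)

lemma cancel_left:
  assumes "a \<in> M\<^sub>0" "b \<in> carrier M" "c \<in> carrier M" "a \<otimes> b = a \<otimes> c"
  shows "b = c"
proof (cases "a \<otimes> b = absorb M")
  case True
  then show ?thesis using assms
    by (auto simp: nonabsorb_iff mult_eq_absorb_iff simp del: nonabsorb_closed)
next
  case False
  then show ?thesis using assms cancellative nonabsorb_closed[OF assms(1)]
    unfolding cancellative_binoid_def by blast
qed

text \<open>The auxiliary factor of the general criterion lies in S, so it is not absorbing and
  cancels. Equality of fractions becomes the same cross-multiplication in M for every such S, which
  is how values in different localizations are compared.\<close>

lemma fraction_eq:
  assumes S: "submonoid S M" "S \<subseteq> M\<^sub>0"
    and c: "a \<in> carrier M" "s \<in> S" "b \<in> carrier M" "t \<in> S"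
  shows "fraction M S a s = fraction M S b t \<longleftrightarrow> a \<otimes> t = b \<otimes> s"
proof -
  have "u \<otimes> (a \<otimes> t) = u \<otimes> (b \<otimes> s) \<longleftrightarrow> a \<otimes> t = b \<otimes> s" if "u \<in> S" for u
    using that cancel_left[of u "a \<otimes> t" "b \<otimes> s"] c subsetD[OF S(2)] by auto
  then show ?thesis
    unfolding fraction_eq_iff[OF S(1) c] using submonoid.one_closed[OF S(1)] by blast
qed

lemmas quo_eq = fraction_eq[OF submonoid_nonabsorb subset_refl]
lemmas quo_mult = localization_mult[OF submonoid_nonabsorb]

sublocale K: binoid K
  by (rule binoid_localization[OF submonoid_nonabsorb])

lemma quo_eq_absorb_iff:
  "a \<in> carrier M \<Longrightarrow> s \<in> M\<^sub>0 \<Longrightarrow> quo a s = absorb K \<longleftrightarrow> a = absorb M"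
  by (simp add: absorb_localization quo_eq absorb_closed absorb_mult)

lemma carrier_diff_group: "carrier \<Gamma> = {quo a s | a s. a \<in> M\<^sub>0 \<and> s \<in> M\<^sub>0}"
proof -
  have "carrier \<Gamma> = carrier K - {absorb K}" by (simp add: diff_group_def nonabsorb_def[of K])
  also have "\<dots> = {quo a s | a s. a \<in> M\<^sub>0 \<and> s \<in> M\<^sub>0}"
  proof (intro Set.set_eqI iffI)
    fix x assume x: "x \<in> carrier K - {absorb K}"
    then obtain a s where "a \<in> carrier M" "s \<in> M\<^sub>0" "x = quo a s" by (blast elim: localizationE)
    moreover from this x have "a \<in> M\<^sub>0"
      using quo_eq_absorb_iff nonabsorb_iff by blast
    ultimately show "x \<in> {quo a s | a s. a \<in> M\<^sub>0 \<and> s \<in> M\<^sub>0}" by blast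
  next
    fix x assume "x \<in> {quo a s | a s. a \<in> M\<^sub>0 \<and> s \<in> M\<^sub>0}"
    then show "x \<in> carrier K - {absorb K}"
      using quo_eq_absorb_iff nonabsorb_iff by fastforce
  qed
  finally show ?thesis .
qed

lemma diff_group_iff: "g \<in> carrier \<Gamma> \<longleftrightarrow> g \<in> carrier K \<and> g \<noteq> absorb K"
  by (simp add: diff_group_def nonabsorb_def[of K])

lemma diff_group_mult [simp]: "g \<otimes>\<^bsub>\<Gamma>\<^esub> h = g \<otimes>\<^bsub>K\<^esub> h"
  by (simp add: diff_group_def)

lemma diff_group_one: "\<one>\<^bsub>\<Gamma>\<^esub> = \<one>\<^bsub>K\<^esub>"
  by (simp add: diff_group_def)

lemma diff_groupE:
  assumes "g \<in> carrier \<Gamma>"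
  obtains a s where "a \<in> M\<^sub>0" "s \<in> M\<^sub>0" "g = quo a s"
  using assms by (auto simp: carrier_diff_group)

lemma quo_in_diff_group [intro, simp]: "a \<in> M\<^sub>0 \<Longrightarrow> s \<in> M\<^sub>0 \<Longrightarrow> quo a s \<in> carrier \<Gamma>"
  by (auto simp: carrier_diff_group)

lemma quo_self: "a \<in> M\<^sub>0 \<Longrightarrow> quo a a = \<one>\<^bsub>K\<^esub>"
  by (simp add: one_localization quo_eq)

lemma comm_group_diff_group: "comm_group \<Gamma>"
proof (rule comm_groupI)
  fix x y z
  assume x: "x \<in> carrier \<Gamma>" and y: "y \<in> carrier \<Gamma>" and z: "z \<in> carrier \<Gamma>"
  show "x \<otimes>\<^bsub>\<Gamma>\<^esub> y \<in> carrier \<Gamma>"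
    using x y by (auto elim!: diff_groupE simp: quo_mult)
  show "x \<otimes>\<^bsub>\<Gamma>\<^esub> y \<otimes>\<^bsub>\<Gamma>\<^esub> z = x \<otimes>\<^bsub>\<Gamma>\<^esub> (y \<otimes>\<^bsub>\<Gamma>\<^esub> z)"
    using x y z by (simp add: diff_group_iff K.m_assoc)
  show "x \<otimes>\<^bsub>\<Gamma>\<^esub> y = y \<otimes>\<^bsub>\<Gamma>\<^esub> x"
    using x y by (simp add: diff_group_iff K.m_comm)
next
  show "\<one>\<^bsub>\<Gamma>\<^esub> \<in> carrier \<Gamma>"
    using quo_in_diff_group[OF nonabsorb_one nonabsorb_one] by (simp add: diff_group_one quo_self)
next
  fix x assume x: "x \<in> carrier \<Gamma>"
  show "\<one>\<^bsub>\<Gamma>\<^esub> \<otimes>\<^bsub>\<Gamma>\<^esub> x = x" using x by (simp add: diff_group_iff diff_group_one)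
  obtain a s where as: "a \<in> M\<^sub>0" "s \<in> M\<^sub>0" "x = quo a s" using x by (rule diff_groupE)
  then have "quo s a \<otimes>\<^bsub>\<Gamma>\<^esub> x = \<one>\<^bsub>\<Gamma>\<^esub>"
    by (simp add: quo_mult diff_group_one quo_self m_comm)
  then show "\<exists>y\<in>carrier \<Gamma>. y \<otimes>\<^bsub>\<Gamma>\<^esub> x = \<one>\<^bsub>\<Gamma>\<^esub>" using as by blast
qed

sublocale \<Gamma>: comm_group \<Gamma>
  by (rule comm_group_diff_group)

lemma inv_quo: "a \<in> M\<^sub>0 \<Longrightarrow> s \<in> M\<^sub>0 \<Longrightarrow> inv\<^bsub>\<Gamma>\<^esub> quo a s = quo s a"
  by (rule \<Gamma>.inv_equality) (simp_all add: quo_mult diff_group_one quo_self m_comm)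

lemma diff_group_in_K [simp]: "g \<in> carrier \<Gamma> \<Longrightarrow> g \<in> carrier K"
  by (simp add: diff_group_iff)

lemma diff_group_m_closed [simp]:
  "g \<in> carrier \<Gamma> \<Longrightarrow> h \<in> carrier \<Gamma> \<Longrightarrow> g \<otimes>\<^bsub>K\<^esub> h \<in> carrier \<Gamma>"
  using \<Gamma>.m_closed by simp

text \<open>Serves to recognise a factor as nonabsorbing from a product that is known to be
  so.\<close>

lemma K_mult_in_diff_group_iff:
  assumes "g \<in> carrier K" "h \<in> carrier K"
  shows "g \<otimes>\<^bsub>K\<^esub> h \<in> carrier \<Gamma> \<longleftrightarrow> g \<in> carrier \<Gamma> \<and> h \<in> carrier \<Gamma>"
  using assms diff_group_m_closed[of g h] K.absorb_mult[of h] K.absorb_mult_right[of g]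
  by (auto simp: diff_group_iff simp del: diff_group_in_K)

lemma K_cancel:
  assumes "g \<in> carrier \<Gamma>" "x \<in> carrier K" "y \<in> carrier K" "g \<otimes>\<^bsub>K\<^esub> x = g \<otimes>\<^bsub>K\<^esub> y"
  shows "x = y"
proof -
  have "(inv\<^bsub>\<Gamma>\<^esub> g \<otimes>\<^bsub>K\<^esub> g) \<otimes>\<^bsub>K\<^esub> x = (inv\<^bsub>\<Gamma>\<^esub> g \<otimes>\<^bsub>K\<^esub> g) \<otimes>\<^bsub>K\<^esub> y"
    using assms by (simp add: K.m_assoc)
  moreover have "inv\<^bsub>\<Gamma>\<^esub> g \<otimes>\<^bsub>K\<^esub> g = \<one>\<^bsub>K\<^esub>"
    using \<Gamma>.l_inv[OF assms(1)] by (simp add: diff_group_one)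
  ultimately show ?thesis using assms by simp
qed

end

section \<open>The spectrum and its structure sheaf\<close>

context binoid
begin

lemma prime_ideal_closed: "prime_ideal M p \<Longrightarrow> a \<in> p \<Longrightarrow> a \<in> carrier M"
  by (auto simp: prime_ideal_def)

lemma prime_ideal_absorb: "prime_ideal M p \<Longrightarrow> absorb M \<in> p"
  by (simp add: prime_ideal_def)

lemma prime_ideal_submonoid: "prime_ideal M p \<Longrightarrow> submonoid (carrier M - p) M"
  by (simp add: prime_ideal_def)

lemma prime_ideal_one: "prime_ideal M p \<Longrightarrow> \<one> \<notin> p"
  using submonoid.one_closed[of "carrier M - p" M] by (auto simp: prime_ideal_def)

lemma prime_ideal_mult_iff:
  assumes p: "prime_ideal M p" and a: "a \<in> carrier M" and b: "b \<in> carrier M"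
  shows "a \<otimes> b \<in> p \<longleftrightarrow> a \<in> p \<or> b \<in> p"
proof
  assume "a \<otimes> b \<in> p"
  then show "a \<in> p \<or> b \<in> p"
    using submonoid.m_closed[OF prime_ideal_submonoid[OF p], of a b] a b by blast
next
  assume "a \<in> p \<or> b \<in> p"
  then show "a \<otimes> b \<in> p"
    using p a b m_comm[OF a b] unfolding prime_ideal_def by metis
qed

lemma prime_idealI:
  assumes "p \<subseteq> carrier M" "absorb M \<in> p" "\<one> \<notin> p"
    and "\<And>a b. a \<in> carrier M \<Longrightarrow> b \<in> carrier M \<Longrightarrow> a \<otimes> b \<in> p \<longleftrightarrow> a \<in> p \<or> b \<in> p"
  shows "prime_ideal M p"
  unfolding prime_ideal_def using assms
  by (auto intro!: submonoid.intro)

lemma openin_Spec_prime: "openin (Spec M) U \<Longrightarrow> p \<in> U \<Longrightarrow> prime_ideal M p"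
  using openin_Spec_contains_basic[of U p] by (auto simp: basic_open_def)

lemma openin_Spec_down:
  assumes "openin (Spec M) U" "p \<in> U" "prime_ideal M q" "q \<subseteq> p"
  shows "q \<in> U"
  using openin_Spec_contains_basic[OF assms(1,2)] assms(3,4) by (auto simp: basic_open_def)

lemma openin_basic_open: "f \<in> carrier M \<Longrightarrow> openin (Spec M) (basic_open M f)"
  unfolding Spec_def openin_topology_generated_by_iff by (rule generate_topology_on.Basis) auto

abbreviation "down p \<equiv> {q. prime_ideal M q \<and> q \<subseteq> p}"

lemma down_subset: "openin (Spec M) U \<Longrightarrow> p \<in> U \<Longrightarrow> down p \<subseteq> U"
  using openin_Spec_down by blast

end

section \<open>Finitely many primes, smallest neighbourhoods and the generic point\<close>

locale fg_cancellative_domain = cancellative_domain +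
  assumes finitely_generated: "finitely_generated_binoid M"
begin

definition generators :: "'a set" where
  "generators = (SOME A. finite A \<and> A \<subseteq> carrier M \<and>
        (\<forall>H. submonoid H M \<and> absorb M \<in> H \<and> A \<subseteq> H \<longrightarrow> H = carrier M))"

lemma generators:
  "finite generators" "generators \<subseteq> carrier M"
  "submonoid H M \<Longrightarrow> absorb M \<in> H \<Longrightarrow> generators \<subseteq> H \<Longrightarrow> H = carrier M"
  using someI_ex[OF finitely_generated[unfolded finitely_generated_binoid_def],
      folded generators_def] by blast+

text \<open>The elements m such that m in q implies m in p form a submonoid: if a product lies in q,
  primality puts a factor in q, hence in p, and then the product lies in p. So it is enough to look
  at generators.\<close>

lemma prime_subset_iff_generators:
  assumes p: "prime_ideal M p" and q: "prime_ideal M q"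
  shows "q \<subseteq> p \<longleftrightarrow> q \<inter> generators \<subseteq> p"
proof
  assume *: "q \<inter> generators \<subseteq> p"
  let ?H = "{m \<in> carrier M. m \<in> q \<longrightarrow> m \<in> p}"
  have "?H = carrier M"
  proof (rule generators(3))
    show "submonoid ?H M"
      using p q by (auto intro!: submonoid.intro simp: prime_ideal_mult_iff prime_ideal_one)
    show "absorb M \<in> ?H" "generators \<subseteq> ?H"
      using p * generators(2) by (auto simp: prime_ideal_absorb absorb_closed)
  qed
  then show "q \<subseteq> p" using prime_ideal_closed[OF q] by blast
qed auto

lemma finite_primes: "finite {p. prime_ideal M p}"
proof (rule inj_on_finite[where f = "\<lambda>p. p \<inter> generators"])
  show "inj_on (\<lambda>p. p \<inter> generators) {p. prime_ideal M p}"
    by (rule inj_onI) (metis Int_lower1 mem_Collect_eq prime_subset_iff_generators subset_antisym)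
  show "(\<lambda>p. p \<inter> generators) ` {p. prime_ideal M p} \<subseteq> Pow generators" by auto
qed (simp add: generators(1))

text \<open>This set is the basic open set of f, the product of the generators outside p: a prime q
  avoids f exactly if it contains none of these generators, that is, if q is contained in p.\<close>

lemma openin_down:
  assumes p: "prime_ideal M p"
  shows "openin (Spec M) (down p)"
proof -
  define f where "f = finprod M (\<lambda>a. a) (generators - p)"
  have cl: "finprod M (\<lambda>a. a) A \<in> carrier M \<and>
      (\<forall>q. prime_ideal M q \<longrightarrow> finprod M (\<lambda>a. a) A \<in> q \<longleftrightarrow> A \<inter> q \<noteq> {})"
    if "finite A" "A \<subseteq> carrier M" for A
    using that
  proof (induction A)
    case (insert x F)
    have "finprod M (\<lambda>a. a) (insert x F) = x \<otimes> finprod M (\<lambda>a. a) F"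
      using insert by (intro finprod_insert) auto
    then show ?case using insert by (auto simp: prime_ideal_mult_iff)
  qed (simp add: prime_ideal_one)
  have f: "f \<in> carrier M" "\<And>q. prime_ideal M q \<Longrightarrow> f \<in> q \<longleftrightarrow> (generators - p) \<inter> q \<noteq> {}"
    unfolding f_def using cl[of "generators - p"] generators(1,2) by blast+
  have "down p = basic_open M f"
    unfolding basic_open_def using f(2) prime_subset_iff_generators[OF p] by blast
  then show ?thesis using openin_basic_open[OF f(1)] by simp
qed

abbreviation "generic \<equiv> {absorb M}"

lemma localization_at_generic: "localization_at M generic = K"
  unfolding nonabsorb_def[of M] ..

lemma fraction_generic: "fraction M (carrier M - generic) = quo"
  unfolding nonabsorb_def ..

lemma prime_generic: "prime_ideal M generic"
  using nonabsorb_one nonabsorb_iff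
  by (intro prime_idealI) (auto simp: absorb_closed mult_eq_absorb_iff)

lemma generic_subset: "prime_ideal M p \<Longrightarrow> generic \<subseteq> p"
  by (simp add: prime_ideal_absorb)

lemma generic_in_open: "openin (Spec M) U \<Longrightarrow> p \<in> U \<Longrightarrow> generic \<in> U"
  using openin_Spec_down openin_Spec_prime prime_generic generic_subset by blast

lemma generic_in_open_iff: "openin (Spec M) U \<Longrightarrow> generic \<in> U \<longleftrightarrow> U \<noteq> {}"
  using generic_in_open by blast

lemma down_generic: "down generic = {generic}"
  using prime_generic prime_ideal_absorb by auto

lemma prime_compl_nonabsorb: "prime_ideal M p \<Longrightarrow> carrier M - p \<subseteq> M\<^sub>0"
  using nonabsorb_iff prime_ideal_absorb by blast

lemmas fraction_at_eq = fraction_eq[OF prime_ideal_submonoid prime_compl_nonabsorb]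

text \<open>The image of M_p in \<open>K\<close>. The elements of \<open>localization_at M p\<close>
  are classes over another set of denominators, so stalks at different points are comparable only
  after this passage to \<open>K\<close>.\<close>

definition stalk :: "'a set \<Rightarrow> ('a \<times> 'a) set set" where
  "stalk p = {quo a f | a f. a \<in> carrier M \<and> f \<in> carrier M - p}"

section \<open>Sections of the structure sheaf, read at the generic point\<close>

abbreviation "\<O> \<equiv> structure_sheaf M"

lemma carrier_structure_sheaf:
  "carrier (binoid_of \<O> U) = {\<sigma> \<in> extensional U. \<forall>p\<in>U. \<exists>W a f.
      openin (Spec M) W \<and> p \<in> W \<and> W \<subseteq> U \<and> a \<in> carrier M \<and> f \<in> carrier M \<and>
      (\<forall>q\<in>W. f \<notin> q \<and> \<sigma> q = fraction M (carrier M - q) a f)}"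
  by (simp add: structure_sheaf_def)

lemma mult_structure_sheaf:
  "\<sigma> \<otimes>\<^bsub>binoid_of \<O> U\<^esub> \<tau> = (\<lambda>p\<in>U. \<sigma> p \<otimes>\<^bsub>localization_at M p\<^esub> \<tau> p)"
  by (simp add: structure_sheaf_def)

lemma one_structure_sheaf: "\<one>\<^bsub>binoid_of \<O> U\<^esub> = (\<lambda>p\<in>U. \<one>\<^bsub>localization_at M p\<^esub>)"
  by (simp add: structure_sheaf_def)

lemma absorb_structure_sheaf: "absorb (binoid_of \<O> U) = (\<lambda>p\<in>U. absorb (localization_at M p))"
  by (simp add: structure_sheaf_def)

lemma restr_structure_sheaf: "restr \<O> U W = (\<lambda>\<sigma>. restrict \<sigma> W)"
  by (simp add: structure_sheaf_def)

lemma structure_sheafE: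
  assumes "\<sigma> \<in> carrier (binoid_of \<O> U)" "p \<in> U"
  obtains W a f where "openin (Spec M) W" "p \<in> W" "W \<subseteq> U" "a \<in> carrier M" "f \<in> carrier M"
    "\<forall>q\<in>W. f \<notin> q \<and> \<sigma> q = fraction M (carrier M - q) a f"
proof -
  have "\<exists>W a f. openin (Spec M) W \<and> p \<in> W \<and> W \<subseteq> U \<and> a \<in> carrier M \<and> f \<in> carrier M \<and>
      (\<forall>q\<in>W. f \<notin> q \<and> \<sigma> q = fraction M (carrier M - q) a f)"
    by (rule bspec[OF conjunct2[OF assms(1)[unfolded carrier_structure_sheaf mem_Collect_eq]] assms(2)])
  then show ?thesis using that by (elim exE conjE)
qed

lemma structure_sheafI:
  assumes "\<sigma> \<in> extensional U"
    and "\<And>p. p \<in> U \<Longrightarrow> \<exists>W a f. openin (Spec M) W \<and> p \<in> W \<and> W \<subseteq> U \<and> a \<in> carrier M \<and> f \<in> carrier M \<and>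
      (\<forall>q\<in>W. f \<notin> q \<and> \<sigma> q = fraction M (carrier M - q) a f)"
  shows "\<sigma> \<in> carrier (binoid_of \<O> U)"
  unfolding carrier_structure_sheaf using assms by (simp only: mem_Collect_eq Ball_def) simp

lemma restr_structure_sheaf_closed:
  assumes \<sigma>: "\<sigma> \<in> carrier (binoid_of \<O> U)" and W: "openin (Spec M) W" "W \<subseteq> U"
  shows "restr \<O> U W \<sigma> \<in> carrier (binoid_of \<O> W)"
proof (rule structure_sheafI)
  fix p assume p: "p \<in> W"
  obtain T a f where T: "openin (Spec M) T" "p \<in> T" "T \<subseteq> U" "a \<in> carrier M" "f \<in> carrier M"
    "\<forall>q\<in>T. f \<notin> q \<and> \<sigma> q = fraction M (carrier M - q) a f"
    using structure_sheafE[OF \<sigma> subsetD[OF W(2) p]] by metis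
  show "\<exists>T a f. openin (Spec M) T \<and> p \<in> T \<and> T \<subseteq> W \<and> a \<in> carrier M \<and> f \<in> carrier M \<and>
      (\<forall>q\<in>T. f \<notin> q \<and> restr \<O> U W \<sigma> q = fraction M (carrier M - q) a f)"
    by (rule exI[of _ "T \<inter> W"], rule exI[of _ a], rule exI[of _ f])
      (use T W p in \<open>auto simp: restr_structure_sheaf\<close>)
qed (simp add: restr_structure_sheaf)

lemma restr_generic: "generic \<in> W \<Longrightarrow> restr \<O> U W \<sigma> generic = \<sigma> generic"
  by (simp add: restr_structure_sheaf)

text \<open>A section is a single fraction on a neighbourhood of p, and this neighbourhood contains
  the generic point; so one pair a, f describes both values.\<close>

lemma structure_sheaf_value:
  assumes "\<sigma> \<in> carrier (binoid_of \<O> U)" "p \<in> U"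
  obtains a f where "a \<in> carrier M" "f \<in> carrier M - p" "f \<in> M\<^sub>0"
    "\<sigma> p = fraction M (carrier M - p) a f" "\<sigma> generic = quo a f"
proof -
  obtain W a f where W: "openin (Spec M) W" "p \<in> W" "W \<subseteq> U" "a \<in> carrier M" "f \<in> carrier M"
    "\<forall>q\<in>W. f \<notin> q \<and> \<sigma> q = fraction M (carrier M - q) a f"
    using structure_sheafE[OF assms] by metis
  have g: "generic \<in> W" using generic_in_open[OF W(1,2)] .
  show ?thesis
  proof (rule that)
    show "\<sigma> generic = quo a f" using W(6) g by (simp only: fraction_generic)
    show "f \<in> M\<^sub>0" using W(5,6) g nonabsorb_iff by blast
  qed (use W in auto)
qed

lemma structure_sheaf_generic_in_stalk:
  "\<sigma> \<in> carrier (binoid_of \<O> U) \<Longrightarrow> p \<in> U \<Longrightarrow> \<sigma> generic \<in> stalk p"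
  unfolding stalk_def by (erule structure_sheaf_value) blast+

lemma structure_sheaf_generic_closed:
  "\<sigma> \<in> carrier (binoid_of \<O> U) \<Longrightarrow> p \<in> U \<Longrightarrow> \<sigma> generic \<in> carrier K"
  by (erule structure_sheaf_value) auto

text \<open>Equality is cross-multiplication at p just as at the generic point, so the generic value
  decides all others. The premise of \<open>eq\<close> leaves the empty set, over which all sections
  coincide, without a condition.\<close>

lemma structure_sheaf_eqI:
  assumes U: "openin (Spec M) U"
    and \<sigma>: "\<sigma> \<in> carrier (binoid_of \<O> U)" and \<tau>: "\<tau> \<in> carrier (binoid_of \<O> U)"
    and eq: "U \<noteq> {} \<Longrightarrow> \<sigma> generic = \<tau> generic"
  shows "\<sigma> = \<tau>"
proof (rule extensionalityI[of _ U])
  fix p assume p: "p \<in> U"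
  have pp: "prime_ideal M p" using openin_Spec_prime[OF U p] .
  obtain a f where a: "a \<in> carrier M" "f \<in> carrier M - p" "f \<in> M\<^sub>0"
    "\<sigma> p = fraction M (carrier M - p) a f" "\<sigma> generic = quo a f"
    using structure_sheaf_value[OF \<sigma> p] .
  obtain b g where b: "b \<in> carrier M" "g \<in> carrier M - p" "g \<in> M\<^sub>0"
    "\<tau> p = fraction M (carrier M - p) b g" "\<tau> generic = quo b g"
    using structure_sheaf_value[OF \<tau> p] .
  have "quo a f = quo b g" using eq p a(5) b(5) by auto
  then have "a \<otimes> g = b \<otimes> f" using quo_eq a(1,3) b(1,3) by blast
  then show "\<sigma> p = \<tau> p" using fraction_at_eq[OF pp pp a(1,2) b(1,2)] a(4) b(4) by simp
qed (use \<sigma> \<tau> in \<open>simp_all add: carrier_structure_sheaf\<close>)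

text \<open>Together with \<open>structure_sheaf_generic_in_stalk\<close> this identifies the
  sections over a nonempty open set with the intersection of its stalks in \<open>K\<close>.
  Representatives are chosen independently at the points and fit together because all of them
  represent g.\<close>

lemma structure_sheaf_surj:
  assumes U: "openin (Spec M) U" "U \<noteq> {}" and g: "\<And>p. p \<in> U \<Longrightarrow> g \<in> stalk p"
  obtains \<sigma> where "\<sigma> \<in> carrier (binoid_of \<O> U)" "\<sigma> generic = g"
proof -
  have "\<forall>p\<in>U. \<exists>x. fst x \<in> carrier M \<and> snd x \<in> carrier M - p \<and> g = quo (fst x) (snd x)"
    using g by (fastforce simp: stalk_def)
  then obtain x where x: "\<And>p. p \<in> U \<Longrightarrow> fst (x p) \<in> carrier M" "\<And>p. p \<in> U \<Longrightarrow> snd (x p) \<in> carrier M - p"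
      "\<And>p. p \<in> U \<Longrightarrow> g = quo (fst (x p)) (snd (x p))"
    by metis
  define \<sigma> where "\<sigma> = (\<lambda>p\<in>U. fraction M (carrier M - p) (fst (x p)) (snd (x p)))"
  \<comment> \<open>The value at q is independent of the representative: every fraction a/f equal to
    g with f outside q may replace the chosen one.\<close>
  have \<sigma>: "\<sigma> q = fraction M (carrier M - q) a f"
    if "q \<in> U" "a \<in> carrier M" "f \<in> carrier M - q" "g = quo a f" for q a f
  proof -
    have pq: "prime_ideal M q" using openin_Spec_prime[OF U(1) that(1)] .
    have f: "f \<in> M\<^sub>0" "snd (x q) \<in> M\<^sub>0" using prime_compl_nonabsorb[OF pq] that(3) x(2)[OF that(1)] by blast+
    have "fst (x q) \<otimes> f = a \<otimes> snd (x q)"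
      using quo_eq[OF x(1)[OF that(1)] f(2) that(2) f(1)] x(3)[OF that(1)] that(4) by simp
    then show ?thesis
      using fraction_at_eq[OF pq pq x(1)[OF that(1)] x(2)[OF that(1)] that(2,3)] that(1) by (simp add: \<sigma>_def)
  qed
  have gen: "generic \<in> U" using generic_in_open_iff[OF U(1)] U(2) by simp
  show ?thesis
  proof (rule that)
    show "\<sigma> \<in> carrier (binoid_of \<O> U)"
    proof (rule structure_sheafI)
      fix p assume p: "p \<in> U"
      \<comment> \<open>On the set where the denominator chosen at p stays invertible, the
        representative chosen at p can be used at every point.\<close>
      let ?W = "U \<inter> basic_open M (snd (x p))"
      have "openin (Spec M) ?W" using openin_Int[OF U(1) openin_basic_open] x(2)[OF p] by blast
      moreover have "p \<in> ?W" using p x(2)[OF p] openin_Spec_prime[OF U(1) p] by (simp add: basic_open_def)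
      moreover have "\<forall>q\<in>?W. snd (x p) \<notin> q \<and> \<sigma> q = fraction M (carrier M - q) (fst (x p)) (snd (x p))"
        using x[OF p] \<sigma>[of _ "fst (x p)" "snd (x p)"] by (simp add: basic_open_def)
      ultimately show "\<exists>W a f. openin (Spec M) W \<and> p \<in> W \<and> W \<subseteq> U \<and> a \<in> carrier M \<and> f \<in> carrier M \<and>
            (\<forall>q\<in>W. f \<notin> q \<and> \<sigma> q = fraction M (carrier M - q) a f)"
        using x(1,2)[OF p] by blast
    qed (simp add: \<sigma>_def)
    show "\<sigma> generic = g"
      using \<sigma>[OF gen x(1,2)[OF gen] x(3)[OF gen]] x(3)[OF gen] by (simp add: fraction_generic del: One_nat_def)
  qed
qed

lemma mult_generic:
  "generic \<in> U \<Longrightarrow> (\<sigma> \<otimes>\<^bsub>binoid_of \<O> U\<^esub> \<tau>) generic = \<sigma> generic \<otimes>\<^bsub>K\<^esub> \<tau> generic"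
  by (simp add: mult_structure_sheaf localization_at_generic)

lemma one_generic: "generic \<in> U \<Longrightarrow> \<one>\<^bsub>binoid_of \<O> U\<^esub> generic = \<one>\<^bsub>K\<^esub>"
  by (simp add: one_structure_sheaf localization_at_generic)

lemma absorb_generic: "generic \<in> U \<Longrightarrow> absorb (binoid_of \<O> U) generic = absorb K"
  by (simp add: absorb_structure_sheaf localization_at_generic)

lemma structure_sheaf_mult_closed:
  assumes U: "openin (Spec M) U"
    and \<sigma>: "\<sigma> \<in> carrier (binoid_of \<O> U)" and \<tau>: "\<tau> \<in> carrier (binoid_of \<O> U)"
  shows "\<sigma> \<otimes>\<^bsub>binoid_of \<O> U\<^esub> \<tau> \<in> carrier (binoid_of \<O> U)"
proof (rule structure_sheafI)
  fix p assume p: "p \<in> U"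
  obtain W a f where W: "openin (Spec M) W" "p \<in> W" "W \<subseteq> U" "a \<in> carrier M" "f \<in> carrier M"
    "\<forall>q\<in>W. f \<notin> q \<and> \<sigma> q = fraction M (carrier M - q) a f"
    using structure_sheafE[OF \<sigma> p] by metis
  obtain W' b g where W': "openin (Spec M) W'" "p \<in> W'" "W' \<subseteq> U" "b \<in> carrier M" "g \<in> carrier M"
    "\<forall>q\<in>W'. g \<notin> q \<and> \<tau> q = fraction M (carrier M - q) b g"
    using structure_sheafE[OF \<tau> p] by metis
  have "f \<otimes> g \<notin> q \<and> (\<sigma> \<otimes>\<^bsub>binoid_of \<O> U\<^esub> \<tau>) q = fraction M (carrier M - q) (a \<otimes> b) (f \<otimes> g)"
    if q: "q \<in> W \<inter> W'" for q
  proof -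
    have pq: "prime_ideal M q" using openin_Spec_prime[OF U] q W(3) by blast
    show ?thesis
      using q W(3-) W'(3-) pq
      by (auto simp: mult_structure_sheaf prime_ideal_mult_iff
          localization_mult[OF prime_ideal_submonoid[OF pq]])
  qed
  then show "\<exists>T a f. openin (Spec M) T \<and> p \<in> T \<and> T \<subseteq> U \<and> a \<in> carrier M \<and> f \<in> carrier M \<and>
      (\<forall>q\<in>T. f \<notin> q \<and> (\<sigma> \<otimes>\<^bsub>binoid_of \<O> U\<^esub> \<tau>) q = fraction M (carrier M - q) a f)"
    using W(1-5) W'(1-5)
    by (intro exI[of _ "W \<inter> W'"] exI[of _ "a \<otimes> b"] exI[of _ "f \<otimes> g"]) auto
qed (simp add: mult_structure_sheaf)

lemma structure_sheaf_const:
  assumes U: "openin (Spec M) U" and a: "a \<in> carrier M"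
  shows "(\<lambda>p\<in>U. fraction M (carrier M - p) a \<one>) \<in> carrier (binoid_of \<O> U)"
proof (rule structure_sheafI)
  let ?\<sigma> = "\<lambda>p\<in>U. fraction M (carrier M - p) a \<one>"
  have "\<forall>q\<in>U. \<one> \<notin> q \<and> ?\<sigma> q = fraction M (carrier M - q) a \<one>"
    using openin_Spec_prime[OF U] prime_ideal_one by simp
  then show "\<exists>W b f. openin (Spec M) W \<and> p \<in> W \<and> W \<subseteq> U \<and> b \<in> carrier M \<and> f \<in> carrier M \<and>
      (\<forall>q\<in>W. f \<notin> q \<and> ?\<sigma> q = fraction M (carrier M - q) b f)" if "p \<in> U" for p
    using U a that one_closed by blast
qed simp

text \<open>All laws are checked at the generic point only, where they are those of
  \<open>K\<close>.\<close>

lemma binoid_structure_sheaf: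
  assumes U: "openin (Spec M) U"
  shows "binoid (binoid_of \<O> U)"
proof -
  have [simp]: "\<one>\<^bsub>binoid_of \<O> U\<^esub> \<in> carrier (binoid_of \<O> U)"
    using structure_sheaf_const[OF U one_closed] by (simp add: one_structure_sheaf one_localization)
  have [simp]: "absorb (binoid_of \<O> U) \<in> carrier (binoid_of \<O> U)"
    using structure_sheaf_const[OF U absorb_closed]
    by (simp add: absorb_structure_sheaf absorb_localization)
  note [simp] = structure_sheaf_mult_closed[OF U]
  have gen: "generic \<in> U" if "U \<noteq> {}" using that generic_in_open_iff[OF U] by simp
  have cl: "\<sigma> generic \<in> carrier K" if "\<sigma> \<in> carrier (binoid_of \<O> U)" "U \<noteq> {}" for \<sigma>
    using that gen structure_sheaf_generic_closed by blast
  note eqI = structure_sheaf_eqI[OF U]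
  have "comm_monoid (binoid_of \<O> U)"
  proof (rule comm_monoidI)
    fix x y z
    assume xyz: "x \<in> carrier (binoid_of \<O> U)" "y \<in> carrier (binoid_of \<O> U)"
      "z \<in> carrier (binoid_of \<O> U)"
    show "x \<otimes>\<^bsub>binoid_of \<O> U\<^esub> y = y \<otimes>\<^bsub>binoid_of \<O> U\<^esub> x"
      by (rule eqI) (use xyz in \<open>simp_all add: mult_generic gen cl K.m_comm\<close>)
    show "x \<otimes>\<^bsub>binoid_of \<O> U\<^esub> y \<otimes>\<^bsub>binoid_of \<O> U\<^esub> z =
        x \<otimes>\<^bsub>binoid_of \<O> U\<^esub> (y \<otimes>\<^bsub>binoid_of \<O> U\<^esub> z)"
      by (rule eqI) (use xyz in \<open>simp_all add: mult_generic gen cl K.m_assoc\<close>)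
  next
    fix x assume x: "x \<in> carrier (binoid_of \<O> U)"
    show "\<one>\<^bsub>binoid_of \<O> U\<^esub> \<otimes>\<^bsub>binoid_of \<O> U\<^esub> x = x"
      by (rule eqI) (use x in \<open>simp_all add: mult_generic one_generic gen cl\<close>)
  qed auto
  moreover have "absorb (binoid_of \<O> U) \<otimes>\<^bsub>binoid_of \<O> U\<^esub> x = absorb (binoid_of \<O> U)"
    if x: "x \<in> carrier (binoid_of \<O> U)" for x
    by (rule eqI) (use x in \<open>simp_all add: mult_generic absorb_generic gen cl K.absorb_mult\<close>)
  ultimately show ?thesis by (simp add: binoid_def binoid_axioms_def)
qed

end

section \<open>Finitely generated torsion-free abelian groups\<close>

context comm_group
begin

definition int_comb :: "nat set \<Rightarrow> (nat \<Rightarrow> 'a) \<Rightarrow> (nat \<Rightarrow> int) \<Rightarrow> 'a" where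
  "int_comb I g z = (\<Otimes>i\<in>I. g i [^] z i)"

text \<open>Generators form an indexed family rather than a subset of the group: elementary
  operations may then produce repetitions without changing the number of indices, which is the
  quantity to be minimised.\<close>

definition spanning :: "nat set \<Rightarrow> (nat \<Rightarrow> 'a) \<Rightarrow> bool" where
  "spanning I g \<longleftrightarrow> finite I \<and> g \<in> I \<rightarrow> carrier G \<and> (\<forall>x\<in>carrier G. \<exists>z. x = int_comb I g z)"

lemma int_comb_closed [simp]: "g \<in> I \<rightarrow> carrier G \<Longrightarrow> int_comb I g z \<in> carrier G"
  unfolding int_comb_def by (rule finprod_closed) auto

lemma int_comb_add:
  assumes "g \<in> I \<rightarrow> carrier G"
  shows "int_comb I g (\<lambda>i. z i + w i) = int_comb I g z \<otimes> int_comb I g w"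
proof -
  have "int_comb I g (\<lambda>i. z i + w i) = (\<Otimes>i\<in>I. g i [^] z i \<otimes> g i [^] w i)"
    unfolding int_comb_def
    by (rule finprod_cong') (use assms in \<open>auto simp: int_pow_mult Pi_iff\<close>)
  also have "\<dots> = int_comb I g z \<otimes> int_comb I g w"
    unfolding int_comb_def by (rule finprod_multf) (use assms in auto)
  finally show ?thesis .
qed

lemma int_comb_zero: "(\<And>i. i \<in> I \<Longrightarrow> z i = 0) \<Longrightarrow> int_comb I g z = \<one>"
  unfolding int_comb_def by (rule finprod_one_eqI) simp

lemma int_comb_minus:
  assumes "g \<in> I \<rightarrow> carrier G"
  shows "int_comb I g (\<lambda>i. - z i) = inv (int_comb I g z)"
proof (rule inv_equality[symmetric])
  have "int_comb I g (\<lambda>i. - z i + z i) = \<one>" by (rule int_comb_zero) simp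
  then show "int_comb I g (\<lambda>i. - z i) \<otimes> int_comb I g z = \<one>"
    using int_comb_add[OF assms, of "\<lambda>i. - z i" z] by simp
qed (use assms in auto)

lemma int_comb_insert:
  assumes "finite I" "i \<notin> I" "g \<in> insert i I \<rightarrow> carrier G"
  shows "int_comb (insert i I) g z = g i [^] z i \<otimes> int_comb I g z"
  unfolding int_comb_def by (rule finprod_insert) (use assms in auto)

lemma int_comb_cong:
  assumes "g \<in> I \<rightarrow> carrier G" "\<And>i. i \<in> I \<Longrightarrow> g' i = g i" "\<And>i. i \<in> I \<Longrightarrow> z' i = z i"
  shows "int_comb I g' z' = int_comb I g z"
  unfolding int_comb_def by (rule finprod_cong') (use assms in auto)

text \<open>Replacing g_j by g_j g_i^e creates a surplus of g_i to the power e z_j, which the new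
  exponent of g_i compensates. This is an elementary column operation on generators and the inverse
  one on exponents.\<close>

lemma int_comb_exchange:
  assumes I: "finite I" "i \<in> I" "j \<in> I" "i \<noteq> j" and g: "g \<in> I \<rightarrow> carrier G"
  shows "int_comb I (g(j := g j \<otimes> g i [^] e)) (z(i := z i - e * z j)) = int_comb I g z"
proof -
  let ?g = "g(j := g j \<otimes> g i [^] e)" and ?z = "z(i := z i - e * z j)"
  define J where "J = I - {i, j}"
  have J: "finite J" "i \<notin> J" "j \<notin> J" "i \<notin> insert j J" "I = insert i (insert j J)"
    using I by (auto simp: J_def)
  have gi: "g i \<in> carrier G" "g j \<in> carrier G" "g \<in> J \<rightarrow> carrier G" using g I J by auto
  have eqJ: "int_comb J ?g ?z = int_comb J g z"
    by (rule int_comb_cong) (use gi J in auto)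
  have cJ: "int_comb J g z \<in> carrier G" using gi(3) by simp
  have [simp]: "e * z j = z j * e" by simp
  have "g i [^] (z i - e * z j) \<otimes> (g j \<otimes> g i [^] e) [^] z j
      = g i [^] (z i - e * z j) \<otimes> (g i [^] (e * z j) \<otimes> g j [^] z j)"
    using gi by (simp add: int_pow_distrib int_pow_pow m_comm)
  also have "\<dots> = g i [^] ((z i - e * z j) + e * z j) \<otimes> g j [^] z j"
    using gi by (subst int_pow_mult) (simp_all add: m_assoc del: int_pow_diff)
  finally have pair: "g i [^] (z i - e * z j) \<otimes> (g j \<otimes> g i [^] e) [^] z j = g i [^] z i \<otimes> g j [^] z j"
    by simp
  have split: "int_comb I h w = h i [^] w i \<otimes> (h j [^] w j \<otimes> int_comb J h w)"
    if h: "h \<in> I \<rightarrow> carrier G" for h and w :: "nat \<Rightarrow> int"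
  proof -
    have "h \<in> insert i (insert j J) \<rightarrow> carrier G" using h by (simp only: J(5))
    then show ?thesis
      unfolding J(5) using int_comb_insert[OF _ J(4), of h w] int_comb_insert[OF J(1,3), of h w] J(1)
      by simp
  qed
  have "?g \<in> I \<rightarrow> carrier G" using g gi(1,2) by (simp add: Pi_iff)
  then have "int_comb I ?g ?z = ?g i [^] ?z i \<otimes> (?g j [^] ?z j \<otimes> int_comb J ?g ?z)"
    by (rule split)
  also have "\<dots> = (g i [^] (z i - e * z j) \<otimes> (g j \<otimes> g i [^] e) [^] z j) \<otimes> int_comb J g z"
    unfolding eqJ using I(4) gi cJ by (simp add: m_assoc)
  also have "\<dots> = g i [^] z i \<otimes> (g j [^] z j \<otimes> int_comb J g z)"
    unfolding pair using gi cJ by (simp add: m_assoc)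
  also have "\<dots> = int_comb I g z"
    by (rule split[OF g, symmetric])
  finally show ?thesis .
qed

lemma spanning_exchange:
  assumes s: "spanning I g" and I: "i \<in> I" "j \<in> I" "i \<noteq> j"
  shows "spanning I (g(j := g j \<otimes> g i [^] (e::int)))"
proof -
  have g: "finite I" "g \<in> I \<rightarrow> carrier G" using s by (auto simp: spanning_def)
  have "\<exists>w. x = int_comb I (g(j := g j \<otimes> g i [^] e)) w" if "x \<in> carrier G" for x
    using that s int_comb_exchange[OF g(1) I g(2), of e] unfolding spanning_def by metis
  moreover have "g(j := g j \<otimes> g i [^] e) \<in> I \<rightarrow> carrier G" using g I by (auto simp: Pi_iff)
  ultimately show ?thesis using g(1) by (simp add: spanning_def)
qed

lemma int_pow_eq_one_torsion_free:
  assumes tf: "\<And>x n. x \<in> carrier G \<Longrightarrow> n \<ge> 1 \<Longrightarrow> x [^] (n::nat) = \<one> \<Longrightarrow> x = \<one>"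
    and x: "x \<in> carrier G" "x [^] (k::int) = \<one>" "k \<noteq> 0"
  shows "x = \<one>"
proof -
  have "x [^] int (nat \<bar>k\<bar>) = \<one>"
    using x by (cases "k \<ge> 0") (simp_all add: int_pow_neg)
  then have "x [^] nat \<bar>k\<bar> = \<one>" by (simp only: int_pow_int)
  then show ?thesis using tf[OF x(1), of "nat \<bar>k\<bar>"] x(3) by simp
qed

text \<open>Euclid's algorithm on the coefficients: a relation between at least two generators is shortened
  by \<open>int_comb_exchange\<close>, and a relation involving one generator makes that generator redundant.\<close>

lemma minimal_spanning_independent:
  assumes tf: "\<And>x n. x \<in> carrier G \<Longrightarrow> n \<ge> 1 \<Longrightarrow> x [^] (n::nat) = \<one> \<Longrightarrow> x = \<one>"
    and min: "\<And>J h. spanning J h \<Longrightarrow> card I \<le> card J"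
  shows "spanning I g \<Longrightarrow> int_comb I g z = \<one> \<Longrightarrow> i \<in> I \<Longrightarrow> z i = 0"
proof (induction "\<Sum>i\<in>I. nat \<bar>z i\<bar>" arbitrary: g z i rule: less_induct)
  case less
  have g: "finite I" "g \<in> I \<rightarrow> carrier G" using less.prems(1) by (auto simp: spanning_def)
  show ?case
  proof (rule ccontr)
    assume nz: "z i \<noteq> 0"
    have pair: False if ij: "i \<in> I" "j \<in> I" "i \<noteq> j" "z j \<noteq> 0" "\<bar>z j\<bar> \<le> \<bar>z i\<bar>" for i j
    proof -
      \<comment> \<open>With these signs the absolute value of z_i - e z_j is the difference of the
        absolute values of z_i and z_j, so the sum used as induction measure drops.\<close>
      define e where "e = sgn (z i) * sgn (z j)"
      let ?z = "z(i := z i - e * z j)"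
      have "\<bar>z i - e * z j\<bar> < \<bar>z i\<bar>"
        using ij(4,5) unfolding e_def sgn_if by (auto split: if_splits)
      then have "(\<Sum>k\<in>I. nat \<bar>?z k\<bar>) < (\<Sum>k\<in>I. nat \<bar>z k\<bar>)"
        using g(1) ij(1) by (intro sum_strict_mono_ex1) auto
      \<comment> \<open>The induction hypothesis for the exchanged family is applied at j, whose
        exponent the exchange has not altered; this contradicts that z_j is nonzero.\<close>
      then have "?z j = 0"
        using less.hyps[OF _ spanning_exchange[OF less.prems(1) ij(1-3)]] ij
          int_comb_exchange[OF g(1) ij(1-3) g(2)] less.prems(2) by metis
      then show False using ij by simp
    qed
    \<comment> \<open>Two nonzero exponents would allow the larger to be reduced by the smaller, so
      the relation involves g_i alone.\<close>
    have z0: "z j = 0" if "j \<in> I" "j \<noteq> i" for j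
      using pair[OF that(1) less.prems(3)] pair[OF less.prems(3) that(1)] nz that by force
    let ?J = "I - {i}"
    have I: "I = insert i ?J" "finite ?J" "g i \<in> carrier G" "g \<in> ?J \<rightarrow> carrier G"
      "g \<in> insert i ?J \<rightarrow> carrier G"
      using less.prems(3) g by auto
    have ins: "int_comb I g w = g i [^] w i \<otimes> int_comb ?J g w" for w
      using int_comb_insert[of ?J i g w] I by auto
    have "g i [^] z i = \<one>"
      using less.prems(2) ins[of z] int_comb_zero[of ?J z g] z0 I by simp
    then have "g i = \<one>" using int_pow_eq_one_torsion_free[OF tf I(3) _ nz] by simp
    then have "int_comb I g w = int_comb ?J g w" for w using ins[of w] I(4) by simp
    then have "spanning ?J g" using less.prems(1) I by (simp add: spanning_def)
    then have "card I \<le> card ?J" by (rule min)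
    then show False using card_Diff1_less[OF g(1) less.prems(3)] by simp
  qed
qed

lemma spanning_generate:
  assumes A: "finite A" "A \<subseteq> carrier G" "generate G A = carrier G"
  shows "\<exists>I g. spanning I g"
proof -
  obtain g where g: "bij_betw g {0..<card A} A"
    using ex_bij_betw_nat_finite[OF A(1)] by blast
  let ?I = "{0..<card A}"
  have gc: "g \<in> ?I \<rightarrow> carrier G" using g A(2) by (auto simp: bij_betw_def)
  have gen: "\<exists>z. h = int_comb ?I g z" if "h \<in> A" for h
  proof -
    have "h \<in> g ` ?I" using that by (simp only: bij_betw_imp_surj_on[OF g])
    then obtain i where i: "i \<in> ?I" "h = g i" by (rule imageE)
    have "int_comb ?I g (\<lambda>j. if i = j then 1 else 0) = (\<Otimes>j\<in>?I. if i = j then g j else \<one>)"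
      unfolding int_comb_def by (rule finprod_cong') (use gc in \<open>auto simp: Pi_iff\<close>)
    then show ?thesis using finprod_singleton[OF i(1) _ gc] i(2) by (metis finite_atLeastLessThan)
  qed
  have "\<exists>z. x = int_comb ?I g z" if "x \<in> generate G A" for x
    using that
  proof (induction rule: generate.induct)
    case one
    then show ?case using int_comb_zero[of ?I "\<lambda>_. 0" g] by metis
  next
    case (incl h)
    then show ?case by (rule gen)
  next
    case (inv h)
    then show ?case using gen int_comb_minus[OF gc] by metis
  next
    case (eng h1 h2)
    then show ?case using int_comb_add[OF gc] by metis
  qed
  then have "spanning ?I g" using gc A(3) by (auto simp: spanning_def)
  then show ?thesis by blast
qed

text \<open>A spanning family with the fewest members is a basis, since minimality excludes
  nontrivial relations. The bijection \<open>b\<close> renumbers its indices to the initial segment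
  that occurs in \<open>valuation\<close>.\<close>

theorem torsion_free_fg_iso:
  assumes A: "finite A" "A \<subseteq> carrier G" "generate G A = carrier G"
    and tf: "\<And>x n. x \<in> carrier G \<Longrightarrow> n \<ge> 1 \<Longrightarrow> x [^] (n::nat) = \<one> \<Longrightarrow> x = \<one>"
  shows "\<exists>n::nat. product_group {..<n} (\<lambda>_. integer_group) \<cong> G"
proof -
  obtain I g where Ig: "spanning I g" "\<And>J h. spanning J h \<Longrightarrow> card I \<le> card J"
  proof -
    obtain x where "spanning (fst x) (snd x)" "\<And>y. spanning (fst y) (snd y) \<Longrightarrow> card (fst x) \<le> card (fst y)"
      using ex_has_least_nat[of "\<lambda>x. spanning (fst x) (snd x)" _ "\<lambda>x. card (fst x)"]
        spanning_generate[OF A] by (metis fst_conv snd_conv)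
    then show ?thesis using that[of "fst x" "snd x"] by (metis fst_conv snd_conv)
  qed
  have gI: "finite I" "g \<in> I \<rightarrow> carrier G" using Ig(1) by (auto simp: spanning_def)
  obtain b where b: "bij_betw b {..<card I} I"
    using ex_bij_betw_nat_finite[OF gI(1)] by (auto simp: atLeast0LessThan)
  let ?n = "card I" and ?h = "\<lambda>w. int_comb {..<card I} (g \<circ> b) w"
  let ?Z = "product_group {..<card I} (\<lambda>_. integer_group)"
  have gb: "g \<circ> b \<in> {..<?n} \<rightarrow> carrier G"
    using gI(2) bij_betwE[OF b] by (auto simp: Pi_iff)
  have reindex: "int_comb I g z = ?h (z \<circ> b)" for z
    unfolding int_comb_def using b gI(2)
    by (subst finprod_reindex[of "\<lambda>i. g i [^] z i" b "{..<?n}", unfolded bij_betw_imp_surj_on[OF b]])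
      (auto simp: bij_betw_def)
  have hom: "?h \<in> hom ?Z G"
  proof (rule homI)
    fix z w assume "z \<in> carrier ?Z" "w \<in> carrier ?Z"
    have "?h (\<lambda>i\<in>{..<?n}. z i + w i) = ?h (\<lambda>i. z i + w i)"
      by (rule int_comb_cong[OF gb]) auto
    then show "?h (z \<otimes>\<^bsub>?Z\<^esub> w) = ?h z \<otimes> ?h w" using int_comb_add[OF gb, of z w] by simp
  qed (use gb in auto)
  interpret h: group_hom ?Z G ?h
    using hom by (simp add: group_hom_def group_hom_axioms_def)
  have "inj_on ?h (carrier ?Z)"
  proof (rule h.inj_on_one_iff[THEN iffD2], intro allI impI)
    fix z assume z: "z \<in> carrier ?Z" "?h z = \<one>"
    \<comment> \<open>The tuple is carried back along \<open>b\<close> to exponents on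
      \<open>I\<close>, where independence has been proved.\<close>
    define w where "w = z \<circ> inv_into {..<?n} b"
    have wz: "w (b i) = z i" if "i < ?n" for i
      using that b by (simp add: w_def bij_betw_def)
    have "int_comb I g w = \<one>"
      unfolding reindex z(2)[symmetric] by (rule int_comb_cong[OF gb]) (simp_all add: wz)
    then have w0: "w j = 0" if "j \<in> I" for j
      by (intro minimal_spanning_independent[of I g w j]) (use tf Ig that in blast)+
    then have "z i = 0" if "i < ?n" for i
      using wz[OF that] w0[of "b i"] bij_betwE[OF b] that by simp
    then show "z = \<one>\<^bsub>?Z\<^esub>" using z(1) by (auto simp: PiE_iff extensional_def fun_eq_iff)
  qed
  moreover have "?h ` carrier ?Z = carrier G"
  proof (intro subset_antisym subsetI)
    fix x assume "x \<in> carrier G"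
    then obtain z where "x = int_comb I g z" using Ig(1) by (auto simp: spanning_def)
    then have "x = ?h (restrict (z \<circ> b) {..<?n})"
      unfolding reindex using int_comb_cong[OF gb, of "g \<circ> b" "restrict (z \<circ> b) {..<?n}" "z \<circ> b"]
      by (simp only: restrict_apply' refl)
    then show "x \<in> ?h ` carrier ?Z" by force
  qed (use gb in auto)
  ultimately have "?h \<in> iso ?Z G" using hom by (simp add: iso_def bij_betw_def)
  then show ?thesis by (intro exI is_isoI)
qed

end

section \<open>Regular localizations and valuations\<close>

text \<open>The smash product of two monoids with adjoined absorbing elements is their direct
  product with one absorbing element adjoined: pairs of \<open>Some\<close> are never collapsed, and
  all other pairs become \<open>(None, None)\<close>.\<close>

lemma smash_adjoin_absorb:
  fixes A :: "('a, 'c) monoid_scheme" and B :: "('b, 'd) monoid_scheme"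
  defines "R \<equiv> smash (adjoin_absorb A) (adjoin_absorb B)"
  shows carrier_smash_adjoin: "carrier R = insert (None, None) {(Some a, Some b) | a b. a \<in> carrier A \<and> b \<in> carrier B}"
    and mult_smash_adjoin: "(Some a, Some b) \<otimes>\<^bsub>R\<^esub> (Some a', Some b') = (Some (a \<otimes>\<^bsub>A\<^esub> a'), Some (b \<otimes>\<^bsub>B\<^esub> b'))"
    and one_smash_adjoin: "\<one>\<^bsub>R\<^esub> = (Some \<one>\<^bsub>A\<^esub>, Some \<one>\<^bsub>B\<^esub>)"
    and absorb_smash_adjoin: "absorb R = (None, None)"
proof -
  have [simp]: "absorb (adjoin_absorb N) = None" for N :: "('e, 'f) monoid_scheme"
    by (simp add: adjoin_absorb_def)
  have [simp]: "carrier (adjoin_absorb N) = insert None (Some ` carrier N)"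
    for N :: "('e, 'f) monoid_scheme"
    by (simp add: adjoin_absorb_def)
  have coll: "smash_collapse (adjoin_absorb A) (adjoin_absorb B) (x, y)
      = (if x = None \<or> y = None then (None, None) else (x, y))" for x y
    by (simp add: smash_collapse_def)
  show "carrier R = insert (None, None) {(Some a, Some b) | a b. a \<in> carrier A \<and> b \<in> carrier B}"
  proof (intro Set.set_eqI iffI)
    fix z assume "z \<in> carrier R"
    then have "z \<in> smash_collapse (adjoin_absorb A) (adjoin_absorb B) `
        (insert None (Some ` carrier A) \<times> insert None (Some ` carrier B))"
      by (simp add: R_def smash_def)
    then show "z \<in> insert (None, None) {(Some a, Some b) | a b. a \<in> carrier A \<and> b \<in> carrier B}"
      by (auto simp: coll)
  next
    fix z assume z: "z \<in> insert (None, None) {(Some a, Some b) | a b. a \<in> carrier A \<and> b \<in> carrier B}"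
    then have "z = smash_collapse (adjoin_absorb A) (adjoin_absorb B) z"
      "z \<in> carrier (adjoin_absorb A) \<times> carrier (adjoin_absorb B)"
      by (auto simp: coll)
    then show "z \<in> carrier R" unfolding R_def smash_def by auto
  qed
  show "(Some a, Some b) \<otimes>\<^bsub>R\<^esub> (Some a', Some b') = (Some (a \<otimes>\<^bsub>A\<^esub> a'), Some (b \<otimes>\<^bsub>B\<^esub> b'))"
    by (simp add: R_def smash_def coll) (simp add: adjoin_absorb_def)
  show "\<one>\<^bsub>R\<^esub> = (Some \<one>\<^bsub>A\<^esub>, Some \<one>\<^bsub>B\<^esub>)"
    by (simp add: R_def smash_def coll) (simp add: adjoin_absorb_def)
  show "absorb R = (None, None)" by (simp add: R_def smash_def)
qed

section \<open>Coordinates on a regular localization\<close>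

context fg_cancellative_domain
begin

text \<open>What is used of an isomorphism of M_p with a regular binoid, expressed in M alone: \<xi>
  gives the exponents in N^s of numerators. The componentwise order of exponents means divisibility
  up to a factor outside p; this factor absorbs both denominators and the group part.\<close>

definition coordinates :: "'a set \<Rightarrow> nat \<Rightarrow> (nat \<Rightarrow> 'a \<Rightarrow> nat) \<Rightarrow> bool" where
  "coordinates p s \<xi> \<longleftrightarrow>
    (\<forall>i<s. \<forall>a\<in>M\<^sub>0. \<forall>b\<in>M\<^sub>0. \<xi> i (a \<otimes> b) = \<xi> i a + \<xi> i b) \<and>
    (\<forall>i<s. \<forall>t\<in>carrier M - p. \<xi> i t = 0) \<and>
    (\<forall>k. \<exists>a\<in>M\<^sub>0. \<forall>i<s. \<xi> i a = k i) \<and>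
    (\<forall>a\<in>M\<^sub>0. \<forall>b\<in>M\<^sub>0. (\<forall>i<s. \<xi> i b \<le> \<xi> i a) \<longrightarrow>
       (\<exists>c\<in>M\<^sub>0. \<exists>t\<in>carrier M - p. a \<otimes> t = b \<otimes> c))"

lemma regular_coordinates:
  assumes p: "prime_ideal M p" and reg: "regular_binoid (localization_at M p)"
  shows "\<exists>s \<xi>. coordinates p s \<xi>"
proof -
  let ?S = "carrier M - p" and ?B = "localization_at M p"
  obtain G :: "('a \<times> 'a) set monoid" and s :: nat and h where G: "comm_group G"
    and h: "h \<in> binoid_iso ?B
          (smash (adjoin_absorb G) (adjoin_absorb (product_group {..<s} (\<lambda>_. nat_monoid))))"
    using reg unfolding regular_binoid_def by blast
  interpret G: comm_group G by (rule G)
  define P where "P = product_group {..<s} (\<lambda>_. nat_monoid)"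
  define R where "R = smash (adjoin_absorb G) (adjoin_absorb P)"
  have carP: "carrier P = {..<s} \<rightarrow>\<^sub>E UNIV"
    and multP: "\<And>x y. x \<otimes>\<^bsub>P\<^esub> y = (\<lambda>i\<in>{..<s}. x i + y i)"
    and oneP: "\<one>\<^bsub>P\<^esub> = (\<lambda>i\<in>{..<s}. 0)"
    by (simp_all add: P_def nat_monoid_def)
  note carR = carrier_smash_adjoin[of G P, folded R_def]
  note multR = mult_smash_adjoin[of G P, folded R_def]
  note oneR = one_smash_adjoin[of G P, folded R_def]
  note absR = absorb_smash_adjoin[of G P, folded R_def]
  have h': "h \<in> hom ?B R" "bij_betw h (carrier ?B) (carrier R)" "h \<one>\<^bsub>?B\<^esub> = \<one>\<^bsub>R\<^esub>" "h (absorb ?B) = absorb R"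
    using h unfolding binoid_iso_def iso_def R_def P_def by blast+
  have S: "submonoid ?S M" "?S \<subseteq> M\<^sub>0"
    using prime_ideal_submonoid[OF p] prime_compl_nonabsorb[OF p] by auto
  have SM [simp]: "\<And>t. t \<in> ?S \<Longrightarrow> t \<in> M\<^sub>0" using S(2) by blast
  have S1 [simp]: "\<one> \<in> ?S" using submonoid.one_closed[OF S(1)] .
  have [simp]: "\<one> \<notin> p" using prime_ideal_one[OF p] .
  note eqB = fraction_eq[OF S]
  note multB = localization_mult[OF S(1)]
  let ?f = "fraction M ?S"
  interpret B: binoid ?B by (rule binoid_localization[OF S(1)])
  have hf: "\<exists>g x. g \<in> carrier G \<and> x \<in> carrier P \<and> h (?f a t) = (Some g, Some x)"
    if "a \<in> M\<^sub>0" "t \<in> ?S" for a t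
  proof -
    have "?f a t \<noteq> absorb ?B"
      unfolding absorb_localization eqB[OF nonabsorb_closed[OF that(1)] that(2) absorb_closed S1]
      using that nonabsorb_iff by (simp add: absorb_mult)
    then have "h (?f a t) \<noteq> absorb R"
      using h'(2,4) fraction_in_localization[OF nonabsorb_closed[OF that(1)] that(2)] B.absorb_closed
      unfolding bij_betw_def inj_on_def by metis
    moreover have "h (?f a t) \<in> carrier R"
      using bij_betwE[OF h'(2)] fraction_in_localization[OF nonabsorb_closed[OF that(1)] that(2)] by blast
    ultimately show ?thesis unfolding carR absR by blast
  qed
  \<comment> \<open>\<open>X\<close> reads off the exponent vector of a nonabsorbing fraction and
    forgets its component in G.\<close>
  define X where "X y = the (snd (h y))" for y
  have X: "X (?f (a \<otimes> b) (t \<otimes> u)) = (\<lambda>i\<in>{..<s}. X (?f a t) i + X (?f b u) i)"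
    if "a \<in> M\<^sub>0" "b \<in> M\<^sub>0" "t \<in> ?S" "u \<in> ?S" for a b t u
  proof -
    have "h (?f (a \<otimes> b) (t \<otimes> u)) = h (?f a t) \<otimes>\<^bsub>R\<^esub> h (?f b u)"
      using hom_mult[OF h'(1) fraction_in_localization[of a t ?S] fraction_in_localization[of b u ?S]]
        that multB[of a t b u] by simp
    then show ?thesis
      using hf[OF that(1,3)] hf[OF that(2,4)] by (auto simp: X_def multR multP)
  qed
  define \<xi> where "\<xi> i a = X (?f a \<one>) i" for i a
  have X1: "X (?f \<one> \<one>) = (\<lambda>i\<in>{..<s}. 0)"
    using h'(3) by (simp add: X_def one_localization oneR oneP)
  have add: "\<xi> i (a \<otimes> b) = \<xi> i a + \<xi> i b" if "i < s" "a \<in> M\<^sub>0" "b \<in> M\<^sub>0" for i a b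
    using X[OF that(2,3) S1 S1] that(1) by (simp add: \<xi>_def)
  \<comment> \<open>The fraction t/t is the unit, so the exponents of t and of 1/t add up to 0; as
    natural numbers they both vanish.\<close>
  have off: "\<xi> i t = 0" if "i < s" "t \<in> ?S" for i t
  proof -
    have "?f t t = ?f \<one> \<one>"
      using that(2) eqB[of t t \<one> \<one>] prime_ideal_one[OF p] by simp
    moreover have "X (?f t t) i = \<xi> i t + X (?f \<one> t) i"
      using fun_cong[OF X[OF SM[OF that(2)] nonabsorb_one S1 that(2)], of i] that by (simp add: \<xi>_def)
    ultimately have "\<xi> i t + X (?f \<one> t) i = 0" using X1 that(1) by simp
    then show ?thesis by simp
  qed
  have pre: "\<exists>a\<in>carrier M. \<exists>t\<in>?S. h (?f a t) = (Some g, Some x)" if "g \<in> carrier G" "x \<in> carrier P" for g x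
  proof -
    have "(Some g, Some x) \<in> h ` carrier ?B"
      using that bij_betw_imp_surj_on[OF h'(2)] carR by blast
    then obtain y where "y \<in> carrier ?B" "h y = (Some g, Some x)" by (metis imageE)
    then show ?thesis by (metis localizationE)
  qed
  have num: "a \<in> M\<^sub>0" if "a \<in> carrier M" "t \<in> ?S" "h (?f a t) = (Some g, Some x)" for a t g x
  proof (rule ccontr)
    assume "a \<notin> M\<^sub>0"
    then have "a = absorb M" using that(1) nonabsorb_iff by blast
    then have "?f a t = absorb ?B"
      unfolding absorb_localization using eqB[OF absorb_closed that(2) absorb_closed S1] that(2)
      by (simp add: absorb_mult)
    then show False using that(3) h'(4) absR by simp
  qed
  \<comment> \<open>If a/t is a preimage of the wanted vector, then its numerator a has the same
    exponents, because a/1 is the product of a/t and t/1, and t has exponents 0.\<close>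
  have surj: "\<exists>a\<in>M\<^sub>0. \<forall>i<s. \<xi> i a = k i" for k
  proof -
    obtain a t where a: "a \<in> carrier M" "t \<in> ?S" "h (?f a t) = (Some \<one>\<^bsub>G\<^esub>, Some (restrict k {..<s}))"
    proof -
      have "restrict k {..<s} \<in> carrier P" unfolding carP by simp
      from pre[OF G.one_closed this] show ?thesis using that by blast
    qed
    have a0: "a \<in> M\<^sub>0" using num[OF a] .
    have "?f (a \<otimes> t) (t \<otimes> \<one>) = ?f a \<one>"
      using eqB[of "a \<otimes> t" "t \<otimes> \<one>" a \<one>] a submonoid.m_closed[OF S(1)] by simp
    then have "\<xi> i a = k i" if "i < s" for i
      using X[OF a0 _ a(2) S1, of t] a(2,3) off[OF that a(2)] that by (simp add: \<xi>_def X_def)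
    then show ?thesis using a0 by blast
  qed
  have dvd: "\<exists>c\<in>M\<^sub>0. \<exists>t\<in>?S. a \<otimes> t = b \<otimes> c"
    if ab: "a \<in> M\<^sub>0" "b \<in> M\<^sub>0" and le: "\<forall>i<s. \<xi> i b \<le> \<xi> i a" for a b
  proof -
    obtain g x where gx: "g \<in> carrier G" "x \<in> carrier P" "h (?f a \<one>) = (Some g, Some x)"
      using hf[OF ab(1) S1] by blast
    obtain g' x' where gx': "g' \<in> carrier G" "x' \<in> carrier P" "h (?f b \<one>) = (Some g', Some x')"
      using hf[OF ab(2) S1] by blast
    have le': "x' i \<le> x i" if "i < s" for i
      using le that gx gx' by (simp add: \<xi>_def X_def)
    \<comment> \<open>The quotient of a by b, formed in the regular binoid and pulled back. The
      subtraction of naturals is exact because of \<open>le'\<close>.\<close>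
    obtain c t where c: "c \<in> carrier M" "t \<in> ?S"
      "h (?f c t) = (Some (inv\<^bsub>G\<^esub> g' \<otimes>\<^bsub>G\<^esub> g), Some (\<lambda>i\<in>{..<s}. x i - x' i))"
      using pre[of "inv\<^bsub>G\<^esub> g' \<otimes>\<^bsub>G\<^esub> g" "\<lambda>i\<in>{..<s}. x i - x' i"] gx gx' carP by auto
    have c0: "c \<in> M\<^sub>0" using num[OF c] .
    have x: "x' \<otimes>\<^bsub>P\<^esub> (\<lambda>i\<in>{..<s}. x i - x' i) = x"
      using gx(2) le' unfolding multP carP by (auto simp: fun_eq_iff PiE_iff extensional_def)
    have g: "g' \<otimes>\<^bsub>G\<^esub> (inv\<^bsub>G\<^esub> g' \<otimes>\<^bsub>G\<^esub> g) = g"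
      using gx gx' by (simp add: G.m_assoc[symmetric])
    have "h (?f (b \<otimes> c) (\<one> \<otimes> t)) = h (?f b \<one>) \<otimes>\<^bsub>R\<^esub> h (?f c t)"
      using hom_mult[OF h'(1) fraction_in_localization[of b \<one> ?S] fraction_in_localization[of c t ?S]]
        ab c multB[of b \<one> c t] S1 by simp
    also have "\<dots> = h (?f a \<one>)" unfolding gx(3) gx'(3) c(3) multR x g ..
    finally have "?f (b \<otimes> c) (\<one> \<otimes> t) = ?f a \<one>"
      using inj_onD[OF bij_betw_imp_inj_on[OF h'(2)] _
          fraction_in_localization[of "b \<otimes> c" "\<one> \<otimes> t" ?S] fraction_in_localization[of a \<one> ?S]]
        ab c by simp
    then have "b \<otimes> c \<otimes> \<one> = a \<otimes> (\<one> \<otimes> t)"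
      using eqB[of "b \<otimes> c" "\<one> \<otimes> t" a \<one>] ab c by simp
    then have "a \<otimes> t = b \<otimes> c" using ab c by simp
    then show ?thesis using c(2) c0 by blast
  qed
  have "coordinates p s \<xi>"
    unfolding coordinates_def by (intro conjI) (use add off surj dvd in blast)+
  then show ?thesis by blast
qed

section \<open>Primes of height one\<close>

lemma height_ge:
  "\<forall>i\<le>n. prime_ideal M (c i) \<Longrightarrow> \<forall>i<n. c i \<subset> c (Suc i) \<Longrightarrow> enat n \<le> height M (c n)"
  unfolding height_def by (rule Sup_upper) blast

lemma height_le:
  assumes "\<And>n c. \<forall>i\<le>n. prime_ideal M (c i) \<Longrightarrow> \<forall>i<n. c i \<subset> c (Suc i) \<Longrightarrow> c n = p \<Longrightarrow> n \<le> k"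
  shows "height M p \<le> enat k"
  unfolding height_def by (rule Sup_least) (use assms in auto)

text \<open>The generic point lies below every prime. So a chain of length one ends in p unless p is
  generic, and a chain of length two ends in p exactly if a prime other than the generic point lies
  strictly below p.\<close>

lemma height_eq_1_iff:
  assumes p: "prime_ideal M p"
  shows "height M p = 1 \<longleftrightarrow> p \<noteq> generic \<and> (\<forall>r. prime_ideal M r \<longrightarrow> r \<subset> p \<longrightarrow> r = generic)"
    (is "_ \<longleftrightarrow> ?R")
proof
  let ?C = "\<lambda>n c. (\<forall>i\<le>n. prime_ideal M (c i)) \<and> (\<forall>i<n. c i \<subset> c (Suc i)) \<and> c n = p"
  have below: "\<not> r \<subset> generic" if "prime_ideal M r" for r
    using generic_subset[OF that] by blast
  {
    assume ht: "height M p = 1"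
    have "p \<noteq> generic"
    proof
      assume pg: "p = generic"
      have "n = 0" if "?C n c" for n c
      proof (rule ccontr)
        assume "n \<noteq> 0"
        then obtain m where "n = Suc m" by (cases n) auto
        then have "c m \<subset> generic" "prime_ideal M (c m)" using that pg by auto
        then show False using below by blast
      qed
      then have "height M p \<le> enat 0" by (intro height_le) simp
      then show False using ht by (simp add: one_enat_def)
    qed
    moreover have "r = generic" if r: "prime_ideal M r" "r \<subset> p" for r
    proof (rule ccontr)
      assume "r \<noteq> generic"
      define c where "c = (\<lambda>i::nat. if i = 0 then generic else if i = 1 then r else p)"
      have "enat 2 \<le> height M (c 2)"
        by (rule height_ge) (use r p prime_generic generic_subset[OF r(1)] \<open>r \<noteq> generic\<close> in
          \<open>auto simp: c_def less_2_cases_iff\<close>)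
      moreover have "c 2 = p" by (simp add: c_def)
      ultimately show False using ht by (simp add: one_enat_def)
    qed
    ultimately show ?R by blast
  next
    assume R: ?R
    have "n \<le> 1" if "?C n c" for n c
    proof (rule ccontr)
      assume "\<not> n \<le> 1"
      then obtain m where n: "n = Suc (Suc m)" by (metis One_nat_def le_SucI le_refl not0_implies_Suc le0)
      then have *: "prime_ideal M (c (Suc m))" "c (Suc m) \<subset> p" "prime_ideal M (c m)" "c m \<subset> c (Suc m)"
        using that by auto
      then have "c (Suc m) = generic" using R by blast
      then show False using below[OF *(3)] *(4) by simp
    qed
    then have "height M p \<le> enat 1" by (intro height_le) simp
    moreover define c where "c = (\<lambda>i::nat. if i = 0 then generic else p)"
    have "enat 1 \<le> height M (c 1)"
      by (rule height_ge) (use R p prime_generic generic_subset[OF p] in \<open>auto simp: c_def\<close>)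
    moreover have "c 1 = p" by (simp add: c_def)
    ultimately show "height M p = 1" by (simp add: one_enat_def)
  }
qed

section \<open>Valuations on the difference group\<close>

definition extend_additive :: "('a \<Rightarrow> nat) \<Rightarrow> ('a \<times> 'a) set \<Rightarrow> int" where
  "extend_additive f g = (THE z. \<exists>a\<in>M\<^sub>0. \<exists>t\<in>M\<^sub>0. g = quo a t \<and> z = int (f a) - int (f t))"

text \<open>Two representations a/t = b/u give a u = b t and therefore the same difference of
  values; so the definite description in \<open>extend_additive\<close> has exactly one
  solution.\<close>

lemma extend_additive:
  assumes f: "\<And>a b. a \<in> M\<^sub>0 \<Longrightarrow> b \<in> M\<^sub>0 \<Longrightarrow> f (a \<otimes> b) = f a + f b"
    and a: "a \<in> M\<^sub>0" "t \<in> M\<^sub>0"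
  shows "extend_additive f (quo a t) = int (f a) - int (f t)"
  unfolding extend_additive_def
proof (rule the_equality)
  fix z assume "\<exists>b\<in>M\<^sub>0. \<exists>u\<in>M\<^sub>0. quo a t = quo b u \<and> z = int (f b) - int (f u)"
  then obtain b u where b: "b \<in> M\<^sub>0" "u \<in> M\<^sub>0" "quo a t = quo b u" "z = int (f b) - int (f u)" by blast
  then have "a \<otimes> u = b \<otimes> t" using quo_eq a by simp
  then have "f a + f u = f b + f t" using f[OF a(1) b(2)] f[OF b(1) a(2)] by simp
  then show "z = int (f a) - int (f t)" using b(4) by linarith
qed (use a in blast)

lemma extend_additive_hom:
  assumes f: "\<And>a b. a \<in> M\<^sub>0 \<Longrightarrow> b \<in> M\<^sub>0 \<Longrightarrow> f (a \<otimes> b) = f a + f b"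
  shows "extend_additive f \<in> hom \<Gamma> integer_group"
proof (rule homI)
  fix g h assume "g \<in> carrier \<Gamma>" "h \<in> carrier \<Gamma>"
  then obtain a t b u where *: "a \<in> M\<^sub>0" "t \<in> M\<^sub>0" "g = quo a t" "b \<in> M\<^sub>0" "u \<in> M\<^sub>0" "h = quo b u"
    by (metis diff_groupE)
  then show "extend_additive f (g \<otimes>\<^bsub>\<Gamma>\<^esub> h) = extend_additive f g \<otimes>\<^bsub>integer_group\<^esub> extend_additive f h"
    by (simp add: quo_mult extend_additive[OF f] f)
qed simp

text \<open>A description of the valuation at q without any choice of an isomorphism. That the value
  1 is attained excludes proper multiples of the normalised valuation.\<close>

definition is_valuation :: "'a set \<Rightarrow> (('a \<times> 'a) set \<Rightarrow> int) \<Rightarrow> bool" where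
  "is_valuation q v \<longleftrightarrow> v \<in> hom \<Gamma> integer_group \<and> (\<exists>g\<in>carrier \<Gamma>. v g = 1) \<and>
     (\<forall>g\<in>carrier \<Gamma>. 0 \<le> v g \<longleftrightarrow> g \<in> stalk q)"

lemma hom_integer_group:
  assumes "v \<in> hom \<Gamma> integer_group"
  shows "g \<in> carrier \<Gamma> \<Longrightarrow> h \<in> carrier \<Gamma> \<Longrightarrow> v (g \<otimes>\<^bsub>K\<^esub> h) = v g + v h"
    and "v \<one>\<^bsub>K\<^esub> = 0"
    and "g \<in> carrier \<Gamma> \<Longrightarrow> v (inv\<^bsub>\<Gamma>\<^esub> g) = - v g"
    and "g \<in> carrier \<Gamma> \<Longrightarrow> v (g [^]\<^bsub>\<Gamma>\<^esub> (k::int)) = k * v g"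
proof -
  interpret group_hom \<Gamma> integer_group v
    using assms by (simp add: group_hom_def group_hom_axioms_def)
  show "g \<in> carrier \<Gamma> \<Longrightarrow> h \<in> carrier \<Gamma> \<Longrightarrow> v (g \<otimes>\<^bsub>K\<^esub> h) = v g + v h"
    using hom_mult[of g h] by simp
  show "v \<one>\<^bsub>K\<^esub> = 0" using hom_one by (simp add: diff_group_one)
  show "g \<in> carrier \<Gamma> \<Longrightarrow> v (inv\<^bsub>\<Gamma>\<^esub> g) = - v g" using hom_inv[of g] by simp
  show "g \<in> carrier \<Gamma> \<Longrightarrow> v (g [^]\<^bsub>\<Gamma>\<^esub> (k::int)) = k * v g" using hom_int_pow[of g k] by simp
qed

text \<open>The nonnegative elements are prescribed; applied to g and its inverse, this shows that
  the kernel of v lies in that of w. So w is v times the number w(a), where v(a) = 1. This number is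
  nonnegative, and it divides 1 because w attains 1.\<close>

lemma is_valuation_unique:
  assumes v: "is_valuation q v" and w: "is_valuation q w" and g: "g \<in> carrier \<Gamma>"
  shows "v g = w g"
proof -
  have hv: "v \<in> hom \<Gamma> integer_group" and hw: "w \<in> hom \<Gamma> integer_group"
    and pos: "\<And>g. g \<in> carrier \<Gamma> \<Longrightarrow> 0 \<le> v g \<longleftrightarrow> 0 \<le> w g"
    using v w by (auto simp: is_valuation_def)
  obtain a b where a: "a \<in> carrier \<Gamma>" "v a = 1" and b: "b \<in> carrier \<Gamma>" "w b = 1"
    using v w unfolding is_valuation_def by blast
  have zero: "w g = 0" if "g \<in> carrier \<Gamma>" "v g = 0" for g
    using pos[OF that(1)] pos[of "inv\<^bsub>\<Gamma>\<^esub> g"] that hom_integer_group(3)[OF hv that(1)]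
      hom_integer_group(3)[OF hw that(1)] by simp
  \<comment> \<open>The element g a^(-v(g)) lies in the kernel of v.\<close>
  have scale: "w g = v g * w a" if "g \<in> carrier \<Gamma>" for g
    using zero[of "g \<otimes>\<^bsub>K\<^esub> a [^]\<^bsub>\<Gamma>\<^esub> (- v g)"] that a
    by (simp add: hom_integer_group(1,4)[OF hv] hom_integer_group(1,4)[OF hw])
  have "w a \<ge> 0" using pos[OF a(1)] a(2) by simp
  moreover have "v b * w a = 1" using scale[OF b(1)] b(2) by simp
  ultimately have "w a = 1" by (auto simp: zmult_eq_1_iff)
  then show ?thesis using scale[OF g] by simp
qed

text \<open>In coordinates on M_p, the prime Q_i consists of the elements with positive i-th
  exponent, and c_i is the i-th exponent extended to fractions. Since exponents control divisibility
  up to a factor outside p, elements can be treated like monomials in s variables.\<close>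

lemma regular_valuations:
  assumes p: "prime_ideal M p" and reg: "regular_binoid (localization_at M p)"
  shows "\<exists>(s :: nat) Q c.
    (\<forall>i<s. prime_ideal M (Q i) \<and> Q i \<subseteq> p \<and> height M (Q i) = 1 \<and> is_valuation (Q i) (c i)) \<and>
    (\<forall>q. prime_ideal M q \<longrightarrow> q \<subseteq> p \<longrightarrow> height M q = 1 \<longrightarrow> (\<exists>i<s. q = Q i)) \<and>
    (\<forall>i<s. \<forall>j<s. Q i = Q j \<longrightarrow> i = j) \<and>
    (\<forall>g\<in>carrier \<Gamma>. g \<in> stalk p \<longleftrightarrow> (\<forall>i<s. 0 \<le> c i g)) \<and>
    (\<forall>k. \<exists>g\<in>carrier \<Gamma>. \<forall>i<s. c i g = k i)"
proof -
  obtain s \<xi> where "coordinates p s \<xi>" using regular_coordinates[OF p reg] by blast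
  note \<xi> = this[unfolded coordinates_def, THEN conjunct1]
    this[unfolded coordinates_def, THEN conjunct2, THEN conjunct1]
    this[unfolded coordinates_def, THEN conjunct2, THEN conjunct2, THEN conjunct1]
    this[unfolded coordinates_def, THEN conjunct2, THEN conjunct2, THEN conjunct2]
  have add: "\<xi> i (a \<otimes> b) = \<xi> i a + \<xi> i b" if "i < s" "a \<in> M\<^sub>0" "b \<in> M\<^sub>0" for i a b
    using \<xi>(1) that by simp
  have off: "\<xi> i t = 0" if "i < s" "t \<in> carrier M - p" for i t
    using \<xi>(2) that by simp
  have surj: "\<exists>a\<in>M\<^sub>0. \<forall>i<s. \<xi> i a = k i" for k using \<xi>(3) by (rule spec)
  have dvd: "\<exists>c\<in>M\<^sub>0. \<exists>t\<in>carrier M - p. a \<otimes> t = b \<otimes> c"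
    if "a \<in> M\<^sub>0" "b \<in> M\<^sub>0" "\<forall>i<s. \<xi> i b \<le> \<xi> i a" for a b
    by (rule \<xi>(4)[rule_format, OF that(1,2)]) (use that(3) in blast)
  have SM: "t \<in> M\<^sub>0" if "t \<in> carrier M - p" for t using prime_compl_nonabsorb[OF p] that by blast
  define Q where "Q i = {m \<in> carrier M. m = absorb M \<or> \<xi> i m > 0}" for i
  define c where "c i = extend_additive (\<xi> i)" for i
  have c: "c i (quo a t) = int (\<xi> i a) - int (\<xi> i t)" if "i < s" "a \<in> M\<^sub>0" "t \<in> M\<^sub>0" for i a t
    unfolding c_def using extend_additive[of "\<xi> i"] add that by simp
  \<comment> \<open>The elements \<open>e i\<close> play the role of the variables of N^s.\<close>
  have "\<exists>e. e \<in> M\<^sub>0 \<and> (\<forall>j<s. \<xi> j e = (if j = i then 1 else 0))" for i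
    using surj[of "\<lambda>j. if j = i then 1 else 0"] by blast
  then obtain e where e: "\<And>i. e i \<in> M\<^sub>0" "\<And>i j. j < s \<Longrightarrow> \<xi> j (e i) = (if j = i then 1 else 0)"
    by metis
  have Q0: "m \<in> Q i \<longleftrightarrow> 0 < \<xi> i m" if "m \<in> M\<^sub>0" for m i
    using that nonabsorb_iff by (auto simp: Q_def)
  have Qp: "Q i \<subseteq> p" if "i < s" for i
    using off[OF that] prime_ideal_absorb[OF p] by (fastforce simp: Q_def)
  have prQ: "prime_ideal M (Q i)" if i: "i < s" for i
  proof (rule prime_idealI)
    show "\<one> \<notin> Q i" using Qp[OF i] prime_ideal_one[OF p] by blast
    fix a b assume ab: "a \<in> carrier M" "b \<in> carrier M"
    show "a \<otimes> b \<in> Q i \<longleftrightarrow> a \<in> Q i \<or> b \<in> Q i"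
    proof (cases "a \<in> M\<^sub>0 \<and> b \<in> M\<^sub>0")
      case True
      then show ?thesis using Q0 add[OF i] by simp
    next
      case False
      then have "a = absorb M \<or> b = absorb M" using ab nonabsorb_iff by blast
      then show ?thesis using ab mult_eq_absorb_iff[OF ab] absorb_closed by (auto simp: Q_def)
    qed
  qed (auto simp: Q_def absorb_closed)
  have dvd_e: "\<exists>d\<in>M\<^sub>0. \<exists>t\<in>carrier M - p. m \<otimes> t = e i \<otimes> d"
    if "m \<in> M\<^sub>0" "i < s" "0 < \<xi> i m" for m i
    by (rule dvd[OF that(1) e(1)]) (use that e(2) in auto)
  \<comment> \<open>Once the variable \<open>e i\<close> lies in a prime r below p, so does every m
    with positive i-th exponent: some m t is a multiple of \<open>e i\<close>, and t is outside p,
    hence outside r.\<close>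
  have pull: "m \<in> r" if r: "prime_ideal M r" "r \<subseteq> p" and m: "m \<in> M\<^sub>0" "i < s" "0 < \<xi> i m" and er: "e i \<in> r" for r m i
  proof -
    obtain d t where d: "d \<in> M\<^sub>0" "t \<in> carrier M - p" "m \<otimes> t = e i \<otimes> d"
      using dvd_e[OF m] by blast
    have "e i \<otimes> d \<in> r" using er prime_ideal_mult_iff[OF r(1)] d(1) e(1) by simp
    then show ?thesis using d r prime_ideal_mult_iff[OF r(1), of m t] m(1) by auto
  qed
  \<comment> \<open>From a nonabsorbing element of r one variable after the other is split off, up
    to factors outside p, until a variable itself lies in r. The total degree decreases, and degree
    0 cannot occur, because such an element divides an element outside p.\<close>
  have minimal: "\<exists>i<s. Q i \<subseteq> r" if r: "prime_ideal M r" "r \<subseteq> p" and ne: "r \<noteq> generic" for r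
  proof -
    have "\<exists>i<s. e i \<in> r" if "m \<in> M\<^sub>0" "m \<in> r" for m
      using that
    proof (induction "\<Sum>i<s. \<xi> i m" arbitrary: m rule: less_induct)
      case less
      show ?case
      proof (cases "\<forall>i<s. \<xi> i m = 0")
        case True
        then have "\<exists>d\<in>M\<^sub>0. \<exists>t\<in>carrier M - p. \<one> \<otimes> t = m \<otimes> d"
          using dvd[OF nonabsorb_one less.prems(1)] by simp
        then obtain d t where d: "d \<in> M\<^sub>0" "t \<in> carrier M - p" "\<one> \<otimes> t = m \<otimes> d" by blast
        have "m \<otimes> d \<in> r" using less.prems d(1) prime_ideal_mult_iff[OF r(1)] by simp
        then show ?thesis using d r(2) by auto
      next
        case False
        then obtain i where i: "i < s" "0 < \<xi> i m" by auto
        then obtain d t where d: "d \<in> M\<^sub>0" "t \<in> carrier M - p" "m \<otimes> t = e i \<otimes> d"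
          using dvd_e[OF less.prems(1)] by blast
        have "e i \<otimes> d \<in> r"
          unfolding d(3)[symmetric] using less.prems d(2) prime_ideal_mult_iff[OF r(1)] by simp
        then have "e i \<in> r \<or> d \<in> r" using prime_ideal_mult_iff[OF r(1)] e(1) d(1) by simp
        moreover have "(\<Sum>j<s. \<xi> j d) < (\<Sum>j<s. \<xi> j m)"
        proof (rule sum_strict_mono_ex1)
          have eq: "\<xi> j m = (if j = i then 1 else 0) + \<xi> j d" if "j < s" for j
            using arg_cong[OF d(3), of "\<xi> j"] add[OF that less.prems(1) SM[OF d(2)]]
              add[OF that e(1) d(1)] off[OF that d(2)] e(2)[OF that] by simp
          show "\<forall>j\<in>{..<s}. \<xi> j d \<le> \<xi> j m" using eq by simp
          show "\<exists>j\<in>{..<s}. \<xi> j d < \<xi> j m" using eq i(1) by (intro bexI[of _ i]) auto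
        qed simp
        ultimately show ?thesis using less.hyps d(1) i(1) by blast
      qed
    qed
    moreover obtain m where "m \<in> r" "m \<noteq> absorb M" using ne generic_subset[OF r(1)] by blast
    ultimately obtain i where i: "i < s" "e i \<in> r"
      using prime_ideal_closed[OF r(1)] nonabsorb_iff by blast
    have "Q i \<subseteq> r"
    proof
      fix x assume "x \<in> Q i"
      then have x: "x \<in> carrier M" "x = absorb M \<or> 0 < \<xi> i x" by (auto simp: Q_def)
      show "x \<in> r"
      proof (cases "x = absorb M")
        case False
        then have "x \<in> M\<^sub>0" "0 < \<xi> i x" using x nonabsorb_iff by blast+
        then show ?thesis using pull[OF r _ i(1) _ i(2)] by simp
      qed (use prime_ideal_absorb[OF r(1)] in simp)
    qed
    then show ?thesis using i by blast
  qed
  have eQ: "e i \<in> Q j \<longleftrightarrow> i = j" if "j < s" for i j using Q0[OF e(1)] e(2)[OF that] by simp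
  have QQ: "i = j" if "i < s" "j < s" "Q i \<subseteq> Q j" for i j
    using eQ[OF that(1), of i] eQ[OF that(2), of i] that(3) by blast
  have Qg: "Q i \<noteq> generic" if "i < s" for i
    using eQ[OF that, of i] e(1)[of i] nonabsorb_iff by blast
  have htQ: "height M (Q i) = 1" if i: "i < s" for i
    unfolding height_eq_1_iff[OF prQ[OF i]]
  proof (intro conjI Qg[OF i] allI impI)
    fix r assume r: "prime_ideal M r" "r \<subset> Q i"
    show "r = generic"
    proof (rule ccontr)
      assume "r \<noteq> generic"
      then obtain j where "j < s" "Q j \<subseteq> r" using minimal[OF r(1)] r(2) Qp[OF i] by blast
      then show False using QQ[of j i] r(2) i by blast
    qed
  qed
  have val: "is_valuation (Q i) (c i)" if i: "i < s" for i
    unfolding is_valuation_def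
  proof (intro conjI ballI)
    show "c i \<in> hom \<Gamma> integer_group" unfolding c_def using extend_additive_hom add[OF i] by blast
    have "\<xi> i \<one> = 0" using off[OF i] prime_ideal_one[OF p] by simp
    then show "\<exists>g\<in>carrier \<Gamma>. c i g = 1"
      using c[OF i e(1)[of i] nonabsorb_one] e(1)[of i] e(2)[OF i, of i]
      by (intro bexI[of _ "quo (e i) \<one>"]) auto
    fix g assume g: "g \<in> carrier \<Gamma>"
    show "0 \<le> c i g \<longleftrightarrow> g \<in> stalk (Q i)"
    proof
      assume "g \<in> stalk (Q i)"
      then obtain a f where a: "g = quo a f" "a \<in> carrier M" "f \<in> carrier M - Q i"
        by (auto simp: stalk_def)
      have f: "f \<in> M\<^sub>0" using a(3) prime_compl_nonabsorb[OF prQ[OF i]] by blast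
      have "a \<in> M\<^sub>0" using quo_eq_absorb_iff[OF a(2) f] g a(1,2) nonabsorb_iff diff_group_iff by blast
      then show "0 \<le> c i g" using c[OF i _ f] a(1,3) Q0[OF f] by simp
    next
      assume pos: "0 \<le> c i g"
      obtain a t where a: "a \<in> M\<^sub>0" "t \<in> M\<^sub>0" "g = quo a t" using g by (rule diff_groupE)
      have le: "\<xi> i t \<le> \<xi> i a" using pos c[OF i a(1,2)] a(3) by simp
      \<comment> \<open>The element b has the i-th exponent of t and no other, so it divides both a
        and t up to factors outside p. Cancelling it leaves a denominator with i-th exponent 0,
        which is therefore outside Q_i.\<close>
      obtain b where b: "b \<in> M\<^sub>0" "\<forall>j<s. \<xi> j b = (if j = i then \<xi> i t else 0)"
        using surj[of "\<lambda>j. if j = i then \<xi> i t else 0"] by blast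
      obtain d u where d: "d \<in> M\<^sub>0" "u \<in> carrier M - p" "a \<otimes> u = b \<otimes> d"
        using dvd[OF a(1) b(1)] b(2) le by (metis le0)
      obtain d' u' where d': "d' \<in> M\<^sub>0" "u' \<in> carrier M - p" "t \<otimes> u' = b \<otimes> d'"
        using dvd[OF a(2) b(1)] b(2) by (metis le0 le_refl)
      note in0 = a(1,2) b(1) d(1) d'(1) SM[OF d(2)] SM[OF d'(2)]
      note incl = in0[THEN nonabsorb_closed]
      have "\<xi> i d' = 0"
        using arg_cong[OF d'(3), of "\<xi> i"] add[OF i a(2) SM[OF d'(2)]] add[OF i b(1) d'(1)]
          off[OF i d'(2)] b(2) i by simp
      then have "\<xi> i (d' \<otimes> u) = 0" using add[OF i d'(1) SM[OF d(2)]] off[OF i d(2)] by simp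
      then have nQ: "d' \<otimes> u \<in> carrier M - Q i" using Q0[of "d' \<otimes> u" i] in0 by simp
      have "b \<otimes> (a \<otimes> (d' \<otimes> u)) = a \<otimes> u \<otimes> (b \<otimes> d')" using incl by (simp add: m_ac)
      also have "\<dots> = b \<otimes> d \<otimes> (t \<otimes> u')" unfolding d(3) d'(3) ..
      also have "\<dots> = b \<otimes> (d \<otimes> u' \<otimes> t)" using incl by (simp add: m_ac)
      finally have "a \<otimes> (d' \<otimes> u) = d \<otimes> u' \<otimes> t" using cancel_left[OF b(1)] incl by simp
      then have "g = quo (d \<otimes> u') (d' \<otimes> u)"
        unfolding a(3) using quo_eq[of a t "d \<otimes> u'" "d' \<otimes> u"] in0 by simp
      then show "g \<in> stalk (Q i)"
        unfolding stalk_def using nQ nonabsorb_closed[OF nonabsorb_mult[OF in0(4,7)]] by blast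
    qed
  qed
  have 1: "prime_ideal M (Q i) \<and> Q i \<subseteq> p \<and> height M (Q i) = 1 \<and> is_valuation (Q i) (c i)" if "i < s" for i
    using prQ Qp htQ val that by blast
  have 2: "\<exists>i<s. q = Q i" if q: "prime_ideal M q" "q \<subseteq> p" "height M q = 1" for q
  proof -
    have q1: "q \<noteq> generic" "\<And>r. prime_ideal M r \<Longrightarrow> r \<subset> q \<Longrightarrow> r = generic"
      using q(3) unfolding height_eq_1_iff[OF q(1)] by blast+
    obtain i where "i < s" "Q i \<subseteq> q" using minimal[OF q(1,2) q1(1)] by blast
    then show ?thesis using q1(2)[OF prQ] Qg by blast
  qed
  have 3: "i = j" if "i < s" "j < s" "Q i = Q j" for i j using QQ that by blast
  \<comment> \<open>The positive and the negative part of an integer vector are realised by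
    numerator and denominator.\<close>
  have 4: "\<exists>g\<in>carrier \<Gamma>. \<forall>i<s. c i g = k i" for k
  proof -
    obtain a where a: "a \<in> M\<^sub>0" "\<forall>i<s. \<xi> i a = nat (k i)"
      using surj[of "\<lambda>i. nat (k i)"] by blast
    obtain t where t: "t \<in> M\<^sub>0" "\<forall>i<s. \<xi> i t = nat (- k i)"
      using surj[of "\<lambda>i. nat (- k i)"] by blast
    show ?thesis using c[OF _ a(1) t(1)] a t by (intro bexI[of _ "quo a t"]) auto
  qed
  have 5: "g \<in> stalk p \<longleftrightarrow> (\<forall>i<s. 0 \<le> c i g)" if g: "g \<in> carrier \<Gamma>" for g
  proof
    assume "g \<in> stalk p"
    then obtain a f where a: "g = quo a f" "a \<in> carrier M" "f \<in> carrier M - p"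
      by (auto simp: stalk_def)
    have "a \<in> M\<^sub>0"
      using quo_eq_absorb_iff[OF a(2) SM[OF a(3)]] g a(1,2) nonabsorb_iff diff_group_iff by blast
    then show "\<forall>i<s. 0 \<le> c i g" using c[OF _ _ SM[OF a(3)]] off[OF _ a(3)] a(1) by simp
  next
    assume pos: "\<forall>i<s. 0 \<le> c i g"
    obtain a t where a: "a \<in> M\<^sub>0" "t \<in> M\<^sub>0" "g = quo a t" using g by (rule diff_groupE)
    \<comment> \<open>Here the whole denominator t divides a, up to a factor u outside p, and g
      becomes a fraction with denominator u.\<close>
    have "\<forall>i<s. \<xi> i t \<le> \<xi> i a" using pos c[OF _ a(1,2)] a(3) by simp
    then obtain d u where d: "d \<in> M\<^sub>0" "u \<in> carrier M - p" "a \<otimes> u = t \<otimes> d"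
      using dvd[OF a(1,2)] by blast
    have "g = quo d u"
      unfolding a(3) using quo_eq[of a t d u] a d SM[OF d(2)] m_comm[of t d] by simp
    then show "g \<in> stalk p" unfolding stalk_def using nonabsorb_closed[OF d(1)] d(2) by blast
  qed
  show ?thesis
    by (intro exI[of _ s] exI[of _ Q] exI[of _ c] conjI) (use 1 2 3 4 5 in blast)+
qed

text \<open>The elements of M with image in the generated subgroup, together with the absorbing
  element, form a submonoid containing the generators, hence all of M; denominators are then reached
  by inverses.\<close>

lemma diff_group_generators:
  "generate \<Gamma> ((\<lambda>a. quo a \<one>) ` (generators \<inter> M\<^sub>0)) = carrier \<Gamma>"
proof -
  let ?A = "(\<lambda>a. quo a \<one>) ` (generators \<inter> M\<^sub>0)"
  have A: "?A \<subseteq> carrier \<Gamma>" by auto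
  define H where "H = {m \<in> carrier M. m = absorb M \<or> quo m \<one> \<in> generate \<Gamma> ?A}"
  have H0: "m \<in> H \<longleftrightarrow> quo m \<one> \<in> generate \<Gamma> ?A" if "m \<in> M\<^sub>0" for m
    using that nonabsorb_iff by (auto simp: H_def)
  have "H = carrier M"
  proof (rule generators(3))
    show "submonoid H M"
    proof (rule submonoid.intro)
      show "H \<subseteq> carrier M" by (auto simp: H_def)
      show "\<one> \<in> H"
        using H0[OF nonabsorb_one] generate.one[of \<Gamma> ?A]
        by (simp add: diff_group_one quo_self)
      fix x y assume xy: "x \<in> H" "y \<in> H"
      then have c: "x \<in> carrier M" "y \<in> carrier M" by (auto simp: H_def)
      show "x \<otimes> y \<in> H"
      proof (cases "x \<in> M\<^sub>0 \<and> y \<in> M\<^sub>0")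
        case True
        then have "quo (x \<otimes> y) \<one> = quo x \<one> \<otimes>\<^bsub>\<Gamma>\<^esub> quo y \<one>" by (simp add: quo_mult)
        then show ?thesis using True xy H0 generate.eng[of _ \<Gamma> ?A] by simp
      next
        case False
        then have "x \<otimes> y = absorb M" using c nonabsorb_iff mult_eq_absorb_iff by blast
        then show ?thesis by (simp add: H_def absorb_closed)
      qed
    qed
    show "absorb M \<in> H" by (simp add: H_def absorb_closed)
    show "generators \<subseteq> H"
    proof
      fix a assume a: "a \<in> generators"
      then have "a \<in> carrier M" using generators(2) by blast
      then show "a \<in> H"
        using a H0[of a] generate.incl[of "quo a \<one>" ?A \<Gamma>] nonabsorb_iff[of a] by (auto simp: H_def)
    qed
  qed
  then have num: "quo a \<one> \<in> generate \<Gamma> ?A" if "a \<in> M\<^sub>0" for a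
    using H0[OF that] that by simp
  show ?thesis
  proof (intro subset_antisym subsetI)
    fix g assume "g \<in> generate \<Gamma> ?A"
    then show "g \<in> carrier \<Gamma>" using \<Gamma>.generate_in_carrier[OF A] by blast
  next
    fix g assume "g \<in> carrier \<Gamma>"
    then obtain a s where a: "a \<in> M\<^sub>0" "s \<in> M\<^sub>0" "g = quo a s" by (rule diff_groupE)
    have "g = quo a \<one> \<otimes>\<^bsub>\<Gamma>\<^esub> inv\<^bsub>\<Gamma>\<^esub> quo s \<one>"
      using a by (simp add: inv_quo quo_mult)
    then show "g \<in> generate \<Gamma> ?A"
      using num[OF a(1)] \<Gamma>.generate_m_inv_closed[OF A num[OF a(2)]] generate.eng by metis
  qed
qed

text \<open>Whatever isomorphism the \<open>SOME\<close> in \<open>valuation\<close> selects, its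
  last component satisfies \<open>is_valuation\<close>; so the point is that one exists. As v
  attains 1, the difference group splits into the kernel of v and a copy of Z. The kernel is
  finitely generated, being a quotient, and torsion-free because M is, so it is some Z^n.\<close>

lemma is_valuation_valuation:
  assumes tf: "torsion_free_binoid M" and q: "prime_ideal M q" and v: "is_valuation q v"
  shows "is_valuation q (valuation M q)"
proof -
  have hv: "v \<in> hom \<Gamma> integer_group" and pos: "\<And>g. g \<in> carrier \<Gamma> \<Longrightarrow> 0 \<le> v g \<longleftrightarrow> g \<in> stalk q"
    using v by (auto simp: is_valuation_def)
  obtain \<gamma> where \<gamma>: "\<gamma> \<in> carrier \<Gamma>" "v \<gamma> = 1" using v by (auto simp: is_valuation_def)
  note hvs = hom_integer_group[OF hv]
  interpret v: group_hom \<Gamma> integer_group v using hv by (simp add: group_hom_def group_hom_axioms_def)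
  define H where "H = kernel \<Gamma> integer_group v"
  define \<Gamma>' where "\<Gamma>' = \<Gamma>\<lparr>carrier := H\<rparr>"
  have H: "h \<in> H \<longleftrightarrow> h \<in> carrier \<Gamma> \<and> v h = 0" for h by (simp add: H_def kernel_def)
  have sub: "subgroup H \<Gamma>" unfolding H_def by (rule v.subgroup_kernel)
  have [simp]: "carrier \<Gamma>' = H" "\<And>x y. x \<otimes>\<^bsub>\<Gamma>'\<^esub> y = x \<otimes>\<^bsub>K\<^esub> y" "\<one>\<^bsub>\<Gamma>'\<^esub> = \<one>\<^bsub>\<Gamma>\<^esub>"
    by (simp_all add: \<Gamma>'_def)
  have grp': "group \<Gamma>'" unfolding \<Gamma>'_def by (rule subgroup.subgroup_is_group[OF sub \<Gamma>.is_group])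
  interpret \<Gamma>': comm_group \<Gamma>'
    by (rule group.group_comm_groupI[OF grp']) (simp add: H K.m_comm)
  \<comment> \<open>Projection onto the kernel along \<gamma>. It presents the kernel as an image of
    the difference group, so finite generation follows from images of generators.\<close>
  define \<pi> where "\<pi> g = g \<otimes>\<^bsub>K\<^esub> \<gamma> [^]\<^bsub>\<Gamma>\<^esub> (- v g)" for g
  have \<pi>H: "\<pi> g \<in> H" if "g \<in> carrier \<Gamma>" for g
    using that \<gamma> by (simp add: H \<pi>_def hvs(1,4))
  have \<pi>id: "\<pi> h = h" if "h \<in> H" for h
    using that K.r_one[of h] by (simp add: H \<pi>_def diff_group_one)
  have \<pi>hom: "\<pi> \<in> hom \<Gamma> \<Gamma>'"
  proof (rule homI)
    fix g h assume gh: "g \<in> carrier \<Gamma>" "h \<in> carrier \<Gamma>"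
    have "\<gamma> [^]\<^bsub>\<Gamma>\<^esub> (- v g + - v h) = \<gamma> [^]\<^bsub>\<Gamma>\<^esub> (- v g) \<otimes>\<^bsub>K\<^esub> \<gamma> [^]\<^bsub>\<Gamma>\<^esub> (- v h)"
      using \<Gamma>.int_pow_mult[OF \<gamma>(1), of "- v g" "- v h"] by (simp only: diff_group_mult)
    moreover have "- v (g \<otimes>\<^bsub>K\<^esub> h) = - v g + - v h" using gh by (simp add: hvs(1))
    ultimately show "\<pi> (g \<otimes>\<^bsub>\<Gamma>\<^esub> h) = \<pi> g \<otimes>\<^bsub>\<Gamma>'\<^esub> \<pi> h"
      unfolding \<pi>_def using gh \<gamma>(1) by (simp add: K.m_ac)
  qed (simp add: \<pi>H)
  have \<pi>onto: "\<pi> ` carrier \<Gamma> = H"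
  proof (intro subset_antisym image_subsetI \<pi>H subsetI)
    fix h assume "h \<in> H"
    then show "h \<in> \<pi> ` carrier \<Gamma>" using \<pi>id H by (metis image_eqI)
  qed
  define A where "A = (\<lambda>a. quo a \<one>) ` (generators \<inter> M\<^sub>0)"
  have A: "finite A" "A \<subseteq> carrier \<Gamma>" "generate \<Gamma> A = carrier \<Gamma>"
    unfolding A_def
  proof -
    show "(\<lambda>a. quo a \<one>) ` (generators \<inter> M\<^sub>0) \<subseteq> carrier \<Gamma>" by (rule image_subsetI) simp
  qed (intro finite_imageI finite_Int disjI1 generators(1) diff_group_generators)+
  interpret \<pi>: group_hom \<Gamma> \<Gamma>' \<pi>
    using \<pi>hom grp' by (simp add: group_hom_def group_hom_axioms_def)
  have gen: "generate \<Gamma>' (\<pi> ` A) = carrier \<Gamma>'"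
    using \<pi>.generate_img[OF A(2)] A(3) \<pi>onto by simp
  have sub_A: "\<pi> ` A \<subseteq> carrier \<Gamma>'" using A(2) \<pi>H by auto
  \<comment> \<open>If x = a/s has trivial n-th power, then a^n = s^n holds in M, and
    torsion-freeness of M gives a = s.\<close>
  have tor: "x = \<one>\<^bsub>\<Gamma>'\<^esub>" if x: "x \<in> carrier \<Gamma>'" "n \<ge> 1" "x [^]\<^bsub>\<Gamma>'\<^esub> (n::nat) = \<one>\<^bsub>\<Gamma>'\<^esub>" for x n
  proof -
    have x\<Gamma>: "x \<in> carrier \<Gamma>" using x(1) H by simp
    obtain a s where a: "a \<in> M\<^sub>0" "s \<in> M\<^sub>0" "x = quo a s" using x\<Gamma> by (rule diff_groupE)
    have pow0: "b [^] m \<in> M\<^sub>0" if "b \<in> M\<^sub>0" for b and m :: nat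
      using that by (induction m) auto
    have pow: "quo a s [^]\<^bsub>\<Gamma>'\<^esub> m = quo (a [^] m) (s [^] m)" for m :: nat
      using a pow0 by (induction m) (simp_all add: diff_group_one quo_self quo_mult)
    have "quo (a [^] n) (s [^] n) = quo \<one> \<one>"
      using x(3) unfolding a(3) pow by (simp add: diff_group_one quo_self)
    then have "a [^] n = s [^] n"
      using quo_eq[of "a [^] n" "s [^] n" \<one> \<one>] pow0 a by simp
    then have "a = s"
      using tf a x(2) pow0[OF a(1), of n] nonabsorb_iff unfolding torsion_free_binoid_def by blast
    then show ?thesis using a by (simp add: diff_group_one quo_self)
  qed
  have "\<exists>n::nat. product_group {..<n} (\<lambda>_. integer_group) \<cong> \<Gamma>'"
    by (rule \<Gamma>'.torsion_free_fg_iso[OF finite_imageI[OF A(1)] sub_A gen]) (rule tor)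
  then obtain n :: nat where "product_group {..<n} (\<lambda>_. integer_group) \<cong> \<Gamma>'" by (rule exE)
  then have "\<Gamma>' \<cong> product_group {..<n} (\<lambda>_. integer_group)"
    by (rule group.iso_sym[OF product_group[OF group_integer_group], rotated])
  then obtain \<psi> where \<psi>: "\<psi> \<in> iso \<Gamma>' (product_group {..<n} (\<lambda>_. integer_group))"
    by (auto simp: is_iso_def)
  let ?Z = "product_group {..<n} (\<lambda>_. integer_group)"
  have \<psi>b: "bij_betw \<psi> H (carrier ?Z)" and \<psi>h: "\<psi> \<in> hom \<Gamma>' ?Z"
    using \<psi> unfolding iso_def by simp_all
  \<comment> \<open>The splitting in coordinates: the kernel part as a vector of integers, and the
    value of v.\<close>
  define \<phi> where "\<phi> g = (\<psi> (\<pi> g), v g)" for g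
  have \<phi>_surj: "\<exists>g\<in>carrier \<Gamma>. \<phi> g = (x, k)" if x: "x \<in> carrier ?Z" for x k
  proof -
    obtain h where h: "h \<in> H" "\<psi> h = x"
      using x bij_betw_imp_surj_on[OF \<psi>b] by (metis imageE)
    let ?g = "h \<otimes>\<^bsub>K\<^esub> \<gamma> [^]\<^bsub>\<Gamma>\<^esub> k"
    have hc: "h \<in> carrier \<Gamma>" "v h = 0" using h(1) H by auto
    have vg: "v ?g = k" using hc \<gamma> by (simp add: hvs(1,4))
    have "\<gamma> [^]\<^bsub>\<Gamma>\<^esub> k \<otimes>\<^bsub>K\<^esub> \<gamma> [^]\<^bsub>\<Gamma>\<^esub> (- k) = \<one>\<^bsub>K\<^esub>"
      using \<Gamma>.int_pow_mult[OF \<gamma>(1), of k "- k"] by (simp add: diff_group_one)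
    then have "\<pi> ?g = h"
      unfolding \<pi>_def vg using hc \<gamma>(1) by (simp add: K.m_assoc)
    then show ?thesis using vg h(2) hc \<gamma>(1) by (intro bexI[of _ ?g]) (simp_all add: \<phi>_def)
  qed
  have \<phi>hom: "\<phi> \<in> hom \<Gamma> (?Z \<times>\<times> integer_group)"
  proof (rule homI)
    fix g assume "g \<in> carrier \<Gamma>"
    then show "\<phi> g \<in> carrier (?Z \<times>\<times> integer_group)"
      using bij_betwE[OF \<psi>b] \<pi>H by (simp add: \<phi>_def DirProd_def)
  next
    fix g h assume gh: "g \<in> carrier \<Gamma>" "h \<in> carrier \<Gamma>"
    have "\<psi> (\<pi> (g \<otimes>\<^bsub>\<Gamma>\<^esub> h)) = \<psi> (\<pi> g) \<otimes>\<^bsub>?Z\<^esub> \<psi> (\<pi> h)"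
      using hom_mult[OF \<pi>hom gh] hom_mult[OF \<psi>h, of "\<pi> g" "\<pi> h"] gh \<pi>H by simp
    then show "\<phi> (g \<otimes>\<^bsub>\<Gamma>\<^esub> h) = \<phi> g \<otimes>\<^bsub>?Z \<times>\<times> integer_group\<^esub> \<phi> h"
      using gh by (simp add: \<phi>_def DirProd_def hvs(1))
  qed
  have \<phi>inj: "inj_on \<phi> (carrier \<Gamma>)"
  proof (rule inj_onI)
    fix g h assume gh: "g \<in> carrier \<Gamma>" "h \<in> carrier \<Gamma>" and "\<phi> g = \<phi> h"
    then have "\<psi> (\<pi> g) = \<psi> (\<pi> h)" and vv: "v g = v h" by (simp_all add: \<phi>_def)
    then have "\<pi> g = \<pi> h"
      using inj_onD[OF bij_betw_imp_inj_on[OF \<psi>b]] \<pi>H gh by blast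
    then show "g = h"
      using gh \<gamma>(1) vv K_cancel[of "\<gamma> [^]\<^bsub>\<Gamma>\<^esub> (- v h)" g h] K.m_comm by (simp add: \<pi>_def)
  qed
  have "\<phi> ` carrier \<Gamma> = carrier (?Z \<times>\<times> integer_group)"
  proof (intro subset_antisym subsetI)
    fix z assume "z \<in> \<phi> ` carrier \<Gamma>"
    then show "z \<in> carrier (?Z \<times>\<times> integer_group)" using hom_in_carrier[OF \<phi>hom] by blast
  next
    fix z assume "z \<in> carrier (?Z \<times>\<times> integer_group)"
    then have "fst z \<in> carrier ?Z" by (simp only: DirProd_def partial_object.simps mem_Times_iff)
    then obtain g where "g \<in> carrier \<Gamma>" "\<phi> g = (fst z, snd z)" using \<phi>_surj by blast
    then show "z \<in> \<phi> ` carrier \<Gamma>" by (metis image_eqI prod.collapse)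
  qed
  then have \<phi>iso: "\<phi> \<in> iso \<Gamma> (?Z \<times>\<times> integer_group)"
    using \<phi>hom \<phi>inj by (simp add: iso_def bij_betw_def)
  \<comment> \<open>The set of fractions in the definition of \<open>valuation\<close> is the stalk
    without its absorbing element.\<close>
  have stalk_eq: "{quo a s | a s. a \<in> M\<^sub>0 \<and> s \<in> carrier M - q} = stalk q \<inter> carrier \<Gamma>" (is "?L = ?R")
  proof (intro subset_antisym subsetI)
    fix x assume "x \<in> ?L"
    then obtain a s where "a \<in> M\<^sub>0" "s \<in> carrier M - q" "x = quo a s" by blast
    then show "x \<in> ?R"
      using prime_compl_nonabsorb[OF q] nonabsorb_closed[of a] unfolding stalk_def by blast
  next
    fix x assume x: "x \<in> ?R"
    then obtain a s where a: "a \<in> carrier M" "s \<in> carrier M - q" "x = quo a s" by (auto simp: stalk_def)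
    then have "a \<in> M\<^sub>0"
      using x quo_eq_absorb_iff[of a s] prime_compl_nonabsorb[OF q] nonabsorb_iff diff_group_iff by blast
    then show "x \<in> ?L" using a by blast
  qed
  have "\<phi> ` (stalk q \<inter> carrier \<Gamma>) = carrier ?Z \<times> {0..}"
  proof (intro subset_antisym subsetI)
    fix z assume "z \<in> \<phi> ` (stalk q \<inter> carrier \<Gamma>)"
    then obtain g where g: "g \<in> carrier \<Gamma>" "g \<in> stalk q" "z = \<phi> g" by blast
    then show "z \<in> carrier ?Z \<times> {0..}"
      using pos[OF g(1)] bij_betwE[OF \<psi>b] \<pi>H[OF g(1)] by (simp add: \<phi>_def)
  next
    fix z assume "z \<in> carrier ?Z \<times> {0::int..}"
    then obtain x k where z: "z = (x, k)" "x \<in> carrier ?Z" "0 \<le> k" by auto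
    obtain g where g: "g \<in> carrier \<Gamma>" "\<phi> g = (x, k)" using \<phi>_surj[OF z(2)] by blast
    then have "v g = k" by (simp add: \<phi>_def)
    then have "g \<in> stalk q" using pos[OF g(1)] z(3) by simp
    then show "z \<in> \<phi> ` (stalk q \<inter> carrier \<Gamma>)" using g z(1) by (metis IntI image_eqI)
  qed
  then have ex: "\<exists>w (n :: nat) \<phi>.
        \<phi> \<in> iso \<Gamma> (product_group {..<n} (\<lambda>_. integer_group) \<times>\<times> integer_group) \<and>
        \<phi> ` {quo a s | a s. a \<in> M\<^sub>0 \<and> s \<in> carrier M - q} =
          carrier (product_group {..<n} (\<lambda>_. integer_group)) \<times> {0..} \<and>
        w = restrict (snd \<circ> \<phi>) (carrier \<Gamma>)"
    unfolding stalk_eq using \<phi>iso by blast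
  \<comment> \<open>From here on only the selected isomorphism \<theta> matters; \<phi> has shown
    that there is something to select, and \<theta> may differ from it, even in the number of
    factors as far as the proof knows.\<close>
  obtain m :: nat and \<theta> where \<theta>: "\<theta> \<in> iso \<Gamma> (product_group {..<m} (\<lambda>_. integer_group) \<times>\<times> integer_group)"
    "\<theta> ` (stalk q \<inter> carrier \<Gamma>) = carrier (product_group {..<m} (\<lambda>_. integer_group)) \<times> {0..}"
    "valuation M q = restrict (snd \<circ> \<theta>) (carrier \<Gamma>)"
    using someI_ex[OF ex, folded valuation_def] unfolding stalk_eq by blast
  let ?Y = "product_group {..<m} (\<lambda>_. integer_group)"
  have val: "valuation M q g = snd (\<theta> g)" if "g \<in> carrier \<Gamma>" for g using that by (simp add: \<theta>(3))
  have \<theta>h: "\<theta> \<in> hom \<Gamma> (?Y \<times>\<times> integer_group)" and \<theta>b: "bij_betw \<theta> (carrier \<Gamma>) (carrier ?Y \<times> UNIV)"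
    using \<theta>(1) by (simp_all add: iso_def DirProd_def)
  show ?thesis
    unfolding is_valuation_def
  proof (intro conjI ballI)
    show "valuation M q \<in> hom \<Gamma> integer_group"
    proof (rule homI)
      fix g h assume gh: "g \<in> carrier \<Gamma>" "h \<in> carrier \<Gamma>"
      then have "snd (\<theta> (g \<otimes>\<^bsub>\<Gamma>\<^esub> h)) = snd (\<theta> g) + snd (\<theta> h)"
        using hom_mult[OF \<theta>h gh] by (simp add: DirProd_def case_prod_beta)
      then show "valuation M q (g \<otimes>\<^bsub>\<Gamma>\<^esub> h) = valuation M q g \<otimes>\<^bsub>integer_group\<^esub> valuation M q h"
        using gh by (simp add: val)
    qed simp
    \<comment> \<open>The preimage of (0, 1) provides the normalisation.\<close>
    have "((\<lambda>i\<in>{..<m}. 0), 1) \<in> \<theta> ` carrier \<Gamma>"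
      unfolding bij_betw_imp_surj_on[OF \<theta>b] by simp
    then show "\<exists>g\<in>carrier \<Gamma>. valuation M q g = 1"
      using val by (metis imageE snd_conv)
    fix g assume g: "g \<in> carrier \<Gamma>"
    have "\<theta> g \<in> carrier ?Y \<times> {0..} \<longleftrightarrow> g \<in> stalk q"
    proof
      assume "\<theta> g \<in> carrier ?Y \<times> {0..}"
      then have "\<theta> g \<in> \<theta> ` (stalk q \<inter> carrier \<Gamma>)" by (simp only: \<theta>(2))
      then show "g \<in> stalk q"
      proof (rule imageE)
        fix g' assume "\<theta> g = \<theta> g'" "g' \<in> stalk q \<inter> carrier \<Gamma>"
        then show ?thesis using inj_onD[OF bij_betw_imp_inj_on[OF \<theta>b], of g g'] g by simp
      qed
    next
      assume "g \<in> stalk q"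
      then show "\<theta> g \<in> carrier ?Y \<times> {0..}" unfolding \<theta>(2)[symmetric] using g by blast
    qed
    then show "0 \<le> valuation M q g \<longleftrightarrow> g \<in> stalk q"
      using bij_betwE[OF \<theta>b] g val[OF g] by (metis atLeast_iff mem_Times_iff)
  qed
qed

end

section \<open>The valuations at the primes of height one in V\<close>

locale regular_spectrum = fg_cancellative_domain +
  fixes V :: "'a set set"
  assumes torsion_free: "torsion_free_binoid M"
    and open_V: "openin (Spec M) V"
    and regular: "p \<in> V \<Longrightarrow> regular_binoid (localization_at M p)"
begin

abbreviation "ht1 \<equiv> height_one_primes M"

lemma prime_V: "p \<in> V \<Longrightarrow> prime_ideal M p"
  using openin_Spec_prime[OF open_V] .

lemma is_valuation:
  assumes q: "q \<in> ht1 V"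
  shows "is_valuation q (valuation M q)"
proof -
  have q': "q \<in> V" "prime_ideal M q" "height M q = 1"
    using q by (auto simp: height_one_primes_def)
  obtain s :: nat and Q c where
    "\<forall>i<s. prime_ideal M (Q i) \<and> Q i \<subseteq> q \<and> height M (Q i) = 1 \<and> is_valuation (Q i) (c i)"
    "\<forall>r. prime_ideal M r \<longrightarrow> r \<subseteq> q \<longrightarrow> height M r = 1 \<longrightarrow> (\<exists>i<s. r = Q i)"
    using regular_valuations[OF q'(2) regular[OF q'(1)]] by blast
  then obtain v where "is_valuation q v" using q' by blast
  then show ?thesis by (rule is_valuation_valuation[OF torsion_free q'(2)])
qed

lemma ht1_down:
  assumes p: "p \<in> V"
  shows "ht1 (down p) = {q. prime_ideal M q \<and> q \<subseteq> p \<and> height M q = 1}"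
    and "ht1 (down p) \<subseteq> ht1 V"
  using down_subset[OF open_V p] by (auto simp: height_one_primes_def)

text \<open>Uniqueness turns the exponents chosen at p into the global valuations. Exponents
  obtained at different points thus agree at common primes of height one, which makes local data of
  a divisor comparable across V.\<close>

lemma valuation_coordinates:
  assumes p: "p \<in> V"
  shows stalk_iff: "g \<in> carrier \<Gamma> \<Longrightarrow> g \<in> stalk p \<longleftrightarrow> (\<forall>q\<in>ht1 (down p). 0 \<le> valuation M q g)"
    and realize: "\<exists>g\<in>carrier \<Gamma>. \<forall>q\<in>ht1 (down p). valuation M q g = D q"
proof -
  obtain s :: nat and Q c where
    Q: "\<forall>i<s. prime_ideal M (Q i) \<and> Q i \<subseteq> p \<and> height M (Q i) = 1 \<and> is_valuation (Q i) (c i)"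
    and all: "\<forall>r. prime_ideal M r \<longrightarrow> r \<subseteq> p \<longrightarrow> height M r = 1 \<longrightarrow> (\<exists>i<s. r = Q i)"
    and inj: "\<forall>i<s. \<forall>j<s. Q i = Q j \<longrightarrow> i = j"
    and st: "\<forall>g\<in>carrier \<Gamma>. g \<in> stalk p \<longleftrightarrow> (\<forall>i<s. 0 \<le> c i g)"
    and re: "\<forall>k. \<exists>g\<in>carrier \<Gamma>. \<forall>i<s. c i g = k i"
    using regular_valuations[OF prime_V[OF p] regular[OF p]] by blast
  have ht: "ht1 (down p) = Q ` {..<s}"
    unfolding ht1_down(1)[OF p] using Q all by blast
  have c: "valuation M (Q i) g = c i g" if "i < s" "g \<in> carrier \<Gamma>" for i g
  proof (rule is_valuation_unique[OF is_valuation _ that(2)])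
    show "Q i \<in> ht1 V" using ht ht1_down(2)[OF p] that(1) by blast
    show "is_valuation (Q i) (c i)" using Q that(1) by blast
  qed
  show "g \<in> stalk p \<longleftrightarrow> (\<forall>q\<in>ht1 (down p). 0 \<le> valuation M q g)" if "g \<in> carrier \<Gamma>"
    unfolding ht using st that c by auto
  obtain g where g: "g \<in> carrier \<Gamma>" "\<forall>i<s. c i g = D (Q i)" using spec[OF re, of "\<lambda>i. D (Q i)"] by blast
  then show "\<exists>g\<in>carrier \<Gamma>. \<forall>q\<in>ht1 (down p). valuation M q g = D q"
    unfolding ht using c by auto
qed

lemmas hom_valuation = is_valuation[unfolded is_valuation_def, THEN conjunct1]

lemma valuation_mult:
  "q \<in> ht1 V \<Longrightarrow> g \<in> carrier \<Gamma> \<Longrightarrow> h \<in> carrier \<Gamma> \<Longrightarrow>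
     valuation M q (g \<otimes>\<^bsub>K\<^esub> h) = valuation M q g + valuation M q h"
  by (rule hom_integer_group(1)[OF hom_valuation])

lemma valuation_one: "q \<in> ht1 V \<Longrightarrow> valuation M q \<one>\<^bsub>K\<^esub> = 0"
  by (rule hom_integer_group(2)[OF hom_valuation])

lemma finite_ht1: "finite (ht1 U)"
  using finite_primes by (rule rev_finite_subset) (auto simp: height_one_primes_def)

end

section \<open>Isomorphisms of sheaves with an action\<close>

text \<open>The body of \<open>oset_isomorphic\<close> with its family of maps exposed, since
  several arguments evaluate particular maps.\<close>

definition oset_iso ::
  "'x topology \<Rightarrow> ('x, 'o) binoid_presheaf \<Rightarrow> ('x, 'o, 's) oset_presheaf \<Rightarrow> ('x, 'o, 't) oset_presheaf
     \<Rightarrow> ('x set \<Rightarrow> 's \<Rightarrow> 't) \<Rightarrow> bool" where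
  "oset_iso X \<O> L K \<phi> \<longleftrightarrow>
     (\<forall>U. openin X U \<longrightarrow>
        bij_betw (\<phi> U) (sections L U) (sections K U) \<and>
        \<phi> U (point L U) = point K U \<and>
        (\<forall>a\<in>carrier (binoid_of \<O> U). \<forall>s\<in>sections L U.
           \<phi> U (action L U a s) = action K U a (\<phi> U s)) \<and>
        (\<forall>W. openin X W \<and> W \<subseteq> U \<longrightarrow>
           (\<forall>s\<in>sections L U. \<phi> W (res L U W s) = res K U W (\<phi> U s))))"

lemma oset_isomorphic_iff: "oset_isomorphic X \<O> L K \<longleftrightarrow> (\<exists>\<phi>. oset_iso X \<O> L K \<phi>)"
  unfolding oset_isomorphic_def oset_iso_def ..

lemma oset_isoI:
  assumes "\<And>U. openin X U \<Longrightarrow> bij_betw (\<phi> U) (sections L U) (sections K U)"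
    and "\<And>U. openin X U \<Longrightarrow> \<phi> U (point L U) = point K U"
    and "\<And>U a s. openin X U \<Longrightarrow> a \<in> carrier (binoid_of \<O> U) \<Longrightarrow> s \<in> sections L U \<Longrightarrow>
           \<phi> U (action L U a s) = action K U a (\<phi> U s)"
    and "\<And>U W s. openin X U \<Longrightarrow> openin X W \<Longrightarrow> W \<subseteq> U \<Longrightarrow> s \<in> sections L U \<Longrightarrow>
           \<phi> W (res L U W s) = res K U W (\<phi> U s)"
  shows "oset_iso X \<O> L K \<phi>"
  unfolding oset_iso_def using assms by simp

lemma oset_isoD:
  assumes "oset_iso X \<O> L K \<phi>" "openin X U"
  shows "bij_betw (\<phi> U) (sections L U) (sections K U)"
    and "\<phi> U (point L U) = point K U"
    and "\<And>a s. a \<in> carrier (binoid_of \<O> U) \<Longrightarrow> s \<in> sections L U \<Longrightarrow>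
           \<phi> U (action L U a s) = action K U a (\<phi> U s)"
    and "\<And>W s. openin X W \<Longrightarrow> W \<subseteq> U \<Longrightarrow> s \<in> sections L U \<Longrightarrow>
           \<phi> W (res L U W s) = res K U W (\<phi> U s)"
    and "\<And>s. s \<in> sections L U \<Longrightarrow> \<phi> U s \<in> sections K U"
proof -
  note * = assms(1)[unfolded oset_iso_def, THEN spec, THEN mp, OF assms(2)]
  show bij: "bij_betw (\<phi> U) (sections L U) (sections K U)" using * by (rule conjunct1)
  show "\<phi> U (point L U) = point K U" using * by simp
  show "\<phi> U (action L U a s) = action K U a (\<phi> U s)"
    if "a \<in> carrier (binoid_of \<O> U)" "s \<in> sections L U" for a s
    using * that by simp
  show "\<phi> W (res L U W s) = res K U W (\<phi> U s)"
    if "openin X W" "W \<subseteq> U" "s \<in> sections L U" for W s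
    using * that by simp
  show "\<phi> U s \<in> sections K U" if "s \<in> sections L U" for s
    using bij_betwE[OF bij] that by blast
qed

lemma oset_isomorphic_trans:
  assumes "oset_isomorphic X \<O> L K" "oset_isomorphic X \<O> K N"
  shows "oset_isomorphic X \<O> L N"
proof -
  obtain \<phi> \<psi> where \<phi>: "oset_iso X \<O> L K \<phi>" and \<psi>: "oset_iso X \<O> K N \<psi>"
    using assms by (auto simp: oset_isomorphic_iff)
  have "oset_iso X \<O> L N (\<lambda>U. \<psi> U \<circ> \<phi> U)"
  proof (rule oset_isoI)
    fix U assume U: "openin X U"
    show "bij_betw (\<psi> U \<circ> \<phi> U) (sections L U) (sections N U)"
      by (rule bij_betw_trans[OF oset_isoD(1)[OF \<phi> U] oset_isoD(1)[OF \<psi> U]])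
  qed (simp_all add: oset_isoD(2-5)[OF \<phi>] oset_isoD(2-5)[OF \<psi>])
  then show ?thesis by (auto simp: oset_isomorphic_iff)
qed

text \<open>Only closure under the operations is required of L, so the lemma applies to
  \<open>oset_self\<close> without its gluing property.\<close>

lemma oset_isomorphic_sym_closed:
  assumes pt_closed: "\<And>U. openin X U \<Longrightarrow> point L U \<in> sections L U"
    and act_closed: "\<And>U a s. openin X U \<Longrightarrow> a \<in> carrier (binoid_of \<O> U) \<Longrightarrow> s \<in> sections L U \<Longrightarrow>
      action L U a s \<in> sections L U"
    and res_closed: "\<And>U W s. openin X U \<Longrightarrow> openin X W \<Longrightarrow> W \<subseteq> U \<Longrightarrow> s \<in> sections L U \<Longrightarrow>
      res L U W s \<in> sections L W"
    and "oset_isomorphic X \<O> L K"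
  shows "oset_isomorphic X \<O> K L"
proof -
  obtain \<phi> where \<phi>: "oset_iso X \<O> L K \<phi>" using assms(4) by (auto simp: oset_isomorphic_iff)
  define \<psi> where "\<psi> U = inv_into (sections L U) (\<phi> U)" for U
  have \<psi>: "\<psi> U (\<phi> U s) = s" if "openin X U" "s \<in> sections L U" for U s
    using bij_betw_inv_into_left[OF oset_isoD(1)[OF \<phi> that(1)] that(2)] by (simp add: \<psi>_def)
  have pre: "\<exists>s\<in>sections L U. k = \<phi> U s" if "openin X U" "k \<in> sections K U" for U k
    using bij_betw_imp_surj_on[OF oset_isoD(1)[OF \<phi> that(1)]] that(2) by blast
  have "oset_iso X \<O> K L \<psi>"
  proof (rule oset_isoI)
    fix U assume U: "openin X U"
    show "bij_betw (\<psi> U) (sections K U) (sections L U)"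
      unfolding \<psi>_def by (rule bij_betw_inv_into[OF oset_isoD(1)[OF \<phi> U]])
    show "\<psi> U (point K U) = point L U"
      using \<psi>[OF U pt_closed[OF U]] oset_isoD(2)[OF \<phi> U] by simp
    fix k assume "k \<in> sections K U"
    then obtain s where s: "s \<in> sections L U" "k = \<phi> U s" using pre U by blast
    show "\<psi> U (action K U a k) = action L U a (\<psi> U k)" if a: "a \<in> carrier (binoid_of \<O> U)" for a
      using \<psi>[OF U act_closed[OF U a s(1)]] oset_isoD(3)[OF \<phi> U a s(1)] \<psi>[OF U s(1)] s(2) by simp
    show "\<psi> W (res K U W k) = res L U W (\<psi> U k)" if W: "openin X W" "W \<subseteq> U" for W
      using \<psi>[OF W(1) res_closed[OF U W s(1)]] oset_isoD(4)[OF \<phi> U W s(1)] \<psi>[OF U s(1)] s(2) by simp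
  qed
  then show ?thesis by (auto simp: oset_isomorphic_iff)
qed

lemma oset_isomorphic_sym:
  assumes L: "oset_sheaf X \<O> L" and "oset_isomorphic X \<O> L K"
  shows "oset_isomorphic X \<O> K L"
proof -
  interpret L: oset_sheaf X \<O> L by (rule L)
  show ?thesis
    using L.res_closed binoid_set.pt_closed[OF L.sections_set] binoid_set.act_closed[OF L.sections_set]
    by (intro oset_isomorphic_sym_closed[OF _ _ _ assms(2)])
qed

text \<open>The empty family covers the empty set, and gluing it yields exactly one section.\<close>

lemma oset_sheaf_empty:
  assumes "oset_sheaf X \<O> L"
  obtains s where "sections L {} = {s}"
proof -
  have "\<exists>!s. s \<in> sections L (\<Union>{}) \<and> (\<forall>U\<in>{}. res L (\<Union>{}) U s = undefined)"
    by (rule oset_sheaf.glue[OF assms]) auto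
  then have "\<exists>!s. s \<in> sections L {}" by simp
  then show ?thesis using that by auto
qed

lemma openin_subtopology_open:
  "openin X U \<Longrightarrow> openin (subtopology X U) W \<longleftrightarrow> openin X W \<and> W \<subseteq> U"
  by (rule openin_open_subtopology)

lemma oset_isomorphic_subtopology:
  assumes "oset_isomorphic X \<O> L K" "openin X U"
  shows "oset_isomorphic (subtopology X U) \<O> L K"
  using assms unfolding oset_isomorphic_def openin_subtopology_open[OF assms(2)] by meson

lemma oset_sheaf_subtopology:
  assumes L: "oset_sheaf X \<O> L" and V: "openin X V"
  shows "oset_sheaf (subtopology X V) \<O> L"
proof -
  interpret L: oset_sheaf X \<O> L by (rule L)
  note * = openin_subtopology_open[OF V]
  show ?thesis
    by (rule oset_sheaf.intro, unfold *)
      (simp_all add: L.sections_set L.res_closed L.res_id L.res_comp L.res_action L.res_point, rule L.glue, blast, blast, blast)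
qed

text \<open>Each axiom is pulled back to L through the bijections. For gluing, injectivity over the
  intersections makes the pulled back sections compatible.\<close>

lemma oset_sheaf_isomorphic:
  assumes L: "oset_sheaf X \<O> L" and iso: "oset_isomorphic X \<O> L K"
    and restr: "\<And>U W a. openin X U \<Longrightarrow> openin X W \<Longrightarrow> W \<subseteq> U \<Longrightarrow> a \<in> carrier (binoid_of \<O> U) \<Longrightarrow>
      restr \<O> U W a \<in> carrier (binoid_of \<O> W)"
  shows "oset_sheaf X \<O> K"
proof -
  interpret L: oset_sheaf X \<O> L by (rule L)
  obtain \<phi> where \<phi>: "oset_iso X \<O> L K \<phi>" using iso by (auto simp: oset_isomorphic_iff)
  note bij = oset_isoD(1)[OF \<phi>] and pt = oset_isoD(2)[OF \<phi>, symmetric] and act = oset_isoD(3)[OF \<phi>, symmetric]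
    and res = oset_isoD(4)[OF \<phi>, symmetric] and closed = oset_isoD(5)[OF \<phi>]
  have pre: "\<exists>s\<in>sections L U. k = \<phi> U s" if "openin X U" "k \<in> sections K U" for U k
    using bij_betw_imp_surj_on[OF bij[OF that(1)]] that(2) by blast
  have inj: "s = t" if "openin X U" "s \<in> sections L U" "t \<in> sections L U" "\<phi> U s = \<phi> U t" for U s t
    using inj_onD[OF bij_betw_imp_inj_on[OF bij[OF that(1)]]] that by blast
  show ?thesis
  proof (rule oset_sheaf.intro)
    fix U assume U: "openin X U"
    interpret U: binoid_set "binoid_of \<O> U" "sections L U" "action L U" "point L U"
      by (rule L.sections_set[OF U])
    have "binoid_set_axioms (binoid_of \<O> U) (sections K U) (action K U) (point K U)"
    proof (rule binoid_set_axioms.intro)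
      fix a b s assume a: "a \<in> carrier (binoid_of \<O> U)" "b \<in> carrier (binoid_of \<O> U)"
        and "s \<in> sections K U"
      then obtain t where t: "t \<in> sections L U" "s = \<phi> U t" using pre[OF U] by blast
      show "action K U (a \<otimes>\<^bsub>binoid_of \<O> U\<^esub> b) s = action K U a (action K U b s)"
        using a t by (simp add: act[OF U] U.act_closed U.act_mult)
    next
      fix a s assume a: "a \<in> carrier (binoid_of \<O> U)" and "s \<in> sections K U"
      then obtain t where t: "t \<in> sections L U" "s = \<phi> U t" using pre[OF U] by blast
      show "action K U a s \<in> sections K U"
        using a t by (simp add: act[OF U] U.act_closed closed[OF U])
    next
      fix s assume "s \<in> sections K U"
      then obtain t where t: "t \<in> sections L U" "s = \<phi> U t" using pre[OF U] by blast
      show "action K U \<one>\<^bsub>binoid_of \<O> U\<^esub> s = s" using t by (simp add: act[OF U] U.act_one)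
      show "action K U (absorb (binoid_of \<O> U)) s = point K U"
        using t by (simp add: act[OF U] pt[OF U] U.act_absorb U.absorb_closed)
    qed (simp_all add: pt[OF U] act[OF U] closed[OF U] U.pt_closed U.act_pt)
    then show "binoid_set (binoid_of \<O> U) (sections K U) (action K U) (point K U)"
      by (rule binoid_set.intro[OF U.binoid_axioms])
  next
    fix U s assume U: "openin X U" and "s \<in> sections K U"
    then obtain t where t: "t \<in> sections L U" "s = \<phi> U t" using pre[OF U] by blast
    show "res K U U s = s" using t by (simp add: res[OF U U] L.res_id[OF U])
  next
    fix U W s assume U: "openin X U" and W: "openin X W" and WU: "W \<subseteq> U" and "s \<in> sections K U"
    then obtain t where t: "t \<in> sections L U" "s = \<phi> U t" using pre[OF U] by blast
    show "res K U W s \<in> sections K W"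
      using t by (simp add: res[OF U W WU] L.res_closed[OF U W WU] closed[OF W])
  next
    fix U W a s assume U: "openin X U" and W: "openin X W" and WU: "W \<subseteq> U"
      and a: "a \<in> carrier (binoid_of \<O> U)" and "s \<in> sections K U"
    then obtain t where t: "t \<in> sections L U" "s = \<phi> U t" using pre[OF U] by blast
    interpret U: binoid_set "binoid_of \<O> U" "sections L U" "action L U" "point L U"
      by (rule L.sections_set[OF U])
    show "res K U W (action K U a s) = action K W (restr \<O> U W a) (res K U W s)"
      using t a
      by (simp add: act[OF U] act[OF W] res[OF U W WU] U.act_closed L.res_closed[OF U W WU]
          L.res_action[OF U W WU] restr[OF U W WU])
  next
    fix U W T s
    assume U: "openin X U" and W: "openin X W" and T: "openin X T" "T \<subseteq> W" and WU: "W \<subseteq> U"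
      and "s \<in> sections K U"
    then obtain t where t: "t \<in> sections L U" "s = \<phi> U t" using pre[OF U] by blast
    show "res K W T (res K U W s) = res K U T s"
      using t L.res_closed[OF U W WU t(1)]
      by (simp add: res[OF U W WU] res[OF W T] res[OF U T(1) subset_trans[OF T(2) WU]]
          L.res_comp[OF U W T WU])
  next
    fix U W assume U: "openin X U" and W: "openin X W" "W \<subseteq> U"
    interpret U: binoid_set "binoid_of \<O> U" "sections L U" "action L U" "point L U"
      by (rule L.sections_set[OF U])
    show "res K U W (point K U) = point K W"
      by (simp add: pt[OF U] pt[OF W(1)] res[OF U W U.pt_closed] L.res_point[OF U W])
  next
    fix \<U> \<sigma>
    assume op: "\<And>U. U \<in> \<U> \<Longrightarrow> openin X U" and sec: "\<And>U. U \<in> \<U> \<Longrightarrow> \<sigma> U \<in> sections K U"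
      and comp: "\<And>U W. U \<in> \<U> \<Longrightarrow> W \<in> \<U> \<Longrightarrow> res K U (U \<inter> W) (\<sigma> U) = res K W (U \<inter> W) (\<sigma> W)"
    have opU: "openin X (\<Union>\<U>)" using op by blast
    have "\<forall>U\<in>\<U>. \<exists>t. t \<in> sections L U \<and> \<sigma> U = \<phi> U t" using pre op sec by blast
    then obtain \<tau> where \<tau>: "\<And>U. U \<in> \<U> \<Longrightarrow> \<tau> U \<in> sections L U" "\<And>U. U \<in> \<U> \<Longrightarrow> \<sigma> U = \<phi> U (\<tau> U)"
      by metis
    have eq: "res L U (U \<inter> W) (\<tau> U) = res L W (U \<inter> W) (\<tau> W)" if UW: "U \<in> \<U>" "W \<in> \<U>" for U W
    proof -
      have o: "openin X (U \<inter> W)" using op UW by blast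
      show ?thesis
        by (rule inj[OF o])
          (use UW op \<tau> o comp[OF UW] in \<open>simp_all add: L.res_closed res[symmetric]\<close>)
    qed
    have ex1: "\<exists>!s. s \<in> sections L (\<Union>\<U>) \<and> (\<forall>U\<in>\<U>. res L (\<Union>\<U>) U s = \<tau> U)"
      by (rule L.glue[OF op \<tau>(1) eq])
    then obtain s where s: "s \<in> sections L (\<Union>\<U>)" "\<forall>U\<in>\<U>. res L (\<Union>\<U>) U s = \<tau> U" by blast
    show "\<exists>!k. k \<in> sections K (\<Union>\<U>) \<and> (\<forall>U\<in>\<U>. res K (\<Union>\<U>) U k = \<sigma> U)"
    proof (rule ex1I[of _ "\<phi> (\<Union>\<U>) s"])
      show "\<phi> (\<Union>\<U>) s \<in> sections K (\<Union>\<U>) \<and> (\<forall>U\<in>\<U>. res K (\<Union>\<U>) U (\<phi> (\<Union>\<U>) s) = \<sigma> U)"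
        using s closed[OF opU] \<tau>(2) by (simp add: res[OF opU op] Union_upper)
      fix k assume k: "k \<in> sections K (\<Union>\<U>) \<and> (\<forall>U\<in>\<U>. res K (\<Union>\<U>) U k = \<sigma> U)"
      then obtain t where t: "t \<in> sections L (\<Union>\<U>)" "k = \<phi> (\<Union>\<U>) t" using pre[OF opU] by blast
      have "res L (\<Union>\<U>) U t = \<tau> U" if U: "U \<in> \<U>" for U
      proof (rule inj[OF op[OF U]])
        show "\<phi> U (res L (\<Union>\<U>) U t) = \<phi> U (\<tau> U)"
          using k t U \<tau>(2)[OF U] res[OF opU op[OF U] Union_upper[OF U] t(1)] by simp
      qed (use U t \<tau> L.res_closed[OF opU op[OF U] Union_upper[OF U]] in auto)
      then have "t = s" using ex1 s t(1) by blast
      then show "k = \<phi> (\<Union>\<U>) s" using t(2) by simp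
    qed
  qed
qed

lemma invertible_sheaf_isomorphic:
  assumes L: "invertible_sheaf X \<O> L" and iso: "oset_isomorphic X \<O> L K"
    and restr: "\<And>U W a. openin X U \<Longrightarrow> openin X W \<Longrightarrow> W \<subseteq> U \<Longrightarrow> a \<in> carrier (binoid_of \<O> U) \<Longrightarrow>
      restr \<O> U W a \<in> carrier (binoid_of \<O> W)"
  shows "invertible_sheaf X \<O> K"
  unfolding invertible_sheaf_def
proof (intro conjI ballI)
  have sh: "oset_sheaf X \<O> L" using L by (simp add: invertible_sheaf_def)
  then show "oset_sheaf X \<O> K" by (rule oset_sheaf_isomorphic[OF _ iso restr])
  fix x assume "x \<in> topspace X"
  then obtain U where U: "openin X U" "x \<in> U" "oset_isomorphic (subtopology X U) \<O> L (oset_self \<O>)"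
    using L by (auto simp: invertible_sheaf_def)
  have "oset_isomorphic (subtopology X U) \<O> K L"
    by (rule oset_isomorphic_sym[OF oset_sheaf_subtopology[OF sh U(1)]
          oset_isomorphic_subtopology[OF iso U(1)]])
  then show "\<exists>U. openin X U \<and> x \<in> U \<and> oset_isomorphic (subtopology X U) \<O> K (oset_self \<O>)"
    using U oset_isomorphic_trans by blast
qed

text \<open>Renames sections along j; this realises a sheaf over a prescribed type of
  sections.\<close>

definition transport_oset ::
  "('s \<Rightarrow> 't) \<Rightarrow> ('x, 'o, 's) oset_presheaf \<Rightarrow> ('x, 'o, 't) oset_presheaf" where
  "transport_oset j L =
     \<lparr>sections = (\<lambda>U. j ` sections L U),
      res = (\<lambda>U W x. j (res L U W (inv_into (sections L U) j x))),
      action = (\<lambda>U a x. j (action L U a (inv_into (sections L U) j x))),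
      point = (\<lambda>U. j (point L U))\<rparr>"

lemma transport_oset_isomorphic:
  assumes "\<And>U. openin X U \<Longrightarrow> inj_on j (sections L U)"
  shows "oset_isomorphic X \<O> L (transport_oset j L)"
proof -
  have "oset_iso X \<O> L (transport_oset j L) (\<lambda>_. j)"
    by (rule oset_isoI) (use assms in \<open>simp_all add: transport_oset_def bij_betw_def\<close>)
  then show ?thesis by (auto simp: oset_isomorphic_iff)
qed

section \<open>The invertible sheaf of a divisor\<close>

context regular_spectrum
begin

abbreviation "spec U \<equiv> subtopology (Spec M) U"

definition div_sheaf ::
  "('a set \<Rightarrow> int) \<Rightarrow> ('a set, 'a set \<Rightarrow> ('a \<times> 'a) set, ('a \<times> 'a) set) oset_presheaf" where
  "div_sheaf D =
     \<lparr>sections = (\<lambda>U. {g \<in> carrier K. g \<noteq> absorb K \<longrightarrow>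
        U \<noteq> {} \<and> (\<forall>q\<in>ht1 U. 0 \<le> valuation M q g + D q)}),
      res = (\<lambda>U W g. if W = {} then absorb K else g),
      action = (\<lambda>U \<sigma> g. if U = {} then absorb K else \<sigma> generic \<otimes>\<^bsub>K\<^esub> g),
      point = (\<lambda>U. absorb K)\<rparr>"

lemma div_sheaf_simps:
  "res (div_sheaf D) U W g = (if W = {} then absorb K else g)"
  "action (div_sheaf D) U \<sigma> g = (if U = {} then absorb K else \<sigma> generic \<otimes>\<^bsub>K\<^esub> g)"
  "point (div_sheaf D) U = absorb K"
  by (simp_all add: div_sheaf_def)

lemma absorb_in_div_sheaf [simp]: "absorb K \<in> sections (div_sheaf D) U"
  by (simp add: div_sheaf_def K.absorb_closed)

lemma div_sheaf_sections_iff: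
  "g \<in> carrier \<Gamma> \<Longrightarrow> g \<in> sections (div_sheaf D) U \<longleftrightarrow>
     U \<noteq> {} \<and> (\<forall>q\<in>ht1 U. 0 \<le> valuation M q g + D q)"
  by (simp add: div_sheaf_def diff_group_iff del: diff_group_in_K)

lemma div_sheaf_empty [simp]: "sections (div_sheaf D) {} = {absorb K}"
  by (auto simp: div_sheaf_def K.absorb_closed)

lemma div_sheaf_closed: "g \<in> sections (div_sheaf D) U \<Longrightarrow> g \<in> carrier K"
  by (simp add: div_sheaf_def)

lemma div_sheaf_cases:
  assumes "g \<in> sections (div_sheaf D) U"
  obtains "g = absorb K" | "g \<in> carrier \<Gamma>" "U \<noteq> {}" "\<forall>q\<in>ht1 U. 0 \<le> valuation M q g + D q"
  using assms by (auto simp: div_sheaf_def diff_group_iff simp del: diff_group_in_K)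

lemma ht1_mono: "U \<subseteq> W \<Longrightarrow> ht1 U \<subseteq> ht1 W"
  by (auto simp: height_one_primes_def)

lemma div_sheaf_mono:
  "g \<in> sections (div_sheaf D) U \<Longrightarrow> W \<subseteq> U \<Longrightarrow> W \<noteq> {} \<Longrightarrow> g \<in> sections (div_sheaf D) W"
  using ht1_mono[of W U] by (auto simp: div_sheaf_def)

text \<open>The condition at a prime q of height one is already visible over
  \<open>down q\<close>.\<close>

lemma div_sheaf_local:
  assumes U: "openin (Spec M) U" "U \<noteq> {}" and g: "\<And>p. p \<in> U \<Longrightarrow> g \<in> sections (div_sheaf D) (down p)"
  shows "g \<in> sections (div_sheaf D) U"
proof (cases "g = absorb K")
  case False
  obtain p where p: "p \<in> U" using U(2) by blast
  have gc: "g \<in> carrier \<Gamma>" using div_sheaf_closed[OF g[OF p]] False by (simp add: diff_group_iff)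
  have "0 \<le> valuation M q g + D q" if q: "q \<in> ht1 U" for q
  proof -
    have "q \<in> U" "q \<in> ht1 (down q)" using q by (auto simp: height_one_primes_def)
    then show ?thesis using g[of q] div_sheaf_sections_iff[OF gc] by blast
  qed
  then show ?thesis using div_sheaf_sections_iff[OF gc] U(2) by blast
qed simp

lemma openin_spec_iff:
  "openin (Spec M) U \<Longrightarrow> openin (spec U) W \<longleftrightarrow> openin (Spec M) W \<and> W \<subseteq> U"
  by (rule openin_subtopology_open)

lemma valuation_structure_sheaf_nonneg:
  assumes "\<sigma> \<in> carrier (binoid_of \<O> U)" "U \<subseteq> V" "q \<in> ht1 U" "\<sigma> generic \<in> carrier \<Gamma>"
  shows "0 \<le> valuation M q (\<sigma> generic)"
proof -
  have "q \<in> U" using assms(3) by (auto simp: height_one_primes_def)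
  then have "\<sigma> generic \<in> stalk q" using structure_sheaf_generic_in_stalk[OF assms(1)] by blast
  moreover have "q \<in> ht1 V" using ht1_mono[OF assms(2)] assms(3) by blast
  ultimately show ?thesis using is_valuation[of q] assms(4) by (auto simp: is_valuation_def)
qed

lemma div_sheaf_action_closed:
  assumes U: "U \<subseteq> V" and \<sigma>: "\<sigma> \<in> carrier (binoid_of \<O> U)" and g: "g \<in> sections (div_sheaf D) U"
    and p: "p \<in> U"
  shows "\<sigma> generic \<otimes>\<^bsub>K\<^esub> g \<in> sections (div_sheaf D) U"
proof -
  have sK: "\<sigma> generic \<in> carrier K" using structure_sheaf_generic_closed[OF \<sigma> p] .
  show ?thesis
  proof (cases "\<sigma> generic = absorb K \<or> g = absorb K")
    case True
    then show ?thesis using sK div_sheaf_closed[OF g] K.absorb_mult K.absorb_mult_right by auto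
  next
    case False
    then have c: "\<sigma> generic \<in> carrier \<Gamma>" "g \<in> carrier \<Gamma>"
      using sK div_sheaf_closed[OF g] by (simp_all add: diff_group_iff del: diff_group_in_K)
    have "0 \<le> valuation M q (\<sigma> generic \<otimes>\<^bsub>K\<^esub> g) + D q" if q: "q \<in> ht1 U" for q
    proof -
      have "q \<in> ht1 V" using ht1_mono[OF U] q by blast
      moreover have "0 \<le> valuation M q g + D q" using g div_sheaf_sections_iff[OF c(2)] q by blast
      ultimately show ?thesis
        using valuation_mult[OF _ c] valuation_structure_sheaf_nonneg[OF \<sigma> U q c(1)] by simp
    qed
    then show ?thesis using div_sheaf_sections_iff[of "\<sigma> generic \<otimes>\<^bsub>K\<^esub> g"] c p by auto
  qed
qed

lemma structure_sheaf_generic_K: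
  "openin (Spec M) U \<Longrightarrow> U \<noteq> {} \<Longrightarrow> \<sigma> \<in> carrier (binoid_of \<O> U) \<Longrightarrow> \<sigma> generic \<in> carrier K"
  using structure_sheaf_generic_closed[of \<sigma> U generic] generic_in_open_iff[of U] by simp

text \<open>Nonempty open sets meet in the generic point and restrictions between them are
  inclusions, so compatible sections over them are the same element of \<open>K\<close>. Gluing
  reduces to a local check of its valuations.\<close>

lemma oset_sheaf_div_sheaf: "oset_sheaf (spec V) \<O> (div_sheaf D)"
proof (rule oset_sheaf.intro, unfold openin_spec_iff[OF open_V])
  fix U assume "openin (Spec M) U \<and> U \<subseteq> V"
  then have U: "openin (Spec M) U" "U \<subseteq> V" by auto
  note gen = generic_in_open_iff[OF U(1)]
  have "binoid_set_axioms (binoid_of \<O> U) (sections (div_sheaf D) U) (action (div_sheaf D) U) (point (div_sheaf D) U)"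
  proof (rule binoid_set_axioms.intro, unfold div_sheaf_simps)
    fix a s assume a: "a \<in> carrier (binoid_of \<O> U)" "s \<in> sections (div_sheaf D) U"
    show "(if U = {} then absorb K else a generic \<otimes>\<^bsub>K\<^esub> s) \<in> sections (div_sheaf D) U"
      using div_sheaf_action_closed[OF U(2) a] by auto
    fix b assume b: "b \<in> carrier (binoid_of \<O> U)"
    show "(if U = {} then absorb K else (b \<otimes>\<^bsub>binoid_of \<O> U\<^esub> a) generic \<otimes>\<^bsub>K\<^esub> s) =
       (if U = {} then absorb K
        else b generic \<otimes>\<^bsub>K\<^esub> (if U = {} then absorb K else a generic \<otimes>\<^bsub>K\<^esub> s))"
      if "s \<in> sections (div_sheaf D) U"
      using structure_sheaf_generic_K[OF U(1)] a b gen div_sheaf_closed[OF that]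
      by (simp add: mult_generic K.m_assoc)
  next
    fix s assume s: "s \<in> sections (div_sheaf D) U"
    then have sK: "s \<in> carrier K" by (rule div_sheaf_closed)
    show "(if U = {} then absorb K else \<one>\<^bsub>binoid_of \<O> U\<^esub> generic \<otimes>\<^bsub>K\<^esub> s) = s"
      using s sK gen by (auto simp: one_generic)
    show "(if U = {} then absorb K else absorb (binoid_of \<O> U) generic \<otimes>\<^bsub>K\<^esub> s) = absorb K"
      using sK gen by (simp add: absorb_generic K.absorb_mult)
  next
    fix a assume "a \<in> carrier (binoid_of \<O> U)"
    then show "(if U = {} then absorb K else a generic \<otimes>\<^bsub>K\<^esub> absorb K) = absorb K"
      using structure_sheaf_generic_K[OF U(1)] by (simp add: K.absorb_mult_right)
  qed simp
  then show "binoid_set (binoid_of \<O> U) (sections (div_sheaf D) U) (action (div_sheaf D) U) (point (div_sheaf D) U)"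
    by (rule binoid_set.intro[OF binoid_structure_sheaf[OF U(1)]])
next
  fix \<U> \<sigma>
  assume op: "\<And>U. U \<in> \<U> \<Longrightarrow> openin (Spec M) U \<and> U \<subseteq> V"
    and sec: "\<And>U. U \<in> \<U> \<Longrightarrow> \<sigma> U \<in> sections (div_sheaf D) U"
    and comp: "\<And>U W. U \<in> \<U> \<Longrightarrow> W \<in> \<U> \<Longrightarrow>
      res (div_sheaf D) U (U \<inter> W) (\<sigma> U) = res (div_sheaf D) W (U \<inter> W) (\<sigma> W)"
  show "\<exists>!s. s \<in> sections (div_sheaf D) (\<Union>\<U>) \<and> (\<forall>U\<in>\<U>. res (div_sheaf D) (\<Union>\<U>) U s = \<sigma> U)"
  proof (cases "\<Union>\<U> = {}")
    case True
    then have "\<sigma> U = absorb K" "U = {}" if "U \<in> \<U>" for U using sec[OF that] that by auto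
    then show ?thesis unfolding True by (auto simp: div_sheaf_simps)
  next
    case False
    then obtain U where U: "U \<in> \<U>" "U \<noteq> {}" by blast
    have eq: "\<sigma> W = \<sigma> U" if W: "W \<in> \<U>" "W \<noteq> {}" for W
    proof -
      have "generic \<in> U \<inter> W" using generic_in_open_iff op U W by blast
      then show ?thesis using comp[OF U(1) W(1)] by (auto simp: div_sheaf_simps split: if_splits)
    qed
    have res: "res (div_sheaf D) (\<Union>\<U>) W (\<sigma> U) = \<sigma> W" if W: "W \<in> \<U>" for W
      using eq[OF W] sec[OF W] by (auto simp: div_sheaf_simps)
    have "\<sigma> U \<in> sections (div_sheaf D) (\<Union>\<U>)"
    proof (rule div_sheaf_local[OF _ False])
      show "openin (Spec M) (\<Union>\<U>)" using op by blast
      fix p assume "p \<in> \<Union>\<U>"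
      then obtain W where W: "W \<in> \<U>" "p \<in> W" by blast
      have "down p \<subseteq> W" "down p \<noteq> {}"
        using down_subset[of W p] openin_Spec_prime[of W p] op[OF W(1)] W(2) by auto
      moreover have "\<sigma> U = \<sigma> W" using eq[OF W(1)] W(2) by auto
      ultimately show "\<sigma> U \<in> sections (div_sheaf D) (down p)"
        using div_sheaf_mono[OF sec[OF W(1)]] by simp
    qed
    moreover have "s = \<sigma> U" if "\<forall>U\<in>\<U>. res (div_sheaf D) (\<Union>\<U>) U s = \<sigma> U" for s
      using bspec[OF that U(1)] U(2) by (simp add: div_sheaf_simps)
    ultimately show ?thesis using res by (intro ex1I[of _ "\<sigma> U"] conjI ballI) simp_all
  qed
next
  fix U W \<sigma> s
  assume U: "openin (Spec M) U \<and> U \<subseteq> V" and W: "openin (Spec M) W \<and> W \<subseteq> V" "W \<subseteq> U"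
  show "res (div_sheaf D) U W (action (div_sheaf D) U \<sigma> s) =
       action (div_sheaf D) W (restr \<O> U W \<sigma>) (res (div_sheaf D) U W s)"
    using W generic_in_open_iff[of W] by (auto simp: div_sheaf_simps restr_generic)
qed (use div_sheaf_mono in \<open>auto simp: div_sheaf_simps\<close>)

lemma oset_self_simps:
  "sections (oset_self \<O>) U = carrier (binoid_of \<O> U)"
  "res (oset_self \<O>) = restr \<O>"
  "action (oset_self \<O>) U = monoid.mult (binoid_of \<O> U)"
  "point (oset_self \<O>) U = absorb (binoid_of \<O> U)"
  by (simp_all add: oset_self_def)

lemma absorb_in_stalk: "prime_ideal M p \<Longrightarrow> absorb K \<in> stalk p"
  unfolding stalk_def absorb_localization using absorb_closed prime_ideal_one by blast

text \<open>The isomorphism is evaluation at the generic point. It is onto because, by regularity,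
  an element with nonnegative valuations at the primes of height one below p lies in the stalk at
  p.\<close>

lemma oset_self_isomorphic:
  assumes U0: "openin (Spec M) U0" "U0 \<subseteq> V"
  shows "oset_isomorphic (spec U0) \<O> (oset_self \<O>) (div_sheaf (\<lambda>_. 0))"
    and "oset_isomorphic (spec U0) \<O> (div_sheaf (\<lambda>_. 0)) (oset_self \<O>)"
proof -
  define \<phi> where "\<phi> U \<sigma> = (if U = {} then absorb K else \<sigma> generic)"
    for U :: "'a set set" and \<sigma> :: "'a set \<Rightarrow> ('a \<times> 'a) set"
  have "oset_iso (spec U0) \<O> (oset_self \<O>) (div_sheaf (\<lambda>_. 0)) \<phi>"
  proof (rule oset_isoI, unfold openin_spec_iff[OF U0(1)] oset_self_simps)
    fix U assume "openin (Spec M) U \<and> U \<subseteq> U0"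
    then have U: "openin (Spec M) U" "U \<subseteq> V" using U0 by auto
    note gen = generic_in_open_iff[OF U(1)]
    show "bij_betw (\<phi> U) (carrier (binoid_of \<O> U)) (sections (div_sheaf (\<lambda>_. 0)) U)"
      unfolding bij_betw_def
    proof (intro conjI subset_antisym subsetI inj_onI)
      fix \<sigma> \<tau> assume "\<sigma> \<in> carrier (binoid_of \<O> U)" "\<tau> \<in> carrier (binoid_of \<O> U)" "\<phi> U \<sigma> = \<phi> U \<tau>"
      then show "\<sigma> = \<tau>" by (intro structure_sheaf_eqI[OF U(1)]) (auto simp: \<phi>_def)
    next
      fix g assume "g \<in> \<phi> U ` carrier (binoid_of \<O> U)"
      then obtain \<sigma> where \<sigma>: "\<sigma> \<in> carrier (binoid_of \<O> U)" "g = \<phi> U \<sigma>" by blast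
      show "g \<in> sections (div_sheaf (\<lambda>_. 0)) U"
      proof (cases "U = {} \<or> \<sigma> generic = absorb K")
        case False
        then have "\<sigma> generic \<in> carrier \<Gamma>"
          using structure_sheaf_generic_K[OF U(1) _ \<sigma>(1)] by (simp add: diff_group_iff)
        then show ?thesis
          using False \<sigma> valuation_structure_sheaf_nonneg[OF \<sigma>(1) U(2)]
          by (simp add: div_sheaf_sections_iff \<phi>_def)
      qed (use \<sigma>(2) in \<open>auto simp: \<phi>_def\<close>)
    next
      fix g assume g: "g \<in> sections (div_sheaf (\<lambda>_. 0)) U"
      show "g \<in> \<phi> U ` carrier (binoid_of \<O> U)"
      proof (cases "U = {}")
        case True
        then show ?thesis
          using g binoid.absorb_closed[OF binoid_structure_sheaf[OF U(1)]] by (auto simp: \<phi>_def)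
      next
        case False
        have "g \<in> stalk p" if p: "p \<in> U" for p
          using g
        proof (cases rule: div_sheaf_cases)
          case 1
          then show ?thesis using absorb_in_stalk openin_Spec_prime[OF U(1) p] by simp
        next
          case 2
          have "ht1 (down p) \<subseteq> ht1 U" by (rule ht1_mono[OF down_subset[OF U(1) p]])
          then show ?thesis using stalk_iff[of p g] 2 p U(2) by auto
        qed
        then obtain \<sigma> where "\<sigma> \<in> carrier (binoid_of \<O> U)" "\<sigma> generic = g"
          using structure_sheaf_surj[OF U(1) False] by blast
        then show ?thesis using False by (auto simp: \<phi>_def)
      qed
    qed
    show "\<phi> U (absorb (binoid_of \<O> U)) = point (div_sheaf (\<lambda>_. 0)) U"
      using gen by (simp add: \<phi>_def div_sheaf_simps absorb_generic)
    fix \<sigma>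
    show "\<phi> U (\<sigma> \<otimes>\<^bsub>binoid_of \<O> U\<^esub> \<tau>) = action (div_sheaf (\<lambda>_. 0)) U \<sigma> (\<phi> U \<tau>)" for \<tau>
      using gen by (simp add: \<phi>_def div_sheaf_simps mult_generic)
    fix W assume "openin (Spec M) W \<and> W \<subseteq> U0" "W \<subseteq> U"
    then show "\<phi> W (restr \<O> U W \<sigma>) = res (div_sheaf (\<lambda>_. 0)) U W (\<phi> U \<sigma>)"
      using generic_in_open_iff[of W] by (auto simp: \<phi>_def div_sheaf_simps restr_generic)
  qed
  then show 1: "oset_isomorphic (spec U0) \<O> (oset_self \<O>) (div_sheaf (\<lambda>_. 0))"
    by (auto simp: oset_isomorphic_iff)
  show "oset_isomorphic (spec U0) \<O> (div_sheaf (\<lambda>_. 0)) (oset_self \<O>)"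
    by (rule oset_isomorphic_sym_closed[OF _ _ _ 1], unfold openin_spec_iff[OF U0(1)] oset_self_simps)
      (auto intro: structure_sheaf_mult_closed restr_structure_sheaf_closed
        binoid.absorb_closed[OF binoid_structure_sheaf])
qed

text \<open>Multiplication by \<gamma> adds the valuations of \<gamma>, which offsets the difference
  of the divisors. The map is part of the statement because it is also used to exhibit generators
  over \<open>down p\<close>.\<close>

lemma div_sheaf_shift:
  assumes U0: "openin (Spec M) U0" "U0 \<subseteq> V" and \<gamma>: "\<gamma> \<in> carrier \<Gamma>"
    and DE: "\<And>q. q \<in> ht1 U0 \<Longrightarrow> D q = E q + valuation M q \<gamma>"
  shows "oset_iso (spec U0) \<O> (div_sheaf D) (div_sheaf E) (\<lambda>U g. \<gamma> \<otimes>\<^bsub>K\<^esub> g)"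
proof -
  have shift: "\<gamma> \<otimes>\<^bsub>K\<^esub> g \<in> sections (div_sheaf E) U \<longleftrightarrow> g \<in> sections (div_sheaf D) U"
    if U: "U \<subseteq> U0" and g: "g \<in> carrier K" for U g
  proof (cases "g = absorb K")
    case True
    then show ?thesis using \<gamma> by (simp add: K.absorb_mult_right)
  next
    case False
    then have g: "g \<in> carrier \<Gamma>" using g by (simp add: diff_group_iff)
    have "valuation M q (\<gamma> \<otimes>\<^bsub>K\<^esub> g) + E q = valuation M q g + D q" if "q \<in> ht1 U" for q
    proof -
      have "q \<in> ht1 U0" "q \<in> ht1 V" using that ht1_mono[OF U] ht1_mono[OF U0(2)] by blast+
      then show ?thesis using DE valuation_mult[OF _ \<gamma> g] by simp
    qed
    then show ?thesis using div_sheaf_sections_iff g \<gamma> by simp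
  qed
  show ?thesis
  proof (rule oset_isoI, unfold openin_spec_iff[OF U0(1)])
    fix U assume U: "openin (Spec M) U \<and> U \<subseteq> U0"
    show "bij_betw ((\<otimes>\<^bsub>K\<^esub>) \<gamma>) (sections (div_sheaf D) U) (sections (div_sheaf E) U)"
    proof (rule bij_betw_imageI, rule inj_onI)
      fix g h assume "g \<in> sections (div_sheaf D) U" "h \<in> sections (div_sheaf D) U"
        "\<gamma> \<otimes>\<^bsub>K\<^esub> g = \<gamma> \<otimes>\<^bsub>K\<^esub> h"
      then show "g = h" using K_cancel[OF \<gamma>] div_sheaf_closed by blast
    next
      show "(\<otimes>\<^bsub>K\<^esub>) \<gamma> ` sections (div_sheaf D) U = sections (div_sheaf E) U"
      proof (intro subset_antisym subsetI)
        fix g assume "g \<in> (\<otimes>\<^bsub>K\<^esub>) \<gamma> ` sections (div_sheaf D) U"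
        then show "g \<in> sections (div_sheaf E) U" using shift U div_sheaf_closed by auto
      next
        fix g assume g: "g \<in> sections (div_sheaf E) U"
        have c: "g \<in> carrier K" "inv\<^bsub>\<Gamma>\<^esub> \<gamma> \<in> carrier K" "\<gamma> \<in> carrier K"
          using div_sheaf_closed[OF g] \<gamma> by auto
        have "\<gamma> \<otimes>\<^bsub>K\<^esub> inv\<^bsub>\<Gamma>\<^esub> \<gamma> = \<one>\<^bsub>K\<^esub>" using \<Gamma>.r_inv[OF \<gamma>] by (simp add: diff_group_one)
        then have e: "\<gamma> \<otimes>\<^bsub>K\<^esub> (inv\<^bsub>\<Gamma>\<^esub> \<gamma> \<otimes>\<^bsub>K\<^esub> g) = g"
          using c by (simp add: K.m_assoc[symmetric])
        then have "inv\<^bsub>\<Gamma>\<^esub> \<gamma> \<otimes>\<^bsub>K\<^esub> g \<in> sections (div_sheaf D) U"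
          using shift[of U "inv\<^bsub>\<Gamma>\<^esub> \<gamma> \<otimes>\<^bsub>K\<^esub> g"] U g c by simp
        then show "g \<in> (\<otimes>\<^bsub>K\<^esub>) \<gamma> ` sections (div_sheaf D) U" using e by (metis image_eqI)
      qed
    qed
    show "\<gamma> \<otimes>\<^bsub>K\<^esub> point (div_sheaf D) U = point (div_sheaf E) U"
      using \<gamma> by (simp add: div_sheaf_simps K.absorb_mult_right)
    fix g assume g: "g \<in> sections (div_sheaf D) U"
    show "\<gamma> \<otimes>\<^bsub>K\<^esub> action (div_sheaf D) U \<sigma> g = action (div_sheaf E) U \<sigma> (\<gamma> \<otimes>\<^bsub>K\<^esub> g)"
      if \<sigma>: "\<sigma> \<in> carrier (binoid_of \<O> U)" for \<sigma>
      using \<gamma> div_sheaf_closed[OF g] structure_sheaf_generic_K[OF _ _ \<sigma>] U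
      by (auto simp: div_sheaf_simps K.absorb_mult_right K.m_lcomm)
    show "\<gamma> \<otimes>\<^bsub>K\<^esub> res (div_sheaf D) U W g = res (div_sheaf E) U W (\<gamma> \<otimes>\<^bsub>K\<^esub> g)" for W
      using \<gamma> by (simp add: div_sheaf_simps K.absorb_mult_right)
  qed
qed

lemma down_in_V:
  assumes "p \<in> V"
  shows "openin (Spec M) (down p)" "down p \<subseteq> V" "p \<in> down p" "down p \<noteq> {}"
  using openin_down[OF prime_V[OF assms]] down_subset[OF open_V assms] prime_V[OF assms] by auto

lemma topspace_spec_V: "topspace (spec V) = V"
  using openin_subset[OF open_V] by (simp add: Int_absorb1)

lemma spec_subset: "U \<subseteq> W \<Longrightarrow> subtopology (spec W) U = spec U"
  by (simp add: subtopology_subtopology Int_absorb1)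

text \<open>Over \<open>down p\<close> some \<gamma> has the values of D as valuations, and shifting
  by it trivialises the sheaf there.\<close>

lemma invertible_div_sheaf: "invertible_sheaf (spec V) \<O> (div_sheaf D)"
  unfolding invertible_sheaf_def
proof (intro conjI ballI oset_sheaf_div_sheaf)
  fix p assume "p \<in> topspace (spec V)"
  then have p: "p \<in> V" by (simp add: topspace_spec_V)
  note dp = down_in_V[OF p]
  obtain \<gamma> where \<gamma>: "\<gamma> \<in> carrier \<Gamma>" "\<forall>q\<in>ht1 (down p). valuation M q \<gamma> = D q"
    using realize[OF p] by blast
  have "oset_isomorphic (spec (down p)) \<O> (div_sheaf D) (div_sheaf (\<lambda>_. 0))"
    unfolding oset_isomorphic_iff
    by (rule exI, rule div_sheaf_shift[OF dp(1,2) \<gamma>(1)]) (use \<gamma>(2) in simp)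
  then have "oset_isomorphic (spec (down p)) \<O> (div_sheaf D) (oset_self \<O>)"
    by (rule oset_isomorphic_trans[OF _ oset_self_isomorphic(2)[OF dp(1,2)]])
  then show "\<exists>U. openin (spec V) U \<and> p \<in> U \<and> oset_isomorphic (subtopology (spec V) U) \<O> (div_sheaf D) (oset_self \<O>)"
    using dp by (intro exI[of _ "down p"]) (simp add: openin_spec_iff[OF open_V] spec_subset)
qed

section \<open>The generic stalk and isomorphisms between divisor sheaves\<close>

lemma ht1_generic: "ht1 {generic} = {}"
  using height_eq_1_iff[OF prime_generic] by (auto simp: height_one_primes_def)

lemma openin_generic: "openin (Spec M) {generic}"
  using openin_down[OF prime_generic] by (simp add: down_generic)

lemma div_sheaf_generic: "sections (div_sheaf D) {generic} = carrier K"
  by (auto simp: div_sheaf_def ht1_generic)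

lemma generic_in_V: "V \<noteq> {} \<Longrightarrow> generic \<in> V"
  using generic_in_open_iff[OF open_V] by simp

lemma stalk_generic: "stalk generic = carrier K"
  unfolding stalk_def by (auto simp: carrier_localization nonabsorb_def[of M] simp del: nonabsorb_closed)

lemma structure_sheaf_generic_surj:
  assumes "g \<in> carrier K"
  obtains \<sigma> where "\<sigma> \<in> carrier (binoid_of \<O> {generic})" "\<sigma> generic = g"
  using structure_sheaf_surj[OF openin_generic, of g] assms stalk_generic by blast

lemma ht1_down_self: "q \<in> ht1 V \<Longrightarrow> q \<in> V \<and> q \<in> ht1 (down q)"
  by (auto simp: height_one_primes_def)

text \<open>Primes strictly below q are generic and hence not of height one. Over
  \<open>down q\<close>, a divisor sheaf is therefore cut out by one inequality.\<close>

lemma ht1_down_eq: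
  assumes q: "q \<in> ht1 V"
  shows "ht1 (down q) = {q}"
proof -
  have pq: "prime_ideal M q" "height M q = 1" using q by (auto simp: height_one_primes_def)
  have "r = q" if r: "prime_ideal M r" "r \<subseteq> q" "height M r = 1" for r
  proof (rule ccontr)
    assume "r \<noteq> q"
    then have "r = generic" using r pq height_eq_1_iff[OF pq(1)] by blast
    then show False using r(3) height_eq_1_iff[OF prime_generic] by simp
  qed
  then show ?thesis using pq by (auto simp: height_one_primes_def)
qed

text \<open>Over the generic point the sections are all of \<open>K\<close>, and scalars take every
  value in \<open>K\<close>; so an isomorphism is there multiplication by the image \<gamma> of the
  unit. Compatibility with restriction extends this to all nonempty open subsets of V.\<close>

lemma div_sheaf_iso_generic:
  assumes V: "V \<noteq> {}" and \<phi>: "oset_iso (spec V) \<O> (div_sheaf D) (div_sheaf E) \<phi>"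
  shows "\<exists>\<gamma>\<in>carrier \<Gamma>. \<forall>U. openin (Spec M) U \<longrightarrow> U \<subseteq> V \<longrightarrow> U \<noteq> {} \<longrightarrow>
    (\<forall>g\<in>sections (div_sheaf D) U. \<phi> U g = \<gamma> \<otimes>\<^bsub>K\<^esub> g)"
proof -
  let ?U = "{generic}"
  have oU: "openin (spec V) ?U"
    using openin_generic generic_in_V[OF V] by (simp add: openin_spec_iff[OF open_V])
  define \<gamma> where "\<gamma> = \<phi> ?U \<one>\<^bsub>K\<^esub>"
  have \<gamma>K: "\<gamma> \<in> carrier K"
    using oset_isoD(5)[OF \<phi> oU, of "\<one>\<^bsub>K\<^esub>"] by (simp add: div_sheaf_generic \<gamma>_def)
  have 1: "\<phi> ?U g = \<gamma> \<otimes>\<^bsub>K\<^esub> g" if g: "g \<in> carrier K" for g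
  proof -
    obtain \<sigma> where \<sigma>: "\<sigma> \<in> carrier (binoid_of \<O> ?U)" "\<sigma> generic = g"
      using structure_sheaf_generic_surj[OF g] .
    have "\<phi> ?U (action (div_sheaf D) ?U \<sigma> \<one>\<^bsub>K\<^esub>) = action (div_sheaf E) ?U \<sigma> \<gamma>"
      unfolding \<gamma>_def by (rule oset_isoD(3)[OF \<phi> oU \<sigma>(1)]) (simp add: div_sheaf_generic)
    then show ?thesis using g \<gamma>K by (simp add: div_sheaf_simps \<sigma>(2) K.m_comm)
  qed
  have "\<one>\<^bsub>K\<^esub> \<noteq> absorb K"
    using \<Gamma>.one_closed by (simp add: diff_group_iff diff_group_one)
  moreover have "\<phi> ?U (absorb K) = absorb K"
    using oset_isoD(2)[OF \<phi> oU] by (simp add: div_sheaf_simps)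
  ultimately have "\<gamma> \<noteq> absorb K"
    using inj_onD[OF bij_betw_imp_inj_on[OF oset_isoD(1)[OF \<phi> oU]], of "\<one>\<^bsub>K\<^esub>" "absorb K"]
    by (auto simp: \<gamma>_def div_sheaf_generic K.absorb_closed)
  then have \<gamma>: "\<gamma> \<in> carrier \<Gamma>" using \<gamma>K by (simp add: diff_group_iff)
  show ?thesis
  proof (intro bexI[OF _ \<gamma>] allI impI ballI)
    fix U g assume U: "openin (Spec M) U" "U \<subseteq> V" "U \<noteq> {}" and g: "g \<in> sections (div_sheaf D) U"
    have UV: "openin (spec V) U" using U by (simp add: openin_spec_iff[OF open_V])
    have "?U \<subseteq> U" using generic_in_open_iff[OF U(1)] U(3) by simp
    then have "\<phi> ?U (res (div_sheaf D) U ?U g) = res (div_sheaf E) U ?U (\<phi> U g)"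
      by (rule oset_isoD(4)[OF \<phi> UV oU _ g])
    then show "\<phi> U g = \<gamma> \<otimes>\<^bsub>K\<^esub> g"
      using 1[OF div_sheaf_closed[OF g]] by (simp add: div_sheaf_simps)
  qed
qed

text \<open>One direction is shifting. For the other, the multiplier \<gamma> is tested over
  \<open>down q\<close>: it must carry the elements of valuation at least -D(q) onto those of
  valuation at least -E(q).\<close>

lemma div_sheaf_isomorphic_iff:
  assumes V: "V \<noteq> {}"
  shows "oset_isomorphic (spec V) \<O> (div_sheaf D) (div_sheaf E) \<longleftrightarrow>
    (\<exists>\<gamma>\<in>carrier \<Gamma>. \<forall>q\<in>ht1 V. D q = E q + valuation M q \<gamma>)"
proof
  assume "\<exists>\<gamma>\<in>carrier \<Gamma>. \<forall>q\<in>ht1 V. D q = E q + valuation M q \<gamma>"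
  then show "oset_isomorphic (spec V) \<O> (div_sheaf D) (div_sheaf E)"
    using div_sheaf_shift[OF open_V subset_refl] unfolding oset_isomorphic_iff by metis
next
  assume "oset_isomorphic (spec V) \<O> (div_sheaf D) (div_sheaf E)"
  then obtain \<phi> where \<phi>: "oset_iso (spec V) \<O> (div_sheaf D) (div_sheaf E) \<phi>"
    by (auto simp: oset_isomorphic_iff)
  obtain \<gamma> where \<gamma>0: "\<gamma> \<in> carrier \<Gamma>"
    "\<forall>U. openin (Spec M) U \<longrightarrow> U \<subseteq> V \<longrightarrow> U \<noteq> {} \<longrightarrow>
      (\<forall>g\<in>sections (div_sheaf D) U. \<phi> U g = \<gamma> \<otimes>\<^bsub>K\<^esub> g)"
    using div_sheaf_iso_generic[OF V \<phi>] by blast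
  note \<gamma> = \<gamma>0(1) \<gamma>0(2)[rule_format]
  have "D q = E q + valuation M q \<gamma>" if q: "q \<in> ht1 V" for q
  proof -
    note q' = ht1_down_self[OF q]
    note dq = down_in_V[OF conjunct1[OF q']]
    have o: "openin (spec V) (down q)" using dq by (simp add: openin_spec_iff[OF open_V])
    have iff: "g \<in> sections (div_sheaf F) (down q) \<longleftrightarrow> 0 \<le> valuation M q g + F q" if "g \<in> carrier \<Gamma>" for g F
      unfolding div_sheaf_sections_iff[OF that] ht1_down_eq[OF q] using dq(4) by simp
    \<comment> \<open>The elements a and b have the least valuations allowed at q by D and by E. The
      image of a gives one inequality, the preimage of b the other.\<close>
    obtain a where a: "a \<in> carrier \<Gamma>" "valuation M q a = - D q"
      using realize[OF conjunct1[OF q'], of "\<lambda>q. - D q"] q' by blast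
    obtain b where b: "b \<in> carrier \<Gamma>" "valuation M q b = - E q"
      using realize[OF conjunct1[OF q'], of "\<lambda>q. - E q"] q' by blast
    have aS: "a \<in> sections (div_sheaf D) (down q)" using iff[OF a(1)] a(2) by simp
    have "\<gamma> \<otimes>\<^bsub>K\<^esub> a \<in> sections (div_sheaf E) (down q)"
      using oset_isoD(5)[OF \<phi> o aS] unfolding \<gamma>(2)[OF dq(1,2,4) aS] .
    then have 1: "0 \<le> valuation M q \<gamma> - D q + E q"
      using iff[of "\<gamma> \<otimes>\<^bsub>K\<^esub> a" E] \<gamma>(1) a valuation_mult[OF q \<gamma>(1) a(1)] by simp
    have "b \<in> sections (div_sheaf E) (down q)" using iff[OF b(1)] b(2) by simp
    then have "b \<in> \<phi> (down q) ` sections (div_sheaf D) (down q)"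
      unfolding bij_betw_imp_surj_on[OF oset_isoD(1)[OF \<phi> o]] .
    then obtain g where g0: "b = \<phi> (down q) g" and g1: "g \<in> sections (div_sheaf D) (down q)"
      by (rule imageE)
    note g = g1 g0[unfolded \<gamma>(2)[OF dq(1,2,4) g1]]
    have gc: "g \<in> carrier \<Gamma>"
      using b(1) g(2) K_mult_in_diff_group_iff[of \<gamma> g] \<gamma>(1) div_sheaf_closed[OF g(1)] by simp
    have "0 \<le> valuation M q g + D q" using iff[OF gc] g(1) by simp
    moreover have "valuation M q \<gamma> + valuation M q g = - E q"
      using valuation_mult[OF q \<gamma>(1) gc] g(2) b(2) by simp
    ultimately show ?thesis using 1 by linarith
  qed
  then show "\<exists>\<gamma>\<in>carrier \<Gamma>. \<forall>q\<in>ht1 V. D q = E q + valuation M q \<gamma>" using \<gamma>(1) by blast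
qed

lemma div_sheaf_cong:
  assumes "\<And>q. q \<in> ht1 V \<Longrightarrow> D q = E q"
  shows "oset_isomorphic (spec V) \<O> (div_sheaf D) (div_sheaf E)"
  unfolding oset_isomorphic_iff
  by (rule exI, rule div_sheaf_shift[OF open_V subset_refl \<Gamma>.one_closed])
    (use assms valuation_one in \<open>simp add: diff_group_one\<close>)

section \<open>Every invertible sheaf comes from a divisor\<close>

lemma down_image: "U \<subseteq> V \<Longrightarrow> W \<in> down ` U \<Longrightarrow> openin (Spec M) W \<and> W \<subseteq> V \<and> W \<noteq> {}"
  by (erule imageE) (simp only: down_in_V(1,2,4) subsetD simp_thms)

lemma Union_down:
  assumes U: "openin (Spec M) U" "U \<subseteq> V"
  shows "\<Union>(down ` U) = U"
proof (rule subset_antisym)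
  show "\<Union>(down ` U) \<subseteq> U" by (rule UN_least) (rule down_subset[OF U(1)])
  show "U \<subseteq> \<Union>(down ` U)"
  proof
    fix x assume x: "x \<in> U"
    then show "x \<in> \<Union>(down ` U)" by (rule UN_I) (rule down_in_V(3)[OF subsetD[OF U(2) x]])
  qed
qed

text \<open>One trivialisation of the generic stalk embeds all sections into \<open>K\<close>. Over
  \<open>down x\<close> this embedding differs from a local trivialisation by a factor a(x), and the
  divisor records the valuations of these factors.\<close>

lemma invertible_sheaf_div_sheaf:
  assumes inv: "invertible_sheaf (spec V) \<O> L"
  shows "\<exists>D. oset_isomorphic (spec V) \<O> L (div_sheaf D)"
proof -
  have sh: "oset_sheaf (spec V) \<O> L" using inv by (simp add: invertible_sheaf_def)
  interpret L: oset_sheaf "spec V" \<O> L by (rule sh)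
  have op: "openin (spec V) U \<longleftrightarrow> openin (Spec M) U \<and> U \<subseteq> V" for U
    by (rule openin_spec_iff[OF open_V])
  let ?G = "{generic}"
  have "\<exists>\<phi>. oset_iso (spec (down x)) \<O> L (div_sheaf (\<lambda>_. 0)) \<phi>" if x: "x \<in> V" for x
  proof -
    obtain U where U: "openin (spec V) U" "x \<in> U" "oset_isomorphic (subtopology (spec V) U) \<O> L (oset_self \<O>)"
      using inv x unfolding invertible_sheaf_def topspace_spec_V by blast
    have U': "openin (Spec M) U" "U \<subseteq> V" using U(1) op by auto
    have dx: "down x \<subseteq> U" by (rule down_subset[OF U'(1) U(2)])
    have "openin (subtopology (spec V) U) (down x)"
      unfolding spec_subset[OF U'(2)] openin_spec_iff[OF U'(1)] using dx down_in_V[OF x] by simp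
    from oset_isomorphic_subtopology[OF U(3) this]
    have "oset_isomorphic (spec (down x)) \<O> L (oset_self \<O>)"
      unfolding spec_subset[OF U'(2)] spec_subset[OF dx] .
    from oset_isomorphic_trans[OF this oset_self_isomorphic(1)[OF down_in_V(1,2)[OF x]]]
    show ?thesis by (simp add: oset_isomorphic_iff)
  qed
  then obtain \<phi> where \<phi>: "\<And>x. x \<in> V \<Longrightarrow> oset_iso (spec (down x)) \<O> L (div_sheaf (\<lambda>_. 0)) (\<phi> x)"
    by metis
  have opd: "openin (spec (down x)) U \<longleftrightarrow> openin (Spec M) U \<and> U \<subseteq> down x" if "x \<in> V" for x U
    by (rule openin_spec_iff[OF down_in_V(1)[OF that]])
  have genU: "generic \<in> U" if "openin (Spec M) U" "U \<noteq> {}" for U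
    using that generic_in_open_iff by blast
  have G_down: "openin (spec (down x)) ?G" if "x \<in> V" for x
    using opd[OF that] openin_generic genU[OF down_in_V(1,4)[OF that]] by simp
  \<comment> \<open>\<tau> is the reference trivialisation of the generic stalk; \<iota> restricts a
    section to the generic point and applies it.\<close>
  define \<tau> where "\<tau> = \<phi> generic ?G"
  define \<iota> where "\<iota> U s = \<tau> (res L U ?G s)" for U s
  have iso_closed: "\<phi> x ?G s \<in> carrier K" if "x \<in> V" "s \<in> sections L ?G" for x s
    using oset_isoD(5)[OF \<phi>[OF that(1)] G_down[OF that(1)] that(2)] by (simp add: div_sheaf_generic)
  have iso_act: "\<phi> x ?G (action L ?G \<sigma> s) = \<sigma> generic \<otimes>\<^bsub>K\<^esub> \<phi> x ?G s"
    if "x \<in> V" "\<sigma> \<in> carrier (binoid_of \<O> ?G)" "s \<in> sections L ?G" for x \<sigma> s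
    using oset_isoD(3)[OF \<phi>[OF that(1)] G_down[OF that(1)] that(2,3)] by (simp add: div_sheaf_simps)
  have iso_inj: "s = t" if "x \<in> V" "s \<in> sections L ?G" "t \<in> sections L ?G" "\<phi> x ?G s = \<phi> x ?G t" for x s t
    using inj_onD[OF bij_betw_imp_inj_on[OF oset_isoD(1)[OF \<phi>[OF that(1)] G_down[OF that(1)]]]] that by blast
  have resG: "res L U ?G s \<in> sections L ?G"
    if "openin (Spec M) U" "U \<subseteq> V" "U \<noteq> {}" "s \<in> sections L U" for U s
    using L.res_closed[of U ?G s] that genU[OF that(1,3)] openin_generic op by auto
  have \<iota>_res: "\<iota> W (res L U W s) = \<iota> U s"
    if U: "openin (Spec M) U" "U \<subseteq> V" and W: "openin (Spec M) W" "W \<subseteq> U" "W \<noteq> {}" and s: "s \<in> sections L U" for U W s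
  proof -
    have "res L W ?G (res L U W s) = res L U ?G s"
      by (rule L.res_comp) (use U W s genU[OF W(1,3)] openin_generic op in auto)
    then show ?thesis by (simp add: \<iota>_def)
  qed
  \<comment> \<open>Two trivialisations of the generic stalk are linear over \<open>K\<close>, so
    they differ by a factor: the value under \<tau> of the section that the trivialisation at x
    sends to the unit.\<close>
  have compare: "\<exists>a\<in>carrier \<Gamma>. \<forall>U s. openin (Spec M) U \<longrightarrow> U \<subseteq> down x \<longrightarrow> U \<noteq> {} \<longrightarrow> s \<in> sections L U \<longrightarrow>
      \<iota> U s = a \<otimes>\<^bsub>K\<^esub> \<phi> x U s" if x: "x \<in> V" for x
  proof -
    have gV: "generic \<in> V" using genU[OF open_V] x by blast
    have "\<one>\<^bsub>K\<^esub> \<in> \<phi> x ?G ` sections L ?G"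
      unfolding bij_betw_imp_surj_on[OF oset_isoD(1)[OF \<phi>[OF x] G_down[OF x]]] div_sheaf_generic by simp
    then obtain e where e0: "\<one>\<^bsub>K\<^esub> = \<phi> x ?G e" and e1: "e \<in> sections L ?G" by (rule imageE)
    note e = e1 e0[symmetric]
    define a where "a = \<tau> e"
    have aK: "a \<in> carrier K" using iso_closed[OF gV e(1)] by (simp add: a_def \<tau>_def)
    have \<tau>_eq: "\<tau> s = a \<otimes>\<^bsub>K\<^esub> \<phi> x ?G s" if s: "s \<in> sections L ?G" for s
    proof -
      obtain \<sigma> where \<sigma>: "\<sigma> \<in> carrier (binoid_of \<O> ?G)" "\<sigma> generic = \<phi> x ?G s"
        using structure_sheaf_generic_surj[OF iso_closed[OF x s]] .
      have cl: "action L ?G \<sigma> e \<in> sections L ?G"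
        by (rule binoid_set.act_closed[OF L.sections_set \<sigma>(1) e(1)])
          (use openin_generic gV op in auto)
      have "s = action L ?G \<sigma> e"
        by (rule iso_inj[OF x s cl]) (use iso_act[OF x \<sigma>(1) e(1)] \<sigma>(2) e(2) iso_closed[OF x s] in simp)
      then have "\<tau> s = \<phi> x ?G s \<otimes>\<^bsub>K\<^esub> a"
        using iso_act[OF gV \<sigma>(1) e(1)] \<sigma>(2) by (simp add: \<tau>_def a_def)
      then show ?thesis using aK iso_closed[OF x s] K.m_comm by simp
    qed
    have ptG: "point L ?G \<in> sections L ?G"
      by (rule binoid_set.pt_closed[OF L.sections_set]) (use openin_generic gV op in auto)
    have "e \<noteq> point L ?G"
      using e(2) oset_isoD(2)[OF \<phi>[OF x] G_down[OF x]] \<Gamma>.one_closed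
      by (auto simp: div_sheaf_simps diff_group_iff diff_group_one)
    moreover have "\<tau> (point L ?G) = absorb K"
      using oset_isoD(2)[OF \<phi>[OF gV] G_down[OF gV]] by (simp add: \<tau>_def div_sheaf_simps)
    ultimately have "a \<noteq> absorb K"
      using iso_inj[OF gV e(1) ptG] by (auto simp: a_def \<tau>_def)
    then have a: "a \<in> carrier \<Gamma>" using aK by (simp add: diff_group_iff)
    have "\<iota> U s = a \<otimes>\<^bsub>K\<^esub> \<phi> x U s"
      if U: "openin (Spec M) U" "U \<subseteq> down x" "U \<noteq> {}" and s: "s \<in> sections L U" for U s
    proof -
      have UV: "U \<subseteq> V" using U(2) down_in_V(2)[OF x] by blast
      have "\<phi> x ?G (res L U ?G s) = res (div_sheaf (\<lambda>_. 0)) U ?G (\<phi> x U s)"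
        by (rule oset_isoD(4)[OF \<phi>[OF x] _ G_down[OF x] _ s]) (use U opd[OF x] genU[OF U(1,3)] in auto)
      then show ?thesis
        unfolding \<iota>_def using \<tau>_eq[OF resG[OF U(1) UV U(3) s]] by (simp add: div_sheaf_simps)
    qed
    then show ?thesis using a by blast
  qed
  then have "\<forall>x\<in>V. \<exists>a. a \<in> carrier \<Gamma> \<and> (\<forall>U s. openin (Spec M) U \<longrightarrow> U \<subseteq> down x \<longrightarrow> U \<noteq> {} \<longrightarrow>
      s \<in> sections L U \<longrightarrow> \<iota> U s = a \<otimes>\<^bsub>K\<^esub> \<phi> x U s)"
    by (simp only: Bex_def Ball_def) simp
  then have "\<exists>a. \<forall>x\<in>V. a x \<in> carrier \<Gamma> \<and> (\<forall>U s. openin (Spec M) U \<longrightarrow> U \<subseteq> down x \<longrightarrow> U \<noteq> {} \<longrightarrow>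
      s \<in> sections L U \<longrightarrow> \<iota> U s = a x \<otimes>\<^bsub>K\<^esub> \<phi> x U s)"
    by (rule bchoice)
  then obtain a where a0: "\<forall>x\<in>V. a x \<in> carrier \<Gamma> \<and> (\<forall>U s. openin (Spec M) U \<longrightarrow> U \<subseteq> down x \<longrightarrow>
      U \<noteq> {} \<longrightarrow> s \<in> sections L U \<longrightarrow> \<iota> U s = a x \<otimes>\<^bsub>K\<^esub> \<phi> x U s)"
    by (rule exE)
  have a: "a x \<in> carrier \<Gamma>" if "x \<in> V" for x using a0 that by simp
  have \<iota>_eq: "\<iota> U s = a x \<otimes>\<^bsub>K\<^esub> \<phi> x U s"
    if "x \<in> V" "openin (Spec M) U" "U \<subseteq> down x" "U \<noteq> {}" "s \<in> sections L U" for x U s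
    using a0 that by simp
  \<comment> \<open>Let q be below x and y. The section over \<open>down q\<close> that the
    trivialisation at y sends to the unit becomes under the one at x an element u of nonnegative
    valuation, and a(x) u = a(y).\<close>
  have le: "valuation M q (a x) \<le> valuation M q (a y)"
    if x: "x \<in> V" and y: "y \<in> V" and q: "q \<in> ht1 V" "q \<subseteq> x" "q \<subseteq> y" for x y q
  proof -
    note q' = ht1_down_self[OF q(1)]
    note dq = down_in_V[OF conjunct1[OF q']]
    have sub: "down q \<subseteq> down x" "down q \<subseteq> down y" using q by auto
    have o: "openin (spec (down x)) (down q)" "openin (spec (down y)) (down q)"
      using opd[OF x] opd[OF y] dq(1) sub by auto
    have "\<one>\<^bsub>K\<^esub> \<in> sections (div_sheaf (\<lambda>_. 0)) (down q)"
      using div_sheaf_sections_iff[of "\<one>\<^bsub>K\<^esub>"] \<Gamma>.one_closed dq(4) ht1_down_eq[OF q(1)] valuation_one[OF q(1)]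
      by (simp add: diff_group_one)
    then have "\<one>\<^bsub>K\<^esub> \<in> \<phi> y (down q) ` sections L (down q)"
      unfolding bij_betw_imp_surj_on[OF oset_isoD(1)[OF \<phi>[OF y] o(2)]] .
    then obtain s where s0: "\<one>\<^bsub>K\<^esub> = \<phi> y (down q) s" and s1: "s \<in> sections L (down q)"
      by (rule imageE)
    note s = s1 s0[symmetric]
    let ?u = "\<phi> x (down q) s"
    have uS: "?u \<in> sections (div_sheaf (\<lambda>_. 0)) (down q)" by (rule oset_isoD(5)[OF \<phi>[OF x] o(1) s(1)])
    have eq: "a x \<otimes>\<^bsub>K\<^esub> ?u = a y"
      using \<iota>_eq[OF x dq(1) sub(1) dq(4) s(1)] \<iota>_eq[OF y dq(1) sub(2) dq(4) s(1)] s(2) a[OF y] by simp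
    have u: "?u \<in> carrier \<Gamma>"
      using K_mult_in_diff_group_iff[of "a x" ?u] eq a[OF x] a[OF y] div_sheaf_closed[OF uS] by simp
    have "0 \<le> valuation M q ?u" using div_sheaf_sections_iff[OF u] uS ht1_down_eq[OF q(1)] by simp
    then show ?thesis using valuation_mult[OF q(1) a[OF x] u] eq by simp
  qed
  \<comment> \<open>By \<open>le\<close> in both directions, all points x above q give the same
    valuation of a(x) at q; the choice x = q represents them. The sign is negative because a(x)
    generates the image of L over \<open>down x\<close>.\<close>
  define D where "D q = - valuation M q (a q)" for q
  have D: "0 = D q + valuation M q (a x)" if x: "x \<in> V" and q: "q \<in> ht1 (down x)" for x q
  proof -
    have qV: "q \<in> ht1 V" "q \<subseteq> x" using ht1_down[OF x] q by auto
    then show ?thesis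
      using le[OF x _ qV(1,2), of q] le[OF _ x qV(1), of q] ht1_down_self[OF qV(1)] by (simp add: D_def)
  qed
  have \<iota>_bij: "bij_betw (\<iota> (down x)) (sections L (down x)) (sections (div_sheaf D) (down x))" if x: "x \<in> V" for x
  proof -
    note dx = down_in_V[OF x]
    have o: "openin (spec (down x)) (down x)" using opd[OF x] dx by simp
    have "oset_iso (spec (down x)) \<O> (div_sheaf (\<lambda>_. 0)) (div_sheaf D) (\<lambda>U g. a x \<otimes>\<^bsub>K\<^esub> g)"
      by (rule div_sheaf_shift[OF dx(1,2) a[OF x] D[OF x]])
    from bij_betw_trans[OF oset_isoD(1)[OF \<phi>[OF x] o] oset_isoD(1)[OF this o]]
    have "bij_betw (\<lambda>s. a x \<otimes>\<^bsub>K\<^esub> \<phi> x (down x) s) (sections L (down x)) (sections (div_sheaf D) (down x))"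
      by (simp add: comp_def)
    then show ?thesis
      by (rule bij_betw_cong[THEN iffD1, rotated]) (use \<iota>_eq[OF x dx(1) subset_refl dx(4)] in simp)
  qed
  have res_down: "res L U (down x) s \<in> sections L (down x)" "\<iota> (down x) (res L U (down x) s) = \<iota> U s"
    if U: "openin (Spec M) U" "U \<subseteq> V" and x: "x \<in> U" and s: "s \<in> sections L U" for U x s
  proof -
    have xV: "x \<in> V" using x U(2) by blast
    have sub: "down x \<subseteq> U" by (rule down_subset[OF U(1) x])
    show "res L U (down x) s \<in> sections L (down x)"
      by (rule L.res_closed) (use U s sub down_in_V[OF xV] op in auto)
    show "\<iota> (down x) (res L U (down x) s) = \<iota> U s"
      by (rule \<iota>_res[OF U _ sub _ s]) (use down_in_V[OF xV] in auto)
  qed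
  \<comment> \<open>Equality under \<iota> gives equality over every \<open>down x\<close>, and
    these sets cover U, so the uniqueness part of gluing applies.\<close>
  have inj: "s = t"
    if U: "openin (Spec M) U" "U \<subseteq> V" and s: "s \<in> sections L U" and t: "t \<in> sections L U" and eq: "\<iota> U s = \<iota> U t" for U s t
  proof -
    let ?\<U> = "down ` U"
    have opU: "openin (spec V) W" if "W \<in> ?\<U>" for W
      using down_image[OF U(2) that] op by simp
    have cov: "\<Union>?\<U> = U" by (rule Union_down[OF U(1,2)])
    have subU: "W \<subseteq> U" if "W \<in> ?\<U>" for W using Union_upper[OF that] unfolding cov .
    have oU: "openin (spec V) U" using U op by simp
    have "\<exists>!r. r \<in> sections L (\<Union>?\<U>) \<and> (\<forall>W\<in>?\<U>. res L (\<Union>?\<U>) W r = res L U W s)"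
    proof (rule L.glue)
      fix W assume W: "W \<in> ?\<U>"
      show "openin (spec V) W" by (rule opU[OF W])
      show "res L U W s \<in> sections L W" by (rule L.res_closed[OF oU opU[OF W] subU[OF W] s])
      fix W' assume W': "W' \<in> ?\<U>"
      have oW: "openin (spec V) (W \<inter> W')" using opU W W' by blast
      show "res L W (W \<inter> W') (res L U W s) = res L W' (W \<inter> W') (res L U W' s)"
        using L.res_comp[OF oU opU[OF W] oW _ subU[OF W] s] L.res_comp[OF oU opU[OF W'] oW _ subU[OF W'] s]
        by simp
    qed
    then have ex1: "\<exists>!r. r \<in> sections L U \<and> (\<forall>W\<in>?\<U>. res L U W r = res L U W s)"
      unfolding cov .
    moreover have "\<forall>W\<in>?\<U>. res L U W t = res L U W s"
    proof (rule ballI)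
      fix W assume "W \<in> ?\<U>"
      then obtain x where x: "x \<in> U" "W = down x" by blast
      then have xV: "x \<in> V" using U(2) by blast
      show "res L U W t = res L U W s"
        unfolding x(2)
        using inj_onD[OF bij_betw_imp_inj_on[OF \<iota>_bij[OF xV]] _ res_down(1)[OF U x(1) t] res_down(1)[OF U x(1) s]]
          res_down(2)[OF U x(1) t] res_down(2)[OF U x(1) s] eq by simp
    qed
    ultimately show "s = t" using s t by blast
  qed
  have into: "\<iota> U s \<in> sections (div_sheaf D) U"
    if U: "openin (Spec M) U" "U \<subseteq> V" "U \<noteq> {}" and s: "s \<in> sections L U" for U s
  proof (rule div_sheaf_local[OF U(1,3)])
    fix x assume x: "x \<in> U"
    have xV: "x \<in> V" using x U(2) by blast
    show "\<iota> U s \<in> sections (div_sheaf D) (down x)"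
      using bij_betwE[OF \<iota>_bij[OF xV], THEN bspec, OF res_down(1)[OF U(1,2) x s]]
      unfolding res_down(2)[OF U(1,2) x s] .
  qed
  \<comment> \<open>Preimages of g exist over the sets \<open>down x\<close>. They agree on overlaps
    because \<iota> is injective there, so they glue.\<close>
  have surj: "\<exists>s\<in>sections L U. \<iota> U s = g"
    if U: "openin (Spec M) U" "U \<subseteq> V" "U \<noteq> {}" and g: "g \<in> sections (div_sheaf D) U" for U g
  proof -
    define \<U> where "\<U> = down ` U"
    note sm = down_image[OF U(2), folded \<U>_def]
    have cov: "\<Union>\<U> = U" unfolding \<U>_def by (rule Union_down[OF U(1,2)])
    have "\<exists>s. s \<in> sections L W \<and> \<iota> W s = g" if W: "W \<in> \<U>" for W
    proof -
      obtain x where x: "x \<in> U" "W = down x" using W unfolding \<U>_def by blast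
      have xV: "x \<in> V" using subsetD[OF U(2) x(1)] .
      have "g \<in> sections (div_sheaf D) (down x)"
        by (rule div_sheaf_mono[OF g down_subset[OF U(1) x(1)] down_in_V(4)[OF xV]])
      then have "g \<in> \<iota> (down x) ` sections L (down x)"
        unfolding bij_betw_imp_surj_on[OF \<iota>_bij[OF xV]] .
      then show ?thesis unfolding x(2) by (rule imageE) (intro exI conjI, assumption, rule sym)
    qed
    then have "\<forall>W\<in>\<U>. \<exists>s. s \<in> sections L W \<and> \<iota> W s = g" by blast
    then have "\<exists>\<sigma>. \<forall>W\<in>\<U>. \<sigma> W \<in> sections L W \<and> \<iota> W (\<sigma> W) = g" by (rule bchoice)
    then obtain \<sigma> where \<sigma>: "\<And>W. W \<in> \<U> \<Longrightarrow> \<sigma> W \<in> sections L W" "\<And>W. W \<in> \<U> \<Longrightarrow> \<iota> W (\<sigma> W) = g"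
      by blast
    have "\<exists>!r. r \<in> sections L (\<Union>\<U>) \<and> (\<forall>W\<in>\<U>. res L (\<Union>\<U>) W r = \<sigma> W)"
    proof (rule L.glue)
      fix W assume W: "W \<in> \<U>"
      show "openin (spec V) W" using sm[OF W] op by blast
      show "\<sigma> W \<in> sections L W" by (rule \<sigma>(1)[OF W])
      fix W' assume W': "W' \<in> \<U>"
      have "openin (Spec M) (W \<inter> W')" "W \<inter> W' \<subseteq> V" using sm[OF W] sm[OF W'] by auto
      moreover have "W \<inter> W' \<noteq> {}" using genU sm[OF W] sm[OF W'] by blast
      moreover have "res L W (W \<inter> W') (\<sigma> W) \<in> sections L (W \<inter> W')"
        by (rule L.res_closed) (use sm[OF W] sm[OF W'] op \<sigma>(1)[OF W] in auto)
      moreover have "res L W' (W \<inter> W') (\<sigma> W') \<in> sections L (W \<inter> W')"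
        by (rule L.res_closed) (use sm[OF W] sm[OF W'] op \<sigma>(1)[OF W'] in auto)
      moreover have "\<iota> (W \<inter> W') (res L W (W \<inter> W') (\<sigma> W)) = g"
        using \<iota>_res[of W "W \<inter> W'" "\<sigma> W"] sm[OF W] \<sigma>[OF W] calculation(1,3) by simp
      moreover have "\<iota> (W \<inter> W') (res L W' (W \<inter> W') (\<sigma> W')) = g"
        using \<iota>_res[of W' "W \<inter> W'" "\<sigma> W'"] sm[OF W'] \<sigma>[OF W'] calculation(1,3) by simp
      ultimately show "res L W (W \<inter> W') (\<sigma> W) = res L W' (W \<inter> W') (\<sigma> W')"
        using inj[of "W \<inter> W'"] by simp
    qed
    then obtain r where r: "r \<in> sections L U" "\<And>W. W \<in> \<U> \<Longrightarrow> res L U W r = \<sigma> W"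
      unfolding cov by blast
    obtain x where x: "x \<in> U" using U(3) by blast
    have dx: "down x \<in> \<U>" unfolding \<U>_def by (rule imageI[OF x])
    have "\<iota> U r = g"
      using res_down(2)[OF U(1,2) x r(1)] unfolding r(2)[OF dx] \<sigma>(2)[OF dx] by (rule sym)
    then show ?thesis using r(1) by blast
  qed
  obtain z where z: "sections L {} = {z}" using oset_sheaf_empty[OF sh] .
  \<comment> \<open>The map \<iota> restricts to the generic point, which the empty set lacks; there
    the only section of the divisor sheaf is taken.\<close>
  define \<psi> where "\<psi> U s = (if U = {} then absorb K else \<iota> U s)" for U s
  have "oset_iso (spec V) \<O> L (div_sheaf D) \<psi>"
  proof (rule oset_isoI, unfold op)
    fix U assume "openin (Spec M) U \<and> U \<subseteq> V"
    then have U: "openin (Spec M) U" "U \<subseteq> V" by auto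
    have oU: "openin (spec V) U" using U op by simp
    show "bij_betw (\<psi> U) (sections L U) (sections (div_sheaf D) U)"
    proof (cases "U = {}")
      case True
      then show ?thesis by (simp add: z \<psi>_def bij_betw_def)
    next
      case False
      have "bij_betw (\<iota> U) (sections L U) (sections (div_sheaf D) U)"
      proof (rule bij_betw_imageI)
        show "inj_on (\<iota> U) (sections L U)" using inj[OF U] by (rule inj_onI)
        show "\<iota> U ` sections L U = sections (div_sheaf D) U"
        proof (rule subset_antisym)
          show "\<iota> U ` sections L U \<subseteq> sections (div_sheaf D) U" using into[OF U False] by (rule image_subsetI)
          show "sections (div_sheaf D) U \<subseteq> \<iota> U ` sections L U"
            using surj[OF U False] by (metis image_eqI subsetI)
        qed
      qed
      moreover have "\<psi> U = \<iota> U" using False by (simp add: \<psi>_def fun_eq_iff)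
      ultimately show ?thesis by simp
    qed
    show "\<psi> U (point L U) = point (div_sheaf D) U"
    proof (cases "U = {}")
      case False
      have gV: "generic \<in> V" using genU[OF U(1) False] U(2) by blast
      have "res L U ?G (point L U) = point L ?G"
        by (rule L.res_point[OF oU]) (use openin_generic gV genU[OF U(1) False] op in auto)
      then show ?thesis
        using oset_isoD(2)[OF \<phi>[OF gV] G_down[OF gV]] False
        by (simp add: \<psi>_def \<iota>_def \<tau>_def div_sheaf_simps)
    qed (simp add: \<psi>_def div_sheaf_simps)
    fix s assume s: "s \<in> sections L U"
    show "\<psi> U (action L U \<sigma> s) = action (div_sheaf D) U \<sigma> (\<psi> U s)" if \<sigma>: "\<sigma> \<in> carrier (binoid_of \<O> U)" for \<sigma>
    proof (cases "U = {}")
      case False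
      have gU: "generic \<in> U" "generic \<in> V" using genU[OF U(1) False] U(2) by auto
      have oG: "openin (spec V) ?G" using openin_generic gU op by simp
      have "res L U ?G (action L U \<sigma> s) = action L ?G (restr \<O> U ?G \<sigma>) (res L U ?G s)"
        by (rule L.res_action[OF oU oG _ \<sigma> s]) (use gU in simp)
      then show ?thesis
        using iso_act[OF gU(2) restr_structure_sheaf_closed[OF \<sigma> openin_generic] resG[OF U False s]] False gU
        by (simp add: \<psi>_def \<iota>_def \<tau>_def div_sheaf_simps restr_generic)
    qed (simp add: \<psi>_def div_sheaf_simps)
    show "\<psi> W (res L U W s) = res (div_sheaf D) U W (\<psi> U s)"
      if W: "openin (Spec M) W \<and> W \<subseteq> V" "W \<subseteq> U" for W
      using \<iota>_res[OF U _ W(2) _ s] W by (auto simp: \<psi>_def div_sheaf_simps)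
  qed
  then show ?thesis by (auto simp: oset_isomorphic_iff)
qed

end

section \<open>The smash product of invertible sheaves\<close>

lemma smash_class_respects:
  assumes "\<And>x y. (x, y) \<in> smash_gen \<O> L K U \<Longrightarrow> f x = f y" and "y \<in> smash_class \<O> L K U x"
  shows "f y = f x"
proof -
  have "(x, y) \<in> (smash_gen \<O> L K U \<union> (smash_gen \<O> L K U)\<inverse>)\<^sup>*"
    using assms(2) by (simp add: smash_class_def)
  then show ?thesis
    by (induction rule: rtrancl_induct) (use assms(1) in auto)
qed

lemma smash_class_refl: "x \<in> smash_class \<O> L K U x"
  by (simp add: smash_class_def)

lemma smash_class_gen:
  assumes "(x, y) \<in> smash_gen \<O> L K U"
  shows "smash_class \<O> L K U x = smash_class \<O> L K U y"
proof -
  let ?R = "smash_gen \<O> L K U \<union> (smash_gen \<O> L K U)\<inverse>"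
  have "(x, y) \<in> ?R\<^sup>*" "(y, x) \<in> ?R\<^sup>*" using assms by blast+
  then show ?thesis unfolding smash_class_def by (auto intro: rtrancl_trans)
qed

text \<open>Restriction and action of \<open>smash_presheaf\<close> are unions over a class. This
  evaluates such a union at any representative once invariance under the generating pairs is
  checked.\<close>

lemma smash_class_UN:
  assumes "\<And>x y. (x, y) \<in> smash_gen \<O> L K U \<Longrightarrow> f x = f y"
  shows "(\<Union>y\<in>smash_class \<O> L K U x. f y) = f x"
proof -
  have "(\<Union>y\<in>smash_class \<O> L K U x. f y) = (\<Union>y\<in>smash_class \<O> L K U x. f x)"
    by (intro SUP_cong refl smash_class_respects[of \<O> L K U f, OF assms])
  also have "\<dots> = f x" using smash_class_refl[of x \<O> L K U] by blast
  finally show ?thesis .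
qed

lemma smash_genE:
  assumes "(x, y) \<in> smash_gen \<O> L K U"
  obtains s where "s \<in> sections L U" "x = (s, point K U)" "y = (point L U, point K U)"
  | t where "t \<in> sections K U" "x = (point L U, t)" "y = (point L U, point K U)"
  | a s t where "a \<in> carrier (binoid_of \<O> U)" "s \<in> sections L U" "t \<in> sections K U"
      "x = (action L U a s, t)" "y = (s, action K U a t)"
  using assms unfolding smash_gen_def by blast

lemma smash_genI:
  "s \<in> sections L U \<Longrightarrow> ((s, point K U), (point L U, point K U)) \<in> smash_gen \<O> L K U"
  "t \<in> sections K U \<Longrightarrow> ((point L U, t), (point L U, point K U)) \<in> smash_gen \<O> L K U"
  "a \<in> carrier (binoid_of \<O> U) \<Longrightarrow> s \<in> sections L U \<Longrightarrow> t \<in> sections K U \<Longrightarrow>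
     ((action L U a s, t), (s, action K U a t)) \<in> smash_gen \<O> L K U"
  unfolding smash_gen_def by blast+

section \<open>The smash presheaf of two sheaves\<close>

locale oset_sheaf_pair =
  L: oset_sheaf X \<O> L + K: oset_sheaf X \<O> K
  for X :: "'x topology" and \<O> :: "('x, 'o) binoid_presheaf"
    and L :: "('x, 'o, 's) oset_presheaf" and K :: "('x, 'o, 't) oset_presheaf" +
  assumes restr_closed: "openin X U \<Longrightarrow> openin X W \<Longrightarrow> W \<subseteq> U \<Longrightarrow> a \<in> carrier (binoid_of \<O> U) \<Longrightarrow>
      restr \<O> U W a \<in> carrier (binoid_of \<O> W)"
begin

abbreviation "F \<equiv> smash_presheaf \<O> L K"
abbreviation "cls \<equiv> smash_class \<O> L K"

lemma sections_smash: "sections F U = cls U ` (sections L U \<times> sections K U)"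
  by (simp add: smash_presheaf_def)

lemma smash_sectionE:
  assumes "c \<in> sections F U"
  obtains s t where "s \<in> sections L U" "t \<in> sections K U" "c = cls U (s, t)"
  using assms unfolding sections_smash by blast

lemma cls_in_sections: "s \<in> sections L U \<Longrightarrow> t \<in> sections K U \<Longrightarrow> cls U (s, t) \<in> sections F U"
  unfolding sections_smash by blast

lemma cls_point1: "s \<in> sections L U \<Longrightarrow> cls U (s, point K U) = cls U (point L U, point K U)"
  by (rule smash_class_gen) (rule smash_genI)

lemma cls_point2: "t \<in> sections K U \<Longrightarrow> cls U (point L U, t) = cls U (point L U, point K U)"
  by (rule smash_class_gen) (rule smash_genI)

lemma cls_action: "a \<in> carrier (binoid_of \<O> U) \<Longrightarrow> s \<in> sections L U \<Longrightarrow> t \<in> sections K U \<Longrightarrow>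
   cls U (action L U a s, t) = cls U (s, action K U a t)"
  by (rule smash_class_gen) (rule smash_genI)

text \<open>Moving a scalar across the product after restriction requires the restricted scalar to
  be a section of the structure sheaf, which is the role of \<open>restr_closed\<close>.\<close>

lemma res_smash:
  assumes U: "openin X U" and W: "openin X W" "W \<subseteq> U"
  shows "res F U W (cls U (s, t)) = cls W (res L U W s, res K U W t)"
proof -
  let ?f = "\<lambda>(s, t). cls W (res L U W s, res K U W t)"
  have "(\<Union>y\<in>cls U (s, t). ?f y) = ?f (s, t)"
  proof (rule smash_class_UN)
    fix x y assume "(x, y) \<in> smash_gen \<O> L K U"
    then show "?f x = ?f y"
    proof (cases rule: smash_genE)
      case (1 s)
      then show ?thesis
        by (simp add: L.res_point[OF U W] K.res_point[OF U W] cls_point1 L.res_closed[OF U W])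
    next
      case (2 t)
      then show ?thesis
        by (simp add: L.res_point[OF U W] K.res_point[OF U W] cls_point2 K.res_closed[OF U W])
    next
      case (3 a s t)
      then show ?thesis
        by (simp add: L.res_action[OF U W] K.res_action[OF U W] L.res_closed[OF U W] K.res_closed[OF U W]
            cls_action restr_closed[OF U W])
    qed
  qed
  then show ?thesis by (simp add: smash_presheaf_def case_prod_beta)
qed

lemma action_smash:
  assumes U: "openin X U" and a: "a \<in> carrier (binoid_of \<O> U)"
  shows "action F U a (cls U (s, t)) = cls U (action L U a s, t)"
proof -
  interpret LU: binoid_set "binoid_of \<O> U" "sections L U" "action L U" "point L U"
    by (rule L.sections_set[OF U])
  interpret KU: binoid_set "binoid_of \<O> U" "sections K U" "action K U" "point K U"
    by (rule K.sections_set[OF U])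
  let ?f = "\<lambda>(s, t). cls U (action L U a s, t)"
  have "(\<Union>y\<in>cls U (s, t). ?f y) = ?f (s, t)"
  proof (rule smash_class_UN)
    fix x y assume "(x, y) \<in> smash_gen \<O> L K U"
    then show "?f x = ?f y"
    proof (cases rule: smash_genE)
      case (1 s)
      then show ?thesis by (simp add: LU.act_pt[OF a] LU.act_closed[OF a] cls_point1)
    next
      case (2 t)
      then show ?thesis by (simp add: LU.act_pt[OF a] cls_point2)
    next
      case (3 b s t)
      \<comment> \<open>The action is defined on the first factor only, so invariance under moving b
        across the product rests on the commutation of a and b.\<close>
      have "action L U a (action L U b s) = action L U b (action L U a s)"
        using 3 a LU.act_mult[of a b s] LU.act_mult[of b a s] LU.m_comm[of a b] by simp
      then show ?thesis using 3 a by (simp add: cls_action LU.act_closed)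
    qed
  qed
  then show ?thesis by (simp add: smash_presheaf_def case_prod_beta)
qed

lemma point_smash: "point F U = cls U (point L U, point K U)"
  by (simp add: smash_presheaf_def)

lemma point_smash_in: "openin X U \<Longrightarrow> point F U \<in> sections F U"
  unfolding point_smash
  by (rule cls_in_sections)
    (rule binoid_set.pt_closed[OF L.sections_set] binoid_set.pt_closed[OF K.sections_set], assumption)+

lemma res_smash_closed:
  "openin X U \<Longrightarrow> openin X W \<Longrightarrow> W \<subseteq> U \<Longrightarrow> c \<in> sections F U \<Longrightarrow> res F U W c \<in> sections F W"
  by (erule smash_sectionE) (simp add: res_smash cls_in_sections L.res_closed K.res_closed)

lemma res_smash_id: "openin X U \<Longrightarrow> c \<in> sections F U \<Longrightarrow> res F U U c = c"
  by (erule smash_sectionE) (simp add: res_smash L.res_id K.res_id)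

lemma res_smash_comp:
  "openin X U \<Longrightarrow> openin X W \<Longrightarrow> openin X T \<Longrightarrow> T \<subseteq> W \<Longrightarrow> W \<subseteq> U \<Longrightarrow> c \<in> sections F U \<Longrightarrow>
     res F W T (res F U W c) = res F U T c"
  by (erule smash_sectionE) (simp add: res_smash L.res_comp K.res_comp)

lemma action_smash_closed:
  "openin X U \<Longrightarrow> a \<in> carrier (binoid_of \<O> U) \<Longrightarrow> c \<in> sections F U \<Longrightarrow> action F U a c \<in> sections F U"
  by (erule smash_sectionE)
    (simp add: action_smash cls_in_sections binoid_set.act_closed[OF L.sections_set])

end

section \<open>Smash products of divisor sheaves\<close>

context regular_spectrum
begin

lemma restr_closed_V:
  "openin (spec V) U \<Longrightarrow> openin (spec V) W \<Longrightarrow> W \<subseteq> U \<Longrightarrow> a \<in> carrier (binoid_of \<O> U) \<Longrightarrow>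
     restr \<O> U W a \<in> carrier (binoid_of \<O> W)"
  using restr_structure_sheaf_closed[of a U W] openin_spec_iff[OF open_V] by simp

lemma div_sheaf_zero_surj:
  assumes U: "openin (Spec M) U" "U \<subseteq> V" "U \<noteq> {}" and h: "h \<in> sections (div_sheaf (\<lambda>_. 0)) U"
  obtains \<sigma> where "\<sigma> \<in> carrier (binoid_of \<O> U)" "\<sigma> generic = h"
proof -
  have "h \<in> stalk x" if x: "x \<in> U" for x
    using h
  proof (cases rule: div_sheaf_cases)
    case 1
    then show ?thesis using absorb_in_stalk[OF openin_Spec_prime[OF U(1) x]] by simp
  next
    case 2
    have "ht1 (down x) \<subseteq> ht1 U" by (rule ht1_mono[OF down_subset[OF U(1) x]])
    then show ?thesis using stalk_iff[of x h, OF subsetD[OF U(2) x] 2(1)] 2(3) by auto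
  qed
  then show ?thesis using structure_sheaf_surj[OF U(1,3), of h] that by blast
qed

text \<open>Over \<open>down p\<close> the sheaf is free on an element with the extreme valuations
  -D(q): it is the shift of the sheaf of the zero divisor, whose sections are the values of
  scalars.\<close>

lemma div_sheaf_down_generator:
  assumes p: "p \<in> V"
  shows "\<exists>\<gamma>\<in>carrier \<Gamma>. (\<forall>q\<in>ht1 (down p). valuation M q \<gamma> = - D q) \<and> \<gamma> \<in> sections (div_sheaf D) (down p) \<and>
    (\<forall>g\<in>sections (div_sheaf D) (down p). \<exists>\<sigma>\<in>carrier (binoid_of \<O> (down p)). g = \<sigma> generic \<otimes>\<^bsub>K\<^esub> \<gamma>)"
proof -
  note dp = down_in_V[OF p]
  obtain \<gamma> where \<gamma>: "\<gamma> \<in> carrier \<Gamma>" "\<forall>q\<in>ht1 (down p). valuation M q \<gamma> = - D q"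
    using realize[OF p, of "\<lambda>q. - D q"] by blast
  have iso: "oset_iso (spec (down p)) \<O> (div_sheaf (\<lambda>_. 0)) (div_sheaf D) (\<lambda>U g. \<gamma> \<otimes>\<^bsub>K\<^esub> g)"
    by (rule div_sheaf_shift[OF dp(1,2) \<gamma>(1)]) (use \<gamma>(2) in simp)
  have o: "openin (spec (down p)) (down p)" using openin_spec_iff[OF dp(1)] dp(1) by simp
  have "\<exists>\<sigma>\<in>carrier (binoid_of \<O> (down p)). g = \<sigma> generic \<otimes>\<^bsub>K\<^esub> \<gamma>"
    if g: "g \<in> sections (div_sheaf D) (down p)" for g
  proof -
    have "g \<in> (\<lambda>g. \<gamma> \<otimes>\<^bsub>K\<^esub> g) ` sections (div_sheaf (\<lambda>_. 0)) (down p)"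
      unfolding bij_betw_imp_surj_on[OF oset_isoD(1)[OF iso o]] by (rule g)
    then obtain h where h: "g = \<gamma> \<otimes>\<^bsub>K\<^esub> h" and h1: "h \<in> sections (div_sheaf (\<lambda>_. 0)) (down p)"
      by (rule imageE)
    obtain \<sigma> where \<sigma>: "\<sigma> \<in> carrier (binoid_of \<O> (down p))" "\<sigma> generic = h"
      using div_sheaf_zero_surj[OF dp(1,2,4) h1] .
    show ?thesis
      by (rule bexI[OF _ \<sigma>(1)]) (use \<sigma>(2) h \<gamma>(1) div_sheaf_closed[OF h1] in \<open>simp add: K.m_comm\<close>)
  qed
  moreover have "\<gamma> \<in> sections (div_sheaf D) (down p)"
    unfolding div_sheaf_sections_iff[OF \<gamma>(1)] using \<gamma>(2) dp(4) by simp
  ultimately show ?thesis using \<gamma> by (intro bexI[OF _ \<gamma>(1)] conjI ballI) blast+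
qed

lemma div_sheaf_mult:
  assumes U: "U \<subseteq> V" and g: "g \<in> sections (div_sheaf D) U" and h: "h \<in> sections (div_sheaf E) U"
  shows "g \<otimes>\<^bsub>K\<^esub> h \<in> sections (div_sheaf (\<lambda>q. D q + E q)) U"
  using g
proof (cases rule: div_sheaf_cases)
  case 1
  then show ?thesis using div_sheaf_closed[OF h] by (simp add: K.absorb_mult)
next
  case g: 2
  show ?thesis
    using h
  proof (cases rule: div_sheaf_cases)
    case 1
    then show ?thesis using g by (simp add: K.absorb_mult_right)
  next
    case h: 2
    have "0 \<le> valuation M q (g \<otimes>\<^bsub>K\<^esub> h) + (D q + E q)" if q: "q \<in> ht1 U" for q
    proof -
      have "q \<in> ht1 V" using ht1_mono[OF U] q by blast
      then have "valuation M q (g \<otimes>\<^bsub>K\<^esub> h) = valuation M q g + valuation M q h"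
        by (rule valuation_mult[OF _ g(1) h(1)])
      moreover have "0 \<le> valuation M q g + D q" "0 \<le> valuation M q h + E q" using g h q by auto
      ultimately show ?thesis by linarith
    qed
    then show ?thesis using g h div_sheaf_sections_iff[of "g \<otimes>\<^bsub>K\<^esub> h"] by simp
  qed
qed

text \<open>A germ of the smash presheaf at \<open>x\<close> is determined by its restriction to \<open>down x\<close>, where both
  factors have a generator and the presheaf is already isomorphic to the expected sheaf; hence the
  sheafification can be computed from these neighbourhoods alone.\<close>

lemma smash_sheaf_div_sheaf:
  assumes L: "oset_sheaf (spec V) \<O> L" "oset_isomorphic (spec V) \<O> L (div_sheaf D)"
    and L': "oset_sheaf (spec V) \<O> L'" "oset_isomorphic (spec V) \<O> L' (div_sheaf E)"
  shows "oset_isomorphic (spec V) \<O> (div_sheaf (\<lambda>q. D q + E q)) (smash_sheaf (spec V) \<O> L L')"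
proof -
  let ?X = "spec V" and ?DE = "div_sheaf (\<lambda>q. D q + E q)"
  interpret oset_sheaf_pair ?X \<O> L L'
    using L(1) L'(1) restr_closed_V
    by (simp add: oset_sheaf_pair_def oset_sheaf_pair_axioms_def)
  have op: "openin ?X U \<longleftrightarrow> openin (Spec M) U \<and> U \<subseteq> V" for U
    by (rule openin_spec_iff[OF open_V])
  obtain \<phi> \<phi>' where \<phi>: "oset_iso ?X \<O> L (div_sheaf D) \<phi>" and \<phi>': "oset_iso ?X \<O> L' (div_sheaf E) \<phi>'"
    using L(2) L'(2) by (auto simp: oset_isomorphic_iff)
  have closed: "\<phi> U s \<in> carrier K" "\<phi>' U t \<in> carrier K"
    if "openin ?X U" "s \<in> sections L U" "t \<in> sections L' U" for U s t
    using oset_isoD(5)[OF \<phi> that(1,2)] oset_isoD(5)[OF \<phi>' that(1,3)] div_sheaf_closed by blast+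
  have gen: "generic \<in> U" if "openin ?X U" "U \<noteq> {}" for U
    using that op generic_in_open_iff by blast
  \<comment> \<open>Multiplication in \<open>K\<close> is the expected identification. It is studied
    on pairs, and \<open>m_gen\<close> allows it to descend to classes.\<close>
  define m where "m U x = \<phi> U (fst x) \<otimes>\<^bsub>K\<^esub> \<phi>' U (snd x)" for U x
  have m_act: "\<phi> U (action L U a s) \<otimes>\<^bsub>K\<^esub> \<phi>' U t = (if U = {} then absorb K else a generic \<otimes>\<^bsub>K\<^esub> m U (s, t))"
    and m_act': "\<phi> U s \<otimes>\<^bsub>K\<^esub> \<phi>' U (action L' U a t) = (if U = {} then absorb K else a generic \<otimes>\<^bsub>K\<^esub> m U (s, t))"
    if U: "openin ?X U" and a: "a \<in> carrier (binoid_of \<O> U)" and s: "s \<in> sections L U" and t: "t \<in> sections L' U"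
    for U a s t
  proof -
    have aK: "a generic \<in> carrier K" if "U \<noteq> {}"
      using structure_sheaf_generic_closed[OF a gen[OF U that]] .
    show "\<phi> U (action L U a s) \<otimes>\<^bsub>K\<^esub> \<phi>' U t = (if U = {} then absorb K else a generic \<otimes>\<^bsub>K\<^esub> m U (s, t))"
      unfolding oset_isoD(3)[OF \<phi> U a s] using closed[OF U s t] aK
      by (cases "U = {}") (simp_all add: div_sheaf_simps m_def K.m_assoc K.absorb_mult)
    show "\<phi> U s \<otimes>\<^bsub>K\<^esub> \<phi>' U (action L' U a t) = (if U = {} then absorb K else a generic \<otimes>\<^bsub>K\<^esub> m U (s, t))"
      unfolding oset_isoD(3)[OF \<phi>' U a t] using closed[OF U s t] aK
      by (cases "U = {}") (simp_all add: div_sheaf_simps m_def K.m_lcomm K.absorb_mult_right)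
  qed
  have m_gen: "m U x = m U y" if U: "openin ?X U" and xy: "(x, y) \<in> smash_gen \<O> L L' U" for U x y
  proof -
    have pts: "point L U \<in> sections L U" "point L' U \<in> sections L' U"
      using binoid_set.pt_closed[OF L.sections_set[OF U]] binoid_set.pt_closed[OF K.sections_set[OF U]] by auto
    have pt: "\<phi> U (point L U) = absorb K" "\<phi>' U (point L' U) = absorb K"
      using oset_isoD(2)[OF \<phi> U] oset_isoD(2)[OF \<phi>' U] by (simp_all add: div_sheaf_simps)
    show ?thesis
      using xy
    proof (cases rule: smash_genE)
      case (1 s)
      then show ?thesis
        using closed[OF U 1(1) pts(2)] by (simp add: m_def pt K.absorb_mult_right K.absorb_closed)
    next
      case (2 t)
      then show ?thesis
        using closed[OF U pts(1) 2(1)] by (simp add: m_def pt K.absorb_mult K.absorb_closed)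
    next
      case (3 a s t)
      show ?thesis unfolding 3(4,5) using m_act[OF U 3(1-3)] m_act'[OF U 3(1-3)] by (simp add: m_def)
    qed
  qed
  define \<mu> where "\<mu> U c = m U (SOME x. x \<in> c)" for U and c :: "('b \<times> 'c) set"
  have \<mu>: "\<mu> U (cls U x) = m U x" if U: "openin ?X U" for U x
  proof -
    have "(SOME y. y \<in> cls U x) \<in> cls U x" by (rule someI[where P = "\<lambda>y. y \<in> cls U x", OF smash_class_refl])
    then show ?thesis
      unfolding \<mu>_def
      by (rule smash_class_respects[of \<O> L L' U "m U", rotated]) (rule m_gen[OF U])
  qed
  have \<mu>_closed: "\<mu> U c \<in> sections ?DE U" if U: "openin ?X U" and c: "c \<in> sections F U" for U c
  proof -
    obtain s t where s: "s \<in> sections L U" "t \<in> sections L' U" "c = cls U (s, t)"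
      using c by (rule smash_sectionE)
    show ?thesis
      unfolding s(3) \<mu>[OF U] m_def fst_conv snd_conv
      by (rule div_sheaf_mult[OF _ oset_isoD(5)[OF \<phi> U s(1)] oset_isoD(5)[OF \<phi>' U s(2)]])
        (use U op in simp)
  qed
  have \<mu>_res: "\<mu> W (res F U W c) = \<mu> U c"
    if U: "openin ?X U" and W: "openin ?X W" "W \<subseteq> U" "W \<noteq> {}" and c: "c \<in> sections F U" for U W c
  proof -
    obtain s t where s: "s \<in> sections L U" "t \<in> sections L' U" "c = cls U (s, t)"
      using c by (rule smash_sectionE)
    show ?thesis
      unfolding s(3) res_smash[OF U W(1,2)] \<mu>[OF U] \<mu>[OF W(1)] m_def fst_conv snd_conv
        oset_isoD(4)[OF \<phi> U W(1,2) s(1)] oset_isoD(4)[OF \<phi>' U W(1,2) s(2)]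
      using W(3) by (simp add: div_sheaf_simps)
  qed
  have \<mu>_action: "\<mu> U (action F U a c) = a generic \<otimes>\<^bsub>K\<^esub> \<mu> U c"
    if U: "openin ?X U" "U \<noteq> {}" and a: "a \<in> carrier (binoid_of \<O> U)" and c: "c \<in> sections F U" for U a c
  proof -
    obtain s t where s: "s \<in> sections L U" "t \<in> sections L' U" "c = cls U (s, t)"
      using c by (rule smash_sectionE)
    show ?thesis
      unfolding s(3) action_smash[OF U(1) a] \<mu>[OF U(1)]
      using m_act[OF U(1) a s(1,2)] U(2) by (simp add: m_def)
  qed
  have \<mu>_point: "\<mu> U (point F U) = absorb K" if U: "openin ?X U" for U
    unfolding point_smash \<mu>[OF U] m_def fst_conv snd_conv oset_isoD(2)[OF \<phi> U] oset_isoD(2)[OF \<phi>' U]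
    by (simp add: div_sheaf_simps K.absorb_mult K.absorb_closed)
  have opd: "openin ?X (down x)" if "x \<in> V" for x using down_in_V[OF that] op by simp
  have \<mu>_bij: "bij_betw (\<mu> (down x)) (sections F (down x)) (sections ?DE (down x))" if x: "x \<in> V" for x
  proof -
    note dx = down_in_V[OF x]
    define U where "U = down x"
    have U: "openin ?X U" "U \<noteq> {}" "openin (Spec M) U" "U \<subseteq> V" unfolding U_def using opd[OF x] dx by auto
    obtain \<gamma> where \<gamma>: "\<gamma> \<in> carrier \<Gamma>" "\<forall>q\<in>ht1 U. valuation M q \<gamma> = - D q" "\<gamma> \<in> sections (div_sheaf D) U"
      "\<forall>g\<in>sections (div_sheaf D) U. \<exists>\<sigma>\<in>carrier (binoid_of \<O> U). g = \<sigma> generic \<otimes>\<^bsub>K\<^esub> \<gamma>"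
      using div_sheaf_down_generator[OF x, of D, folded U_def] by (elim bexE conjE) (rule that)
    obtain \<delta> where \<delta>: "\<delta> \<in> carrier \<Gamma>" "\<forall>q\<in>ht1 U. valuation M q \<delta> = - E q" "\<delta> \<in> sections (div_sheaf E) U"
      "\<forall>g\<in>sections (div_sheaf E) U. \<exists>\<sigma>\<in>carrier (binoid_of \<O> U). g = \<sigma> generic \<otimes>\<^bsub>K\<^esub> \<delta>"
      using div_sheaf_down_generator[OF x, of E, folded U_def] by (elim bexE conjE) (rule that)
    interpret LU: binoid_set "binoid_of \<O> U" "sections L U" "action L U" "point L U"
      by (rule L.sections_set[OF U(1)])
    interpret KU: binoid_set "binoid_of \<O> U" "sections L' U" "action L' U" "point L' U"
      by (rule K.sections_set[OF U(1)])
    have surj: "\<exists>s\<in>sections L U. \<phi> U s = g" if "g \<in> sections (div_sheaf D) U" for g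
      using bij_betw_imp_surj_on[OF oset_isoD(1)[OF \<phi> U(1)]] that by (metis imageE)
    have surj': "\<exists>s\<in>sections L' U. \<phi>' U s = g" if "g \<in> sections (div_sheaf E) U" for g
      using bij_betw_imp_surj_on[OF oset_isoD(1)[OF \<phi>' U(1)]] that by (metis imageE)
    obtain e where e: "e \<in> sections L U" "\<phi> U e = \<gamma>" using surj[OF \<gamma>(3)] by blast
    obtain e' where e': "e' \<in> sections L' U" "\<phi>' U e' = \<delta>" using surj'[OF \<delta>(3)] by blast
    have s_eq: "\<exists>\<sigma>\<in>carrier (binoid_of \<O> U). s = action L U \<sigma> e" if s: "s \<in> sections L U" for s
    proof -
      obtain \<sigma> where \<sigma>: "\<sigma> \<in> carrier (binoid_of \<O> U)" "\<phi> U s = \<sigma> generic \<otimes>\<^bsub>K\<^esub> \<gamma>"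
        using \<gamma>(4) oset_isoD(5)[OF \<phi> U(1) s] by blast
      have "\<phi> U s = \<phi> U (action L U \<sigma> e)"
        unfolding \<sigma>(2) oset_isoD(3)[OF \<phi> U(1) \<sigma>(1) e(1)] e(2) using U(2) by (simp add: div_sheaf_simps)
      then have "s = action L U \<sigma> e"
        by (rule inj_onD[OF bij_betw_imp_inj_on[OF oset_isoD(1)[OF \<phi> U(1)]] _ s LU.act_closed[OF \<sigma>(1) e(1)]])
      then show ?thesis using \<sigma>(1) by blast
    qed
    have t_eq: "\<exists>\<sigma>\<in>carrier (binoid_of \<O> U). t = action L' U \<sigma> e'" if t: "t \<in> sections L' U" for t
    proof -
      obtain \<sigma> where \<sigma>: "\<sigma> \<in> carrier (binoid_of \<O> U)" "\<phi>' U t = \<sigma> generic \<otimes>\<^bsub>K\<^esub> \<delta>"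
        using \<delta>(4) oset_isoD(5)[OF \<phi>' U(1) t] by blast
      have "\<phi>' U t = \<phi>' U (action L' U \<sigma> e')"
        unfolding \<sigma>(2) oset_isoD(3)[OF \<phi>' U(1) \<sigma>(1) e'(1)] e'(2) using U(2) by (simp add: div_sheaf_simps)
      then have "t = action L' U \<sigma> e'"
        by (rule inj_onD[OF bij_betw_imp_inj_on[OF oset_isoD(1)[OF \<phi>' U(1)]] _ t KU.act_closed[OF \<sigma>(1) e'(1)]])
      then show ?thesis using \<sigma>(1) by blast
    qed
    \<comment> \<open>Normal form of a class: both entries are multiples of the generators e and e',
      and the scalar of the second moves to the first. A class is then described by one scalar
      \<rho>, which its generic value determines.\<close>
    have normal: "\<exists>\<rho>\<in>carrier (binoid_of \<O> U). c = cls U (action L U \<rho> e, e')" if c: "c \<in> sections F U" for c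
    proof -
      obtain s t where s: "s \<in> sections L U" "t \<in> sections L' U" "c = cls U (s, t)"
        using c by (rule smash_sectionE)
      obtain \<sigma> where \<sigma>: "\<sigma> \<in> carrier (binoid_of \<O> U)" "s = action L U \<sigma> e" using s_eq[OF s(1)] by blast
      obtain \<tau> where \<tau>: "\<tau> \<in> carrier (binoid_of \<O> U)" "t = action L' U \<tau> e'" using t_eq[OF s(2)] by blast
      have "c = cls U (action L U \<tau> s, e')"
        unfolding s(3) \<tau>(2) by (rule cls_action[symmetric, OF \<tau>(1) s(1) e'(1)])
      also have "action L U \<tau> s = action L U (\<tau> \<otimes>\<^bsub>binoid_of \<O> U\<^esub> \<sigma>) e"
        unfolding \<sigma>(2) by (rule LU.act_mult[symmetric, OF \<tau>(1) \<sigma>(1) e(1)])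
      finally show ?thesis using LU.m_closed[OF \<tau>(1) \<sigma>(1)] by blast
    qed
    have \<mu>_norm: "\<mu> U (cls U (action L U \<rho> e, e')) = (\<gamma> \<otimes>\<^bsub>K\<^esub> \<delta>) \<otimes>\<^bsub>K\<^esub> \<rho> generic"
      if \<rho>: "\<rho> \<in> carrier (binoid_of \<O> U)" for \<rho>
    proof -
      have "\<rho> generic \<in> carrier K" using structure_sheaf_generic_closed[OF \<rho> gen[OF U(1,2)]] .
      then show ?thesis
        unfolding \<mu>[OF U(1)] m_def fst_conv snd_conv m_act[OF U(1) \<rho> e(1) e'(1)]
        using U(2) e(2) e'(2) \<gamma>(1) \<delta>(1) by (simp add: K.m_comm)
    qed
    have \<gamma>\<delta>: "\<gamma> \<otimes>\<^bsub>K\<^esub> \<delta> \<in> carrier \<Gamma>" using \<gamma>(1) \<delta>(1) by simp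
    have val: "valuation M q (\<gamma> \<otimes>\<^bsub>K\<^esub> \<delta>) = - (D q + E q)" if q: "q \<in> ht1 U" for q
    proof -
      have "q \<in> ht1 V" using ht1_mono[OF U(4)] q by blast
      then show ?thesis using valuation_mult[OF _ \<gamma>(1) \<delta>(1)] \<gamma>(2) \<delta>(2) q by simp
    qed
    have shift: "oset_iso (spec U) \<O> (div_sheaf (\<lambda>_. 0)) ?DE (\<lambda>U g. (\<gamma> \<otimes>\<^bsub>K\<^esub> \<delta>) \<otimes>\<^bsub>K\<^esub> g)"
      by (rule div_sheaf_shift[OF U(3,4) \<gamma>\<delta>]) (simp add: val)
    have oUU: "openin (spec U) U" using openin_spec_iff[OF U(3)] U(3) by simp
    have "bij_betw (\<mu> U) (sections F U) (sections ?DE U)"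
    proof (rule bij_betw_imageI)
      show "inj_on (\<mu> U) (sections F U)"
      proof (rule inj_onI)
        fix c d assume c: "c \<in> sections F U" and d: "d \<in> sections F U" and eq: "\<mu> U c = \<mu> U d"
        obtain \<rho> where \<rho>: "\<rho> \<in> carrier (binoid_of \<O> U)" "c = cls U (action L U \<rho> e, e')"
          using normal[OF c] by blast
        obtain \<rho>' where \<rho>': "\<rho>' \<in> carrier (binoid_of \<O> U)" "d = cls U (action L U \<rho>' e, e')"
          using normal[OF d] by blast
        have "\<rho> generic = \<rho>' generic"
          using K_cancel[OF \<gamma>\<delta>] eq \<mu>_norm[OF \<rho>(1)] \<mu>_norm[OF \<rho>'(1)] \<rho>(2) \<rho>'(2)
            structure_sheaf_generic_closed[OF \<rho>(1) gen[OF U(1,2)]]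
            structure_sheaf_generic_closed[OF \<rho>'(1) gen[OF U(1,2)]] by simp
        then have "\<rho> = \<rho>'" by (intro structure_sheaf_eqI[OF U(3) \<rho>(1) \<rho>'(1)])
        then show "c = d" using \<rho>(2) \<rho>'(2) by simp
      qed
      show "\<mu> U ` sections F U = sections ?DE U"
      proof (rule subset_antisym)
        show "\<mu> U ` sections F U \<subseteq> sections ?DE U" by (rule image_subsetI) (rule \<mu>_closed[OF U(1)])
        show "sections ?DE U \<subseteq> \<mu> U ` sections F U"
        proof
          fix g assume "g \<in> sections ?DE U"
          then have "g \<in> (\<lambda>g. (\<gamma> \<otimes>\<^bsub>K\<^esub> \<delta>) \<otimes>\<^bsub>K\<^esub> g) ` sections (div_sheaf (\<lambda>_. 0)) U"
            unfolding bij_betw_imp_surj_on[OF oset_isoD(1)[OF shift oUU]] .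
          then obtain h where h: "g = (\<gamma> \<otimes>\<^bsub>K\<^esub> \<delta>) \<otimes>\<^bsub>K\<^esub> h" and h1: "h \<in> sections (div_sheaf (\<lambda>_. 0)) U"
            by (rule imageE)
          obtain \<rho> where \<rho>: "\<rho> \<in> carrier (binoid_of \<O> U)" "\<rho> generic = h"
            using div_sheaf_zero_surj[OF U(3,4,2) h1] .
          show "g \<in> \<mu> U ` sections F U"
            unfolding h \<rho>(2)[symmetric] \<mu>_norm[OF \<rho>(1), symmetric]
            by (rule imageI[OF cls_in_sections[OF LU.act_closed[OF \<rho>(1) e(1)] e'(1)]])
        qed
      qed
    qed
    then show ?thesis unfolding U_def .
  qed
  \<comment> \<open>The class over \<open>down x\<close> whose product is g; it provides the
    canonical representative of a germ at x.\<close>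
  define cx where "cx x g = inv_into (sections F (down x)) (\<mu> (down x)) g" for x g
  have cx: "cx x g \<in> sections F (down x)" "\<mu> (down x) (cx x g) = g"
    if "x \<in> V" "g \<in> sections ?DE (down x)" for x g
  proof -
    have "g \<in> \<mu> (down x) ` sections F (down x)"
      unfolding bij_betw_imp_surj_on[OF \<mu>_bij[OF that(1)]] by (rule that(2))
    then show "cx x g \<in> sections F (down x)" "\<mu> (down x) (cx x g) = g"
      unfolding cx_def by (rule inv_into_into, rule f_inv_into_f)
  qed
  have cxI: "c = cx x g" if "x \<in> V" "c \<in> sections F (down x)" "\<mu> (down x) c = g" for x c g
    unfolding cx_def using bij_betw_inv_into_left[OF \<mu>_bij[OF that(1)] that(2)] that(3) by simp
  have ldown: "down x \<subseteq> W" if "openin ?X W" "x \<in> W" for x W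
    using down_subset that op by blast
  have inV: "x \<in> V" if "openin ?X W" "x \<in> W" for x W using that op by blast
  have germ_eq: "germ ?X F x W c = {(W', c'). openin ?X W' \<and> x \<in> W' \<and> c' \<in> sections F W' \<and>
      res F W (down x) c = res F W' (down x) c'}"
    if W: "openin ?X W" "x \<in> W" and c: "c \<in> sections F W" for x W c
  proof -
    have xV: "x \<in> V" by (rule inV[OF W])
    have iff: "(\<exists>T. openin ?X T \<and> x \<in> T \<and> T \<subseteq> W \<inter> W' \<and> res F W T c = res F W' T c') \<longleftrightarrow>
        res F W (down x) c = res F W' (down x) c'"
      if W': "openin ?X W'" "x \<in> W'" and c': "c' \<in> sections F W'" for W' c'
    proof
      assume "\<exists>T. openin ?X T \<and> x \<in> T \<and> T \<subseteq> W \<inter> W' \<and> res F W T c = res F W' T c'"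
      then obtain T where T: "openin ?X T" "x \<in> T" "T \<subseteq> W" "T \<subseteq> W'" "res F W T c = res F W' T c'" by blast
      show "res F W (down x) c = res F W' (down x) c'"
        using res_smash_comp[OF W(1) T(1) opd[OF xV] ldown[OF T(1,2)] T(3) c]
          res_smash_comp[OF W'(1) T(1) opd[OF xV] ldown[OF T(1,2)] T(4) c'] T(5) by simp
    next
      assume "res F W (down x) c = res F W' (down x) c'"
      then show "\<exists>T. openin ?X T \<and> x \<in> T \<and> T \<subseteq> W \<inter> W' \<and> res F W T c = res F W' T c'"
        using opd[OF xV] down_in_V(3)[OF xV] ldown[OF W] ldown[OF W']
        by (intro exI[of _ "down x"]) blast
    qed
    show ?thesis
      unfolding germ_def by (rule Collect_cong, rule prod.case_cong[OF refl], intro conj_cong refl iff)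
  qed
  have germ_cong: "germ ?X F x W c = germ ?X F x W' c'"
    if "openin ?X W" "x \<in> W" "c \<in> sections F W" "openin ?X W'" "x \<in> W'" "c' \<in> sections F W'"
      "res F W (down x) c = res F W' (down x) c'" for x W c W' c'
    unfolding germ_eq[OF that(1-3)] germ_eq[OF that(4-6)] that(7) ..
  have germ_res: "germ ?X F x W c = germ ?X F x (down x) (res F W (down x) c)"
    if W: "openin ?X W" "x \<in> W" and c: "c \<in> sections F W" for x W c
  proof -
    have xV: "x \<in> V" by (rule inV[OF W])
    have rc: "res F W (down x) c \<in> sections F (down x)"
      by (rule res_smash_closed[OF W(1) opd[OF xV] ldown[OF W] c])
    show ?thesis
      by (rule germ_cong[OF W c opd[OF xV] down_in_V(3)[OF xV] rc])
        (rule res_smash_id[symmetric, OF opd[OF xV] rc])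
  qed
  \<comment> \<open>A germ at x thus depends only on the product in \<open>K\<close> of any class
    representing it.\<close>
  have germ_cx: "germ ?X F x W c = germ ?X F x (down x) (cx x (\<mu> W c))"
    if W: "openin ?X W" "x \<in> W" and c: "c \<in> sections F W" for x W c
  proof -
    have xV: "x \<in> V" by (rule inV[OF W])
    have "res F W (down x) c = cx x (\<mu> W c)"
      by (rule cxI[OF xV res_smash_closed[OF W(1) opd[OF xV] ldown[OF W] c]
            \<mu>_res[OF W(1) opd[OF xV] ldown[OF W] down_in_V(4)[OF xV] c]])
    then show ?thesis using germ_res[OF W c] by simp
  qed
  have germ_self: "(W, c) \<in> germ ?X F x W c" if "openin ?X W" "x \<in> W" "c \<in> sections F W" for x W c
    unfolding germ_eq[OF that] using that by simp
  have germ_cx_inj: "g = h" if x: "x \<in> V" and g: "g \<in> sections ?DE (down x)" "h \<in> sections ?DE (down x)"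
    and eq: "germ ?X F x (down x) (cx x g) = germ ?X F x (down x) (cx x h)" for x g h
  proof -
    note d = opd[OF x] down_in_V(3)[OF x]
    have "(down x, cx x g) \<in> germ ?X F x (down x) (cx x h)"
      unfolding eq[symmetric] by (rule germ_self[OF d cx(1)[OF x g(1)]])
    then have "res F (down x) (down x) (cx x h) = res F (down x) (down x) (cx x g)"
      unfolding germ_eq[OF d cx(1)[OF x g(2)]] by simp
    then have "cx x h = cx x g"
      unfolding res_smash_id[OF d(1) cx(1)[OF x g(2)]] res_smash_id[OF d(1) cx(1)[OF x g(1)]] .
    then show ?thesis using cx(2)[OF x g(1)] cx(2)[OF x g(2)] by simp
  qed
  have secd: "g \<in> sections ?DE (down x)" if "openin ?X U" "x \<in> U" "g \<in> sections ?DE U" for U x g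
    by (rule div_sheaf_mono[OF that(3) ldown[OF that(1,2)] down_in_V(4)[OF inV[OF that(1,2)]]])
  define \<Phi> where "\<Phi> U g = (\<lambda>x\<in>U. germ ?X F x (down x) (cx x g))" for U g
  let ?S = "smash_sheaf ?X \<O> L L'"
  have sec_S: "sections ?S U = {\<sigma> \<in> extensional U. \<forall>x\<in>U. \<exists>W s.
          openin ?X W \<and> x \<in> W \<and> W \<subseteq> U \<and> s \<in> sections F W \<and> (\<forall>y\<in>W. \<sigma> y = germ ?X F y W s)}" for U
    by (simp add: smash_sheaf_def sheafify_def)
  have \<Phi>_down: "\<Phi> U g y = germ ?X F y (down x) (cx x g)"
    if U: "openin ?X U" and x: "x \<in> U" and y: "y \<in> down x" and g: "g \<in> sections ?DE U" for U g x y
  proof -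
    have xV: "x \<in> V" by (rule inV[OF U x])
    have yU: "y \<in> U" using ldown[OF U x] y by blast
    show ?thesis
      using germ_cx[OF opd[OF xV] y cx(1)[OF xV secd[OF U x g]]] yU
      unfolding cx(2)[OF xV secd[OF U x g]] by (simp add: \<Phi>_def)
  qed
  have \<Phi>_closed: "\<Phi> U g \<in> sections ?S U" if U: "openin ?X U" and g: "g \<in> sections ?DE U" for U g
  proof -
    have "\<exists>W s. openin ?X W \<and> x \<in> W \<and> W \<subseteq> U \<and> s \<in> sections F W \<and> (\<forall>y\<in>W. \<Phi> U g y = germ ?X F y W s)"
      if x: "x \<in> U" for x
    proof -
      have xV: "x \<in> V" by (rule inV[OF U x])
      have "\<forall>y\<in>down x. \<Phi> U g y = germ ?X F y (down x) (cx x g)"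
        by (rule ballI) (rule \<Phi>_down[OF U x _ g])
      then show ?thesis
        using opd[OF xV] down_in_V(3)[OF xV] ldown[OF U x] cx(1)[OF xV secd[OF U x g]] by blast
    qed
    moreover have "\<Phi> U g \<in> extensional U" by (simp add: \<Phi>_def)
    ultimately show ?thesis unfolding sec_S by blast
  qed
  have "oset_iso ?X \<O> ?DE ?S \<Phi>"
  proof (rule oset_isoI)
    fix U assume U: "openin ?X U"
    show "bij_betw (\<Phi> U) (sections ?DE U) (sections ?S U)"
    proof (rule bij_betw_imageI)
      show "inj_on (\<Phi> U) (sections ?DE U)"
      proof (rule inj_onI)
        fix g h assume g: "g \<in> sections ?DE U" and h: "h \<in> sections ?DE U" and eq: "\<Phi> U g = \<Phi> U h"
        show "g = h"
        proof (cases "U = {}")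
          case True
          then show ?thesis using g h by simp
        next
          case False
          then obtain x where x: "x \<in> U" by blast
          show ?thesis
            by (rule germ_cx_inj[OF inV[OF U x] secd[OF U x g] secd[OF U x h]])
              (use fun_cong[OF eq, of x] x in \<open>simp add: \<Phi>_def\<close>)
        qed
      qed
      show "\<Phi> U ` sections ?DE U = sections ?S U"
      proof (rule subset_antisym)
        show "\<Phi> U ` sections ?DE U \<subseteq> sections ?S U" by (rule image_subsetI) (rule \<Phi>_closed[OF U])
        show "sections ?S U \<subseteq> \<Phi> U ` sections ?DE U"
        proof
          fix \<sigma> assume \<sigma>: "\<sigma> \<in> sections ?S U"
          show "\<sigma> \<in> \<Phi> U ` sections ?DE U"
          proof (cases "U = {}")
            case True
            then have "\<sigma> = \<Phi> U (absorb K)" using \<sigma> by (simp add: sec_S \<Phi>_def restrict_def)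
            then show ?thesis by (rule image_eqI) simp
          next
            case False
            have loc: "\<exists>W s. openin ?X W \<and> x \<in> W \<and> W \<subseteq> U \<and> s \<in> sections F W \<and> (\<forall>y\<in>W. \<sigma> y = germ ?X F y W s)"
              if "x \<in> U" for x
              using \<sigma> that unfolding sec_S by blast
            have gU: "generic \<in> U" by (rule gen[OF U False])
            obtain W0 s0 where W0: "openin ?X W0" "generic \<in> W0" "s0 \<in> sections F W0"
              "\<sigma> generic = germ ?X F generic W0 s0" using loc[OF gU] by blast
            \<comment> \<open>The element g is read off at the generic point. It governs the germs
              at every other x too, since a local representative around x also determines the germ
              at the generic point.\<close>
            define g where "g = \<mu> W0 s0"
            have key: "g \<in> sections ?DE (down x) \<and> \<sigma> x = germ ?X F x (down x) (cx x g)" if x: "x \<in> U" for x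
            proof -
              obtain W s where W: "openin ?X W" "x \<in> W" "s \<in> sections F W" "\<forall>y\<in>W. \<sigma> y = germ ?X F y W s"
                using loc[OF x] by blast
              have gW: "generic \<in> W" using gen[OF W(1)] W(2) by blast
              have gV: "generic \<in> V" by (rule inV[OF W(1) gW])
              have "\<mu> W s = g"
                unfolding g_def
              proof (rule germ_cx_inj[OF gV])
                show "\<mu> W s \<in> sections ?DE (down generic)" by (rule secd[OF W(1) gW \<mu>_closed[OF W(1,3)]])
                show "\<mu> W0 s0 \<in> sections ?DE (down generic)" by (rule secd[OF W0(1,2) \<mu>_closed[OF W0(1,3)]])
                show "germ ?X F generic (down generic) (cx generic (\<mu> W s)) =
                    germ ?X F generic (down generic) (cx generic (\<mu> W0 s0))"
                  using germ_cx[OF W(1) gW W(3)] germ_cx[OF W0(1-3)] W(4) gW W0(4) by simp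
              qed
              then show ?thesis
                using secd[OF W(1,2) \<mu>_closed[OF W(1,3)]] germ_cx[OF W(1-3)] bspec[OF W(4) W(2)] by simp
            qed
            have "g \<in> sections ?DE U"
              by (rule div_sheaf_local) (use U op False key in blast)+
            moreover have "\<sigma> = \<Phi> U g"
              by (rule extensionalityI[of _ U]) (use \<sigma> key in \<open>simp_all add: sec_S \<Phi>_def\<close>)
            ultimately show ?thesis by (rule image_eqI[rotated])
          qed
        qed
      qed
    qed
    show "\<Phi> U (point ?DE U) = point ?S U"
    proof -
      have "germ ?X F x (down x) (cx x (absorb K)) = germ ?X F x U (point F U)" if x: "x \<in> U" for x
        using germ_cx[OF U x point_smash_in[OF U]] \<mu>_point[OF U] by simp
      then show ?thesis
        by (simp add: \<Phi>_def div_sheaf_simps smash_sheaf_def sheafify_def cong: restrict_cong)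
    qed
    fix g assume g: "g \<in> sections ?DE U"
    show "\<Phi> U (action ?DE U a g) = action ?S U a (\<Phi> U g)" if a: "a \<in> carrier (binoid_of \<O> U)" for a
    proof -
      have "germ ?X F x (down x) (cx x (action ?DE U a g)) =
          (\<Union>(W, s)\<in>germ ?X F x (down x) (cx x g).
            germ ?X F x (U \<inter> W) (action F (U \<inter> W) (restr \<O> U (U \<inter> W) a) (res F W (U \<inter> W) s)))" (is "?l = ?r")
        if x: "x \<in> U" for x
      proof -
        have xV: "x \<in> V" by (rule inV[OF U x])
        note d = opd[OF xV] down_in_V(3)[OF xV]
        note cg = cx[OF xV secd[OF U x g]]
        have Une: "U \<noteq> {}" using x by blast
        \<comment> \<open>All representatives of the germ have product g, so acting on any of them
          gives the product that belongs to the left-hand side; the union in \<open>sheafify\<close>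
          therefore has a single value.\<close>
        have *: "germ ?X F x (U \<inter> W) (action F (U \<inter> W) (restr \<O> U (U \<inter> W) a) (res F W (U \<inter> W) s)) = ?l"
          if "(W, s) \<in> germ ?X F x (down x) (cx x g)" for W s
        proof -
          have W: "openin ?X W" "x \<in> W" "s \<in> sections F W"
            and eq: "res F (down x) (down x) (cx x g) = res F W (down x) s"
            using that unfolding germ_eq[OF d cg(1)] by blast+
          have UW: "openin ?X (U \<inter> W)" "x \<in> U \<inter> W" "U \<inter> W \<subseteq> U" "U \<inter> W \<subseteq> W" "U \<inter> W \<noteq> {}"
            using U W x by auto
          have a': "restr \<O> U (U \<inter> W) a \<in> carrier (binoid_of \<O> (U \<inter> W))"
            by (rule restr_closed[OF U UW(1,3) a])
          have s': "res F W (U \<inter> W) s \<in> sections F (U \<inter> W)"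
            by (rule res_smash_closed[OF W(1) UW(1,4) W(3)])
          have "\<mu> W s = \<mu> (down x) (res F W (down x) s)"
            by (rule \<mu>_res[symmetric, OF W(1) d(1) ldown[OF W(1,2)] down_in_V(4)[OF xV] W(3)])
          also have "\<dots> = g" unfolding eq[symmetric] res_smash_id[OF d(1) cg(1)] by (rule cg(2))
          finally have "\<mu> (U \<inter> W) (res F W (U \<inter> W) s) = g"
            using \<mu>_res[OF W(1) UW(1,4,5) W(3)] by simp
          then have "\<mu> (U \<inter> W) (action F (U \<inter> W) (restr \<O> U (U \<inter> W) a) (res F W (U \<inter> W) s)) = action ?DE U a g"
            unfolding \<mu>_action[OF UW(1,5) a' s'] restr_generic[OF gen[OF UW(1,5)]]
            using Une by (simp add: div_sheaf_simps)
          then show ?thesis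
            using germ_cx[OF UW(1,2) action_smash_closed[OF UW(1) a' s']] by simp
        qed
        have "?r = (\<Union>_\<in>germ ?X F x (down x) (cx x g). ?l)"
          by (rule SUP_cong) (use * in auto)
        moreover have "germ ?X F x (down x) (cx x g) \<noteq> {}" using germ_self[OF d cg(1)] by blast
        ultimately show ?thesis by simp
      qed
      then show ?thesis
        by (simp add: \<Phi>_def smash_sheaf_def sheafify_def cong: restrict_cong)
    qed
    show "\<Phi> W (res ?DE U W g) = res ?S U W (\<Phi> U g)" if W: "openin ?X W" "W \<subseteq> U" for W
      using W(2) by (auto simp: \<Phi>_def smash_sheaf_def sheafify_def div_sheaf_simps restrict_def fun_eq_iff)
  qed
  then show ?thesis by (auto simp: oset_isomorphic_iff)
qed

end

section \<open>The Picard group and the divisor class group\<close>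

text \<open>Every axiom for images is the image of the axiom in G. Preservation of the unit is a
  premise, since it cannot be derived while H is merely a structure with a product.\<close>

lemma group_of_surjective_hom:
  assumes G: "group G" and h: "h \<in> hom G H" "h ` carrier G = carrier H" "h \<one>\<^bsub>G\<^esub> = \<one>\<^bsub>H\<^esub>"
  shows "group H"
proof -
  interpret G: group G by (rule G)
  have mult: "h x \<otimes>\<^bsub>H\<^esub> h y = h (x \<otimes>\<^bsub>G\<^esub> y)" if "x \<in> carrier G" "y \<in> carrier G" for x y
    using hom_mult[OF h(1) that] by simp
  have pre: "\<exists>a\<in>carrier G. x = h a" if "x \<in> carrier H" for x
    using that unfolding h(2)[symmetric] by blast
  have cl: "h a \<in> carrier H" if "a \<in> carrier G" for a
    using hom_in_carrier[OF h(1) that] .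
  show ?thesis
  proof (rule groupI)
    fix x y z assume "x \<in> carrier H" "y \<in> carrier H" "z \<in> carrier H"
    then obtain a b c where abc: "a \<in> carrier G" "b \<in> carrier G" "c \<in> carrier G" "x = h a" "y = h b" "z = h c"
      using pre by metis
    show "x \<otimes>\<^bsub>H\<^esub> y \<in> carrier H" using abc by (simp add: mult cl)
    show "x \<otimes>\<^bsub>H\<^esub> y \<otimes>\<^bsub>H\<^esub> z = x \<otimes>\<^bsub>H\<^esub> (y \<otimes>\<^bsub>H\<^esub> z)" using abc by (simp add: mult G.m_assoc)
  next
    show "\<one>\<^bsub>H\<^esub> \<in> carrier H" unfolding h(3)[symmetric] by (rule cl[OF G.one_closed])
    fix x assume "x \<in> carrier H"
    then obtain a where a: "a \<in> carrier G" "x = h a" using pre by blast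
    show "\<one>\<^bsub>H\<^esub> \<otimes>\<^bsub>H\<^esub> x = x" unfolding h(3)[symmetric] using a by (simp add: mult)
    have "h (inv\<^bsub>G\<^esub> a) \<otimes>\<^bsub>H\<^esub> x = \<one>\<^bsub>H\<^esub>" unfolding h(3)[symmetric] using a by (simp add: mult)
    then show "\<exists>y\<in>carrier H. y \<otimes>\<^bsub>H\<^esub> x = \<one>\<^bsub>H\<^esub>" using cl[of "inv\<^bsub>G\<^esub> a"] a(1) by auto
  qed
qed

lemma lookup_sum_frag:
  assumes "finite S"
  shows "Poly_Mapping.lookup (\<Sum>q\<in>S. frag_cmul (f q) (frag_of q)) r = (if r \<in> S then f r else 0)"
proof -
  have "Poly_Mapping.lookup (\<Sum>q\<in>S. frag_cmul (f q) (frag_of q)) r = (\<Sum>q\<in>S. if r = q then f q else 0)"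
    unfolding lookup_sum by (rule sum.cong) (auto simp: when_def)
  then show ?thesis using assms by (simp add: sum.delta)
qed

section \<open>Countability of the difference group\<close>

context fg_cancellative_domain
begin

text \<open>The values of finite words in the generators, together with the absorbing element, form
  a submonoid containing the generators, hence all of M.\<close>

lemma countable_carrier: "countable (carrier M)"
proof -
  define H where "H = insert (absorb M) ((\<lambda>l. foldr (\<otimes>) l \<one>) ` lists generators)"
  have cl: "foldr (\<otimes>) l \<one> \<in> carrier M" if "l \<in> lists generators" for l
    using that generators(2) by (induction l) auto
  have app: "foldr (\<otimes>) l \<one> \<otimes> foldr (\<otimes>) k \<one> = foldr (\<otimes>) (l @ k) \<one>"
    if "l \<in> lists generators" "k \<in> lists generators" for l k
    using that(1)
  proof (induction l)
    case Nil
    then show ?case using cl[OF that(2)] by simp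
  next
    case (Cons a l)
    then show ?case using cl[OF that(2)] cl[of l] generators(2) by (auto simp: m_assoc)
  qed
  have "H = carrier M"
  proof (rule generators(3))
    show "submonoid H M"
    proof (rule submonoid.intro)
      show "H \<subseteq> carrier M" using cl absorb_closed by (auto simp: H_def)
      have "foldr (\<otimes>) [] \<one> \<in> (\<lambda>l. foldr (\<otimes>) l \<one>) ` lists generators" by (rule imageI) simp
      then show "\<one> \<in> H" by (simp add: H_def)
      fix x y assume "x \<in> H" "y \<in> H"
      then consider "x = absorb M" "y \<in> carrier M" | "y = absorb M" "x \<in> carrier M"
        | l k where "l \<in> lists generators" "k \<in> lists generators" "x = foldr (\<otimes>) l \<one>" "y = foldr (\<otimes>) k \<one>"
        using cl absorb_closed unfolding H_def by blast
      then show "x \<otimes> y \<in> H"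
      proof cases
        case 3
        have "l @ k \<in> lists generators" using 3(1,2) by simp
        then show ?thesis unfolding 3(3,4) app[OF 3(1,2)] H_def by blast
      qed (simp_all add: absorb_mult absorb_mult_right H_def)
    qed
    show "generators \<subseteq> H"
    proof
      fix a assume a: "a \<in> generators"
      then have "foldr (\<otimes>) [a] \<one> \<in> (\<lambda>l. foldr (\<otimes>) l \<one>) ` lists generators" by (intro imageI) simp
      moreover have "foldr (\<otimes>) [a] \<one> = a" using a generators(2) by auto
      ultimately show "a \<in> H" by (simp add: H_def)
    qed
  qed (simp add: H_def)
  moreover have "countable H"
    unfolding H_def using countable_finite[OF generators(1)] by simp
  ultimately show ?thesis by simp
qed

lemma countable_K: "countable (carrier K)"
proof -
  have "carrier K \<subseteq> (\<lambda>(a, s). quo a s) ` (carrier M \<times> carrier M)"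
    unfolding carrier_localization by auto
  moreover have "countable ((\<lambda>(a, s). quo a s) ` (carrier M \<times> carrier M))"
    using countable_carrier by simp
  ultimately show ?thesis by (rule countable_subset)
qed

end

section \<open>Classes of divisor sheaves in the Picard group\<close>

context regular_spectrum
begin

text \<open>Over empty V there are no primes of height one and all divisor sheaves are isomorphic,
  so the criterion holds there as well.\<close>

lemma div_sheaf_isomorphic_iff_principal:
  "oset_isomorphic (spec V) \<O> (div_sheaf D) (div_sheaf E) \<longleftrightarrow>
    (\<exists>\<gamma>\<in>carrier \<Gamma>. \<forall>q\<in>ht1 V. D q = E q + valuation M q \<gamma>)"
proof (cases "V = {}")
  case True
  then have "ht1 V = {}" by (simp add: height_one_primes_def)
  then show ?thesis using div_sheaf_cong[of D E] \<Gamma>.one_closed by auto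
qed (rule div_sheaf_isomorphic_iff)

lemma oset_isomorphic_sym_invertible:
  "invertible_sheaf X \<O>' L \<Longrightarrow> oset_isomorphic X \<O>' L N \<Longrightarrow> oset_isomorphic X \<O>' N L"
  by (rule oset_isomorphic_sym) (simp_all add: invertible_sheaf_def)

text \<open>All sections lie in the countable set \<open>K\<close>, which embeds in every infinite
  type.\<close>

lemma div_sheaf_representable:
  assumes "infinite (UNIV :: 's set)"
  obtains N :: "('a set, 'a set \<Rightarrow> ('a \<times> 'a) set, 's) oset_presheaf"
  where "invertible_sheaf (spec V) \<O> N" "oset_isomorphic (spec V) \<O> N (div_sheaf D)"
proof -
  obtain f :: "nat \<Rightarrow> 's" where f: "inj f" using infinite_countable_subset[OF assms] by blast
  define j where "j = f \<circ> to_nat_on (carrier K)"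
  have "inj_on j (carrier K)"
    unfolding j_def by (rule comp_inj_on[OF inj_on_to_nat_on[OF countable_K]])
      (rule inj_on_subset[OF f subset_UNIV])
  then have "inj_on j (sections (div_sheaf D) U)" for U
    by (rule inj_on_subset) (use div_sheaf_closed in blast)
  then have iso: "oset_isomorphic (spec V) \<O> (div_sheaf D) (transport_oset j (div_sheaf D))"
    by (rule transport_oset_isomorphic)
  show ?thesis
    by (rule that[OF invertible_sheaf_isomorphic[OF invertible_div_sheaf iso restr_closed_V]
          oset_isomorphic_sym_invertible[OF invertible_div_sheaf iso]])
qed

text \<open>The class of O(D) in \<open>Pic\<close>. Since \<open>div_sheaf D\<close> has its
  sections in a fixed type of its own, the class is described by the sheaves over the chosen type
  that are isomorphic to it.\<close>

definition pic_class ::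
  "('a set \<Rightarrow> int) \<Rightarrow> ('a set, 'a set \<Rightarrow> ('a \<times> 'a) set, 's) oset_presheaf set" where
  "pic_class D = {N. invertible_sheaf (spec V) \<O> N \<and> oset_isomorphic (spec V) \<O> N (div_sheaf D)}"

lemma pic_class_nonempty:
  assumes "infinite (UNIV :: 's set)"
  shows "(pic_class D :: ('a set, 'a set \<Rightarrow> ('a \<times> 'a) set, 's) oset_presheaf set) \<noteq> {}"
  using div_sheaf_representable[OF assms, of D] unfolding pic_class_def by blast

lemma pic_class_image:
  fixes N :: "('a set, 'a set \<Rightarrow> ('a \<times> 'a) set, 's) oset_presheaf"
  assumes N: "invertible_sheaf (spec V) \<O> N" "oset_isomorphic (spec V) \<O> N (div_sheaf D)"
  shows "{(L, K). invertible_sheaf (spec V) \<O> L \<and> invertible_sheaf (spec V) \<O> K \<and>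
      oset_isomorphic (spec V) \<O> L K} `` {N} = (pic_class D :: ('a set, 'a set \<Rightarrow> ('a \<times> 'a) set, 's) oset_presheaf set)"
proof -
  have "oset_isomorphic (spec V) \<O> N L \<longleftrightarrow> oset_isomorphic (spec V) \<O> L (div_sheaf D)"
    if L: "invertible_sheaf (spec V) \<O> L" for L :: "('a set, 'a set \<Rightarrow> ('a \<times> 'a) set, 's) oset_presheaf"
    using oset_isomorphic_sym_invertible[OF N(1)] oset_isomorphic_sym_invertible[OF L]
      oset_isomorphic_sym_invertible[OF invertible_div_sheaf] N(2) oset_isomorphic_trans by meson
  then show ?thesis using N by (auto simp: pic_class_def)
qed

lemma carrier_Pic:
  assumes "infinite (UNIV :: 's set)"
  shows "carrier (Pic (spec V) \<O> TYPE('s)) = range pic_class"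
proof (intro subset_antisym subsetI)
  fix A assume "A \<in> carrier (Pic (spec V) \<O> TYPE('s))"
  then obtain N :: "('a set, 'a set \<Rightarrow> ('a \<times> 'a) set, 's) oset_presheaf"
    where N: "invertible_sheaf (spec V) \<O> N"
      "A = {(L, K :: ('a set, 'a set \<Rightarrow> ('a \<times> 'a) set, 's) oset_presheaf). invertible_sheaf (spec V) \<O> L \<and> invertible_sheaf (spec V) \<O> K \<and>
          oset_isomorphic (spec V) \<O> L K} `` {N}"
    by (auto simp: Pic_def elim!: quotientE)
  obtain D where "oset_isomorphic (spec V) \<O> N (div_sheaf D)"
    using invertible_sheaf_div_sheaf[OF N(1)] by blast
  then have "A = pic_class D" unfolding N(2) by (rule pic_class_image[OF N(1)])
  then show "A \<in> range pic_class" by blast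
next
  fix A :: "('a set, 'a set \<Rightarrow> ('a \<times> 'a) set, 's) oset_presheaf set" assume "A \<in> range pic_class"
  then obtain D where A: "A = pic_class D" by blast
  obtain N :: "('a set, 'a set \<Rightarrow> ('a \<times> 'a) set, 's) oset_presheaf"
    where N: "invertible_sheaf (spec V) \<O> N" "oset_isomorphic (spec V) \<O> N (div_sheaf D)"
    using div_sheaf_representable[OF assms] .
  show "A \<in> carrier (Pic (spec V) \<O> TYPE('s))"
    unfolding A pic_class_image[OF N, symmetric] Pic_def partial_object.simps
    by (rule quotientI) (simp add: N(1))
qed

text \<open>Equal classes share a member, because classes over an infinite type are nonempty; this
  member links the two divisor sheaves.\<close>

lemma pic_class_eq_iff:
  assumes "infinite (UNIV :: 's set)"
  shows "(pic_class D :: ('a set, 'a set \<Rightarrow> ('a \<times> 'a) set, 's) oset_presheaf set) = pic_class E \<longleftrightarrow>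
    oset_isomorphic (spec V) \<O> (div_sheaf D) (div_sheaf E)"
proof
  assume eq: "(pic_class D :: ('a set, 'a set \<Rightarrow> ('a \<times> 'a) set, 's) oset_presheaf set) = pic_class E"
  obtain N :: "('a set, 'a set \<Rightarrow> ('a \<times> 'a) set, 's) oset_presheaf" where N: "N \<in> pic_class D"
    using pic_class_nonempty[OF assms, of D] by blast
  then have "invertible_sheaf (spec V) \<O> N" "oset_isomorphic (spec V) \<O> N (div_sheaf D)"
    "oset_isomorphic (spec V) \<O> N (div_sheaf E)"
    unfolding eq using N by (auto simp: pic_class_def)
  then show "oset_isomorphic (spec V) \<O> (div_sheaf D) (div_sheaf E)"
    using oset_isomorphic_sym_invertible oset_isomorphic_trans by blast
next
  assume DE: "oset_isomorphic (spec V) \<O> (div_sheaf D) (div_sheaf E)"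
  note ED = oset_isomorphic_sym_invertible[OF invertible_div_sheaf DE]
  show "pic_class D = pic_class E"
    unfolding pic_class_def using oset_isomorphic_trans[OF _ DE] oset_isomorphic_trans[OF _ ED] by blast
qed

lemma one_Pic: "\<one>\<^bsub>Pic (spec V) \<O> TYPE('s)\<^esub> = pic_class (\<lambda>_. 0)"
  unfolding pic_class_def Pic_def monoid.simps
  using oset_isomorphic_trans[OF _ oset_self_isomorphic(1)[OF open_V subset_refl]]
    oset_isomorphic_trans[OF _ oset_self_isomorphic(2)[OF open_V subset_refl]] by blast

text \<open>A member of the product is isomorphic to a smash product of members, hence to the sheaf
  of the sum. The converse needs actual representatives of both factors, whence the infinite
  type.\<close>

lemma mult_Pic:
  assumes "infinite (UNIV :: 's set)"
  shows "pic_class D \<otimes>\<^bsub>Pic (spec V) \<O> TYPE('s)\<^esub> pic_class E = pic_class (\<lambda>q. D q + E q)"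
proof -
  have smash: "oset_isomorphic (spec V) \<O> (div_sheaf (\<lambda>q. D q + E q)) (smash_sheaf (spec V) \<O> L L')"
    if "L \<in> pic_class D" "L' \<in> pic_class E" for L L' :: "('a set, 'a set \<Rightarrow> ('a \<times> 'a) set, 's) oset_presheaf"
    using that by (intro smash_sheaf_div_sheaf) (auto simp: pic_class_def invertible_sheaf_def)
  obtain L0 L0' :: "('a set, 'a set \<Rightarrow> ('a \<times> 'a) set, 's) oset_presheaf"
    where L0: "L0 \<in> pic_class D" "L0' \<in> pic_class E"
    using pic_class_nonempty[OF assms] by blast
  show ?thesis
  proof (intro subset_antisym subsetI)
    fix N :: "('a set, 'a set \<Rightarrow> ('a \<times> 'a) set, 's) oset_presheaf"
    assume "N \<in> pic_class D \<otimes>\<^bsub>Pic (spec V) \<O> TYPE('s)\<^esub> pic_class E"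
    then obtain L L' :: "('a set, 'a set \<Rightarrow> ('a \<times> 'a) set, 's) oset_presheaf"
      where N: "invertible_sheaf (spec V) \<O> N" "L \<in> pic_class D" "L' \<in> pic_class E"
      "oset_isomorphic (spec V) \<O> N (smash_sheaf (spec V) \<O> L L')"
      by (auto simp: Pic_def)
    have "oset_isomorphic (spec V) \<O> (smash_sheaf (spec V) \<O> L L') (div_sheaf (\<lambda>q. D q + E q))"
      by (rule oset_isomorphic_sym_invertible[OF invertible_div_sheaf smash[OF N(2,3)]])
    then show "N \<in> pic_class (\<lambda>q. D q + E q)"
      using N(1) oset_isomorphic_trans[OF N(4)] by (simp add: pic_class_def)
  next
    fix N :: "('a set, 'a set \<Rightarrow> ('a \<times> 'a) set, 's) oset_presheaf"
    assume "N \<in> pic_class (\<lambda>q. D q + E q)"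
    then have N: "invertible_sheaf (spec V) \<O> N" "oset_isomorphic (spec V) \<O> N (div_sheaf (\<lambda>q. D q + E q))"
      by (auto simp: pic_class_def)
    then show "N \<in> pic_class D \<otimes>\<^bsub>Pic (spec V) \<O> TYPE('s)\<^esub> pic_class E"
      using L0 oset_isomorphic_trans[OF N(2) smash[OF L0]] by (auto simp: Pic_def)
  qed
qed

lemma principal_divisor_lookup:
  "Poly_Mapping.lookup (principal_divisor M V \<gamma>) q = (if q \<in> ht1 V then valuation M q \<gamma> else 0)"
  unfolding principal_divisor_def by (rule lookup_sum_frag[OF finite_ht1])

text \<open>The first isomorphism theorem for the map that sends a divisor to the class of its
  sheaf; comparison with the zero divisor identifies its kernel with the principal divisors.\<close>

theorem Pic_iso_Cl:
  assumes inf: "infinite (UNIV :: 's set)"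
  shows "group (Pic (spec V) \<O> TYPE('s)) \<and> Pic (spec V) \<O> TYPE('s) \<cong> Cl M V"
proof -
  let ?P = "Pic (spec V) \<O> TYPE('s)"
  define \<Psi> where "\<Psi> x = (pic_class (Poly_Mapping.lookup x) ::
      ('a set, 'a set \<Rightarrow> ('a \<times> 'a) set, 's) oset_presheaf set)"
    for x :: "'a set \<Rightarrow>\<^sub>0 int"
  have Div: "group (Div M V)" by (simp add: Div_def)
  have hom: "\<Psi> \<in> hom (Div M V) ?P"
  proof (rule homI)
    fix x y :: "'a set \<Rightarrow>\<^sub>0 int"
    have "Poly_Mapping.lookup (x + y) = (\<lambda>q. Poly_Mapping.lookup x q + Poly_Mapping.lookup y q)"
      by (simp add: fun_eq_iff lookup_add)
    then show "\<Psi> (x \<otimes>\<^bsub>Div M V\<^esub> y) = \<Psi> x \<otimes>\<^bsub>?P\<^esub> \<Psi> y"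
      by (simp add: Div_def \<Psi>_def mult_Pic[OF inf])
  qed (simp add: \<Psi>_def carrier_Pic[OF inf])
  have onto: "\<Psi> ` carrier (Div M V) = carrier ?P"
    unfolding carrier_Pic[OF inf]
  proof (intro subset_antisym subsetI)
    fix A :: "('a set, 'a set \<Rightarrow> ('a \<times> 'a) set, 's) oset_presheaf set" assume "A \<in> range pic_class"
    then obtain D where A: "A = pic_class D" by blast
    \<comment> \<open>An arbitrary function D is cut down to the primes of height one in V, which
      does not change its sheaf up to isomorphism.\<close>
    define x where "x = (\<Sum>q\<in>ht1 V. frag_cmul (D q) (frag_of q))"
    have lx: "Poly_Mapping.lookup x q = (if q \<in> ht1 V then D q else 0)" for q
      unfolding x_def by (rule lookup_sum_frag[OF finite_ht1])
    have "x \<in> carrier (Div M V)"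
      unfolding Div_def carrier_free_Abelian_group_iff by (auto simp: in_keys_iff lx split: if_splits)
    moreover have "A = \<Psi> x"
      unfolding A \<Psi>_def pic_class_eq_iff[OF inf] by (rule div_sheaf_cong) (simp add: lx)
    ultimately show "A \<in> \<Psi> ` carrier (Div M V)" by blast
  qed (auto simp: \<Psi>_def)
  have one: "\<Psi> \<one>\<^bsub>Div M V\<^esub> = \<one>\<^bsub>?P\<^esub>"
    by (simp add: Div_def \<Psi>_def one_Pic zero_poly_mapping.rep_eq)
  have P: "group ?P" by (rule group_of_surjective_hom[OF Div hom onto one])
  interpret \<Psi>: group_hom "Div M V" ?P \<Psi>
    using Div P hom by (simp add: group_hom_def group_hom_axioms_def)
  have "kernel (Div M V) ?P \<Psi> = Prin M V"
  proof -
    have "x \<in> carrier (Div M V) \<and> \<Psi> x = \<one>\<^bsub>?P\<^esub> \<longleftrightarrow> (\<exists>\<gamma>\<in>carrier \<Gamma>. x = principal_divisor M V \<gamma>)" for x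
    proof -
      have "\<Psi> x = \<one>\<^bsub>?P\<^esub> \<longleftrightarrow> (\<exists>\<gamma>\<in>carrier \<Gamma>. \<forall>q\<in>ht1 V. Poly_Mapping.lookup x q = valuation M q \<gamma>)"
        unfolding \<Psi>_def one_Pic pic_class_eq_iff[OF inf] div_sheaf_isomorphic_iff_principal by simp
      \<comment> \<open>Divisors vanish away from the primes of height one in V, so agreement at
        these primes is equality.\<close>
      moreover have "x \<in> carrier (Div M V) \<and> (\<forall>q\<in>ht1 V. Poly_Mapping.lookup x q = valuation M q \<gamma>) \<longleftrightarrow>
          x = principal_divisor M V \<gamma>" for \<gamma>
        unfolding Div_def carrier_free_Abelian_group_iff poly_mapping_eq_iff fun_eq_iff principal_divisor_lookup
        by (auto simp: in_keys_iff split: if_splits)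
      ultimately show ?thesis by blast
    qed
    then show ?thesis unfolding kernel_def Prin_def by blast
  qed
  then have iso: "Cl M V \<cong> ?P"
    using \<Psi>.FactGroup_iso[OF onto] by (simp add: Cl_def)
  have "group (Cl M V)"
    unfolding Cl_def \<open>kernel (Div M V) ?P \<Psi> = Prin M V\<close>[symmetric]
    by (rule normal.factorgroup_is_group[OF \<Psi>.normal_kernel])
  then show ?thesis using P group.iso_sym[OF _ iso] by blast
qed

end

theorem proposition1p128:
  fixes M :: "'a binoid" and V :: "'a set set"
  assumes "binoid M"
    and "finitely_generated_binoid M"
    and "integral_binoid M"
    and "cancellative_binoid M"
    and "torsion_free_binoid M"
    and "regular_in_codim_one M"
    and "openin (Spec M) V"
    and "\<forall>p\<in>V. regular_binoid (localization_at M p)"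
    and "infinite (UNIV :: 's set)"
  shows "group (Pic (subtopology (Spec M) V) (structure_sheaf M) TYPE('s)) \<and>
         Pic (subtopology (Spec M) V) (structure_sheaf M) TYPE('s) \<cong> Cl M V"
proof -
  interpret regular_spectrum M V
    using assms
    by (simp add: regular_spectrum_def regular_spectrum_axioms_def fg_cancellative_domain_def
        fg_cancellative_domain_axioms_def cancellative_domain_def cancellative_domain_axioms_def)
  show ?thesis by (rule Pic_iso_Cl[OF assms(9)])
qed

end
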